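(* Let $(\Gamma,S)$ be a Coxeter system (with $S$ finite) that is non-spherical, non-affine and of dimension at most $2$. If the Euler characteristic of its nerve satisfies $\chi(L(\Gamma,S))\geq 1$, then the growth rate $\tau(\Gamma,S)$ is a Pisot number. Moreover, there exists a sequence of Coxeter systems $(\Gamma_n,S_n)$ with $\chi(L(\Gamma_n,S_n))=0$ such that the growth rates $\tau(\Gamma_n,S_n)$ converge to $\tau(\Gamma,S)$ from below (that is, $\tau(\Gamma_n,S_n)\le\tau(\Gamma,S)$ for all $n$ and $\lim_{n\to\infty}\tau(\Gamma_n,S_n)=\tau(\Gamma,S)$).
   Context: A Coxeter system $(\Gamma,S)$ of rank $N$ is a group $\Gamma$ with generating set $S=\{s_1,\dots,s_N\}$ and presentation $\langle s_1,\dots,s_N \mid (s_is_j)^{k_{ij}},\ 1\le i,j\le N\rangle$, where $k_{ii}=1$ and $k_{ij}=k_{ji}\in\{2,3,\dots\}\cup\{\infty\}$ for $i\neq j$; $k_{ij}$ is the order of $s_is_j$, and $k_{ij}=\infty$ means that there is no relation. The cosine matrix $C=(c_{ij})\in M_N(\mathbb{R})$ has $c_{ij}=-\cos(\pi/k_{ij})$ if $k_{ij}<\infty$ and $c_{ij}=-1$ if $k_{ij}=\infty$. The system is spherical if $C$ is positive definite and affine if $C$ is positive semidefinite; thus non-spherical and non-affine means that $C$ is not positive semidefinite. The nerve $L(\Gamma,S)$ is the abstract simplicial complex with vertex set $S$ in which a nonempty subset $T\subset S$ spans a simplex (of dimension $\#T-1$) if and only if the subgroup $\Gamma_T$ generated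 by $T$ is finite. $\chi(L(\Gamma,S))$ denotes its Euler characteristic. The dimension of $(\Gamma,S)$ is $\dim L(\Gamma,S)+1$, i.e. the maximal cardinality of a subset of $S$ generating a finite subgroup. If the dimension is at most $2$, $L(\Gamma,S)$ is a graph, with an edge between $s_i\ne s_j$ exactly when $k_{ij}<\infty$, and $\chi(L(\Gamma,S))$ is its number of vertices minus its number of edges. The growth rate is $\tau(\Gamma,S)=\limsup_{\ell\to\infty}\sqrt[\ell]{a_\ell}$, where $a_\ell$ is the number of elements of $\Gamma$ of word length $\ell$ with respect to $S$. A Pisot number is a real algebraic integer $\tau>1$ such that $\tau$ is an integer or all of its other Galois conjugates lie in the open unit disk. *)

theory Defs
  imports
    Complex_Main
    "HOL-Library.Extended_Nat"
    "HOL-Library.Extended_Real"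
    "HOL-Computational_Algebra.Polynomial"
    "HOL-Algebra.Generated_Groups"
begin

section \<open>Group presentations\<close>

text \<open>
  A signed letter \<open>(s, True)\<close> stands for the generator \<open>s\<close>, and \<open>(s, False)\<close> for its formal
  inverse.
\<close>

type_synonym 'a signed_word = "('a \<times> bool) list"

definition signed_words :: "'a set \<Rightarrow> 'a signed_word set" where
  "signed_words S = lists (S \<times> UNIV)"

definition word_eval :: "('a, 'b) monoid_scheme \<Rightarrow> 'a signed_word \<Rightarrow> 'a" where
  "word_eval G w =
     foldr (\<lambda>(s, b) g. (if b then s else inv\<^bsub>G\<^esub> s) \<otimes>\<^bsub>G\<^esub> g) w \<one>\<^bsub>G\<^esub>"

text \<open>
  Two words are equivalent iff they represent the same element of \<open>\<langle>S | R\<rangle>\<close>, i.e. the same element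
  of the free group on \<open>S\<close> modulo the normal closure of \<open>R\<close>.
\<close>

inductive pres_equiv :: "'a set \<Rightarrow> 'a signed_word set \<Rightarrow> 'a signed_word \<Rightarrow> 'a signed_word \<Rightarrow> bool"
  for S :: "'a set" and R :: "'a signed_word set"
where
  refl: "u \<in> signed_words S \<Longrightarrow> pres_equiv S R u u"
| sym: "pres_equiv S R u v \<Longrightarrow> pres_equiv S R v u"
| trans: "pres_equiv S R u v \<Longrightarrow> pres_equiv S R v w \<Longrightarrow> pres_equiv S R u w"
| cancel: "u \<in> signed_words S \<Longrightarrow> v \<in> signed_words S \<Longrightarrow> s \<in> S \<Longrightarrow>
    pres_equiv S R (u @ [(s, b), (s, \<not> b)] @ v) (u @ v)"
| relator: "u \<in> signed_words S \<Longrightarrow> v \<in> signed_words S \<Longrightarrow> r \<in> R \<Longrightarrow> r \<in> signed_words S \<Longrightarrow>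
    pres_equiv S R (u @ r @ v) (u @ v)"

definition presented_by ::
    "('a, 'b) monoid_scheme \<Rightarrow> 'a set \<Rightarrow> 'a signed_word set \<Rightarrow> bool" where
  "presented_by G S R \<longleftrightarrow>
     group G \<and> S \<subseteq> carrier G \<and> generate G S = carrier G \<and>
     (\<forall>u \<in> signed_words S. \<forall>v \<in> signed_words S.
        word_eval G u = word_eval G v \<longleftrightarrow> pres_equiv S R u v)"

section \<open>Coxeter systems\<close>

definition coxeter_matrix :: "'a set \<Rightarrow> ('a \<Rightarrow> 'a \<Rightarrow> enat) \<Rightarrow> bool" where
  "coxeter_matrix S k \<longleftrightarrow>
     (\<forall>s \<in> S. k s s = 1) \<and>
     (\<forall>s \<in> S. \<forall>t \<in> S. s \<noteq> t \<longrightarrow> k s t = k t s \<and> 2 \<le> k s t)"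

definition coxeter_relators :: "'a set \<Rightarrow> ('a \<Rightarrow> 'a \<Rightarrow> enat) \<Rightarrow> 'a signed_word set" where
  "coxeter_relators S k =
     {concat (replicate n [(s, True), (t, True)]) | s t n. s \<in> S \<and> t \<in> S \<and> k s t = enat n}"

text \<open>
  The matrix \<open>k\<close> is determined on \<open>S\<close> by the group: it follows from the presentation that \<open>k s t\<close>
  is the order of \<open>s t\<close>.
\<close>

definition coxeter_system ::
    "('a, 'b) monoid_scheme \<Rightarrow> 'a set \<Rightarrow> ('a \<Rightarrow> 'a \<Rightarrow> enat) \<Rightarrow> bool" where
  "coxeter_system G S k \<longleftrightarrow>
     finite S \<and> coxeter_matrix S k \<and> presented_by G S (coxeter_relators S k)"

definition cosine_matrix :: "('a \<Rightarrow> 'a \<Rightarrow> enat) \<Rightarrow> 'a \<Rightarrow> 'a \<Rightarrow> real" where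
  "cosine_matrix k s t = (case k s t of enat n \<Rightarrow> - cos (pi / real n) | \<infinity> \<Rightarrow> - 1)"

definition pos_definite_on :: "'a set \<Rightarrow> ('a \<Rightarrow> 'a \<Rightarrow> real) \<Rightarrow> bool" where
  "pos_definite_on S C \<longleftrightarrow>
     (\<forall>x :: 'a \<Rightarrow> real. (\<exists>s \<in> S. x s \<noteq> 0) \<longrightarrow> (\<Sum>s\<in>S. \<Sum>t\<in>S. x s * C s t * x t) > 0)"

definition pos_semidefinite_on :: "'a set \<Rightarrow> ('a \<Rightarrow> 'a \<Rightarrow> real) \<Rightarrow> bool" where
  "pos_semidefinite_on S C \<longleftrightarrow>
     (\<forall>x :: 'a \<Rightarrow> real. (\<Sum>s\<in>S. \<Sum>t\<in>S. x s * C s t * x t) \<ge> 0)"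

definition coxeter_spherical :: "'a set \<Rightarrow> ('a \<Rightarrow> 'a \<Rightarrow> enat) \<Rightarrow> bool" where
  "coxeter_spherical S k \<longleftrightarrow> pos_definite_on S (cosine_matrix k)"

definition coxeter_affine :: "'a set \<Rightarrow> ('a \<Rightarrow> 'a \<Rightarrow> enat) \<Rightarrow> bool" where
  "coxeter_affine S k \<longleftrightarrow> pos_semidefinite_on S (cosine_matrix k)"

section \<open>Nerve, dimension and growth rate\<close>

definition nerve :: "('a, 'b) monoid_scheme \<Rightarrow> 'a set \<Rightarrow> 'a set set" where
  "nerve G S = {T. T \<subseteq> S \<and> T \<noteq> {} \<and> finite (generate G T)}"

text \<open>A simplex \<open>T\<close> has dimension \<open>card T - 1\<close>; simplices are nonempty finite sets.\<close>

definition euler_characteristic :: "'a set set \<Rightarrow> int" where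
  "euler_characteristic K = (\<Sum>T\<in>K. (-1) ^ (card T - 1))"

text \<open>
  This is one more than the dimension of the nerve. The empty set is included among the candidates,
  so that the trivial system with \<open>S = {}\<close> has dimension \<open>0\<close>.
\<close>

definition coxeter_dim :: "('a, 'b) monoid_scheme \<Rightarrow> 'a set \<Rightarrow> nat" where
  "coxeter_dim G S = Max (card ` insert {} (nerve G S))"

definition word_length :: "('a, 'b) monoid_scheme \<Rightarrow> 'a set \<Rightarrow> 'a \<Rightarrow> nat" where
  "word_length G S g =
     (LEAST n. \<exists>w \<in> signed_words S. length w = n \<and> word_eval G w = g)"

definition sphere_size :: "('a, 'b) monoid_scheme \<Rightarrow> 'a set \<Rightarrow> nat \<Rightarrow> nat" where
  "sphere_size G S l = card {g \<in> carrier G. word_length G S g = l}"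

text \<open>
  For finite \<open>S\<close> the sequence of roots is bounded, so the limit superior is a finite extended real
  and the conversion to \<^typ>\<open>real\<close> loses nothing.
\<close>

definition growth_rate :: "('a, 'b) monoid_scheme \<Rightarrow> 'a set \<Rightarrow> real" where
  "growth_rate G S =
     real_of_ereal (limsup (\<lambda>l. ereal (root l (real (sphere_size G S l)))))"

section \<open>Pisot numbers\<close>

text \<open>
  Two complex numbers are Galois conjugate (over the rationals) iff they are roots of the same
  irreducible rational polynomial, i.e. iff they have the same minimal polynomial.
\<close>

definition galois_conjugate :: "complex \<Rightarrow> complex \<Rightarrow> bool" where
  "galois_conjugate x z \<longleftrightarrow>
     (\<exists>p :: rat poly. irreducible p \<and>
        poly (map_poly of_rat p) x = 0 \<and> poly (map_poly of_rat p) z = 0)"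

definition pisot_number :: "real \<Rightarrow> bool" where
  "pisot_number \<tau> \<longleftrightarrow>
     algebraic_int \<tau> \<and> \<tau> > 1 \<and>
     (\<tau> \<in> \<int> \<or> (\<forall>z. galois_conjugate (of_real \<tau>) z \<and> z \<noteq> of_real \<tau> \<longrightarrow> norm z < 1))"

end

theory Submission
  imports
    Defs
    "HOL-Complex_Analysis.Complex_Analysis"
begin

text \<open>
  Write \<open>N\<close> for the number of generators, let \<open>e\<close> run through the edges of the nerve, with labels \<open>k\<^sub>e\<close>,
  and put \<open>[k](w) = 1 + w + \<dots> + w\<^bsup>k-1\<^esup>\<close>. The growth series \<open>f\<close> satisfies
  \<open>(1 + w) / f(w) = F(w)\<close> with \<open>F(w) = 1 + w - N w + \<Sum>\<^sub>e w\<^bsup>k\<^sub>e\<^esup> / [k\<^sub>e](w)\<close>.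
  This is the inclusion-exclusion \<open>\<Sum> (-1)\<^bsup>card T\<^esup> = 0\<close> over the sets \<open>T\<close> of right descents of a
  nontrivial element: a set of descents generates a finite subgroup, so in dimension at most 2 it has
  at most two elements; the elements with a given descent are counted by pairing \<open>g\<close> with \<open>g s\<close>, and
  those with two given descents \<open>s\<close>, \<open>t\<close> are the longest elements of the cosets of the dihedral group
  generated by \<open>s\<close> and \<open>t\<close>. These coset facts follow from the exchange condition
  (proved by counting reflections modulo 2) and from the fact that \<open>s t\<close> has order exactly \<open>k s t\<close>
  (read off from the dual of the geometric representation).

  The analytic heart is that \<open>F\<close> has at most one zero in the unit disk. With
  \<open>M(w) = (1 + w) / (1 - w)\<close> one has
  \<open>2 F(w) / (1 - w) = \<chi> - (N - 2) M(w) + \<Sum>\<^sub>e M(w\<^bsup>k\<^sub>e\<^esup>)\<close>, where \<open>\<chi>\<close> is the Euler characteristic of the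
  nerve. Polarising, two zeros \<open>v\<close>, \<open>w\<close> satisfy an identity between positive definite kernels in
  which \<open>\<chi>\<close> and the edges stand on one side and a kernel of rank one on the other; a vector killed by
  the rank one kernel shows \<open>v = w\<close> as soon as \<open>\<chi> \<ge> 0\<close> (\<open>charfun_zero_unique\<close>). On the unit circle \<open>M\<close> is
  imaginary, so there the real part of \<open>2 F(w) / (1 - w)\<close> is \<open>\<chi>\<close>, and \<open>F\<close> does not vanish if \<open>\<chi> > 0\<close>.
  Since the system is not affine, \<open>F(1) < 0 < F(0)\<close>; so \<open>F\<close> has a zero \<open>R\<close> between 0 and 1, and this
  zero is the radius of convergence of \<open>f\<close>: the growth rate is \<open>1 / R\<close>. Substituting \<open>1 / w\<close> and clearing
  denominators turns \<open>F\<close> into a monic integer polynomial. A conjugate of \<open>1 / R\<close> of absolute value at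
  least 1 would be a root of unity, a second zero of \<open>F\<close> in the unit disk, or a zero on the circle,
  and none of these occurs. Hence \<open>1 / R\<close> is a Pisot number (\<open>pisot_charfun\<close>).

  For the approximation only the function \<open>F\<close> matters, not the shape of the nerve. So the labels
  of the given system are placed on the edges of a cycle with \<open>N\<close> vertices, and the remaining
  \<open>\<chi>\<close> edges of the cycle receive a large label \<open>m\<close>. A cycle has Euler characteristic 0, and it carries
  no finite subgroup of rank 3 (for \<open>N = 3\<close> because the labels are hyperbolic). Its function is
  \<open>F + \<chi> w\<^sup>m / [m](w)\<close>, which is at least \<open>F\<close> on the positive axis and converges to \<open>F\<close> on \<open>[0, 1)\<close>;
  so its zero lies to the right of \<open>R\<close> and tends to \<open>R\<close>.
\<close>

section \<open>Words over the generators\<close>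

fun alt_word :: "nat \<Rightarrow> 'a \<Rightarrow> 'a \<Rightarrow> 'a list" where
  "alt_word 0 s t = []"
| "alt_word (Suc n) s t = s # alt_word n t s"

lemma length_alt [simp]: "length (alt_word n s t) = n"
  by (induction n s t rule: alt_word.induct) auto

lemma set_alt: "set (alt_word n s t) \<subseteq> {s, t}"
  by (induction n s t rule: alt_word.induct) auto

lemma concat_replicate_alt: "concat (replicate n [s, t]) = alt_word (2 * n) s t"
  by (induction n) auto

lemma alt_Suc_snoc: "alt_word (Suc n) s t = alt_word n s t @ [if even n then s else t]"
  by (induction n s t rule: alt_word.induct) auto

lemma rev_alt_append_alt:
  "rev (alt_word i t s) @ alt_word j s t = alt_word (i + j) (if even i then s else t) (if even i then t else s)"
proof (induction i arbitrary: s t j)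
  case (Suc i)
  have "rev (alt_word (Suc i) t s) @ alt_word j s t = rev (alt_word i s t) @ alt_word (Suc j) t s" by simp
  also have "\<dots> = alt_word (i + Suc j) (if even i then t else s) (if even i then s else t)"
    by (rule Suc)
  finally show ?case by (simp split: if_splits)
qed simp

text \<open>
  The value of an unsigned word; for words in involutions it is \<open>word_eval\<close> with the signs
  forgotten (\<open>word_eval_val\<close>).
\<close>
definition word_value :: "('a, 'b) monoid_scheme \<Rightarrow> 'a list \<Rightarrow> 'a" where
  "word_value G w = foldr (\<lambda>s g. s \<otimes>\<^bsub>G\<^esub> g) w \<one>\<^bsub>G\<^esub>"

text \<open>
  Signs of letters carry no information here, because generators are involutions. A function of
  unsigned words is therefore an invariant of the group as soon as it survives the insertion of a
  square and of a braid relator. Parity of the length, the parity of reflections and the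
  representation on functionals below are all invariants of this kind.
\<close>
lemma pres_equiv_invariant:
  assumes "pres_equiv S (coxeter_relators S k) u v"
    and square: "\<And>u v s. set u \<subseteq> S \<Longrightarrow> set v \<subseteq> S \<Longrightarrow> s \<in> S \<Longrightarrow> \<Phi> (u @ [s, s] @ v) = \<Phi> (u @ v)"
    and braid: "\<And>u v s t n. set u \<subseteq> S \<Longrightarrow> set v \<subseteq> S \<Longrightarrow> s \<in> S \<Longrightarrow> t \<in> S \<Longrightarrow> k s t = enat n \<Longrightarrow>
      \<Phi> (u @ alt_word (2 * n) s t @ v) = \<Phi> (u @ v)"
  shows "\<Phi> (map fst u) = \<Phi> (map fst v)"
  using assms(1)
proof induction
  case (cancel u v s b)
  then show ?case
    using square[of "map fst u" "map fst v" s] by (force simp: signed_words_def)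
next
  case (relator u v r)
  then obtain s t n where r: "r = concat (replicate n [(s, True), (t, True)])" "s \<in> S" "t \<in> S"
      "k s t = enat n"
    by (auto simp: coxeter_relators_def)
  have "map fst r = alt_word (2 * n) s t"
    unfolding r(1) by (simp add: map_concat flip: concat_replicate_alt)
  then show ?case
    using braid[of "map fst u" "map fst v" s t n] relator r by (force simp: signed_words_def)
qed simp_all

locale coxeter =
  fixes G :: "('a, 'b) monoid_scheme" (structure) and S :: "'a set" and k :: "'a \<Rightarrow> 'a \<Rightarrow> enat"
  assumes coxeter: "coxeter_system G S k"
begin

lemma finite_S: "finite S" and matrix: "coxeter_matrix S k"
  and pres: "presented_by G S (coxeter_relators S k)"
  using coxeter by (auto simp: coxeter_system_def)

sublocale group G using pres by (simp add: presented_by_def)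

lemma S_carrier: "S \<subseteq> carrier G" and gen: "generate G S = carrier G"
  using pres by (auto simp: presented_by_def)

lemma in_carrier [simp]: "s \<in> S \<Longrightarrow> s \<in> carrier G" using S_carrier by auto

lemma pres_iff: "u \<in> signed_words S \<Longrightarrow> v \<in> signed_words S \<Longrightarrow>
  word_eval G u = word_eval G v \<longleftrightarrow> pres_equiv S (coxeter_relators S k) u v"
  using pres by (auto simp: presented_by_def)

lemma k_self: "s \<in> S \<Longrightarrow> k s s = 1"
  and k_sym: "s \<in> S \<Longrightarrow> t \<in> S \<Longrightarrow> k s t = k t s"
  and k_ge2: "s \<in> S \<Longrightarrow> t \<in> S \<Longrightarrow> s \<noteq> t \<Longrightarrow> 2 \<le> k s t"
  using matrix unfolding coxeter_matrix_def by (simp, metis, simp)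

abbreviation val where "val \<equiv> word_value G"

lemma val_Nil [simp]: "val [] = \<one>" and val_Cons [simp]: "val (s # w) = s \<otimes> val w"
  by (simp_all add: word_value_def)

lemma val_closed [simp]: "set w \<subseteq> S \<Longrightarrow> val w \<in> carrier G"
  by (induction w) auto

lemma val_append: "set u \<subseteq> S \<Longrightarrow> set v \<subseteq> S \<Longrightarrow> val (u @ v) = val u \<otimes> val v"
  by (induction u) (auto simp: m_assoc)

lemma relator_word:
  assumes "s \<in> S" "t \<in> S" "k s t = enat n"
  shows "val (alt_word (2 * n) s t) = \<one>"
proof -
  define r where "r = concat (replicate n [(s, True), (t, True)])"
  have r: "r \<in> signed_words S"
    unfolding r_def signed_words_def by (induction n) (use assms in auto)
  have "r \<in> coxeter_relators S k" using assms by (auto simp: r_def coxeter_relators_def)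
  then have "pres_equiv S (coxeter_relators S k) r []"
    using pres_equiv.relator[of "[]" S "[]" r] r by (simp add: signed_words_def)
  then have "word_eval G r = \<one>" using pres_iff[of r "[]"] r by (simp add: signed_words_def word_eval_def)
  moreover have "word_eval G r = val (map fst r)"
    using assms(1,2) unfolding r_def by (induction n) (auto simp: word_eval_def)
  moreover have "map fst r = alt_word (2 * n) s t"
    unfolding r_def by (simp add: map_concat flip: concat_replicate_alt)
  ultimately show ?thesis by simp
qed

lemma square [simp]: "s \<in> S \<Longrightarrow> s \<otimes> s = \<one>"
  using relator_word[of s s 1] k_self[of s] by (simp add: one_enat_def numeral_2_eq_2)

lemma inv_gen [simp]: "s \<in> S \<Longrightarrow> inv s = s"
  using inv_equality[of s s] by simp

lemma square_left [simp]: "s \<in> S \<Longrightarrow> g \<in> carrier G \<Longrightarrow> s \<otimes> (s \<otimes> g) = g"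
  by (simp flip: m_assoc)

lemma square_right [simp]: "s \<in> S \<Longrightarrow> g \<in> carrier G \<Longrightarrow> g \<otimes> s \<otimes> s = g"
  by (simp add: m_assoc)

lemma word_eval_val: "w \<in> signed_words S \<Longrightarrow> word_eval G w = val (map fst w)"
  by (induction w) (auto simp: word_eval_def signed_words_def)

lemma val_invariant:
  assumes "val u = val v" "set u \<subseteq> S" "set v \<subseteq> S"
    and "\<And>u v s. set u \<subseteq> S \<Longrightarrow> set v \<subseteq> S \<Longrightarrow> s \<in> S \<Longrightarrow> \<Phi> (u @ [s, s] @ v) = \<Phi> (u @ v)"
    and "\<And>u v s t n. set u \<subseteq> S \<Longrightarrow> set v \<subseteq> S \<Longrightarrow> s \<in> S \<Longrightarrow> t \<in> S \<Longrightarrow> k s t = enat n \<Longrightarrow>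
      \<Phi> (u @ alt_word (2 * n) s t @ v) = \<Phi> (u @ v)"
  shows "\<Phi> u = \<Phi> v"
proof -
  let ?m = "map (\<lambda>s. (s, True))"
  have m: "?m u \<in> signed_words S" "?m v \<in> signed_words S" "map fst (?m w) = w" for w
    using assms(2,3) by (auto simp: signed_words_def comp_def)
  have "pres_equiv S (coxeter_relators S k) (?m u) (?m v)"
    using m(1,2) m(3)[of u] m(3)[of v] assms(1) by (simp add: word_eval_val del: map_map flip: pres_iff)
  from pres_equiv_invariant[OF this, of \<Phi>] assms(4,5) m(3) show ?thesis by metis
qed

lemma inv_val: "set w \<subseteq> S \<Longrightarrow> inv (val w) = val (rev w)"
  by (induction w) (auto simp: inv_mult_group val_append)

lemma generate_eq_val: "I \<subseteq> S \<Longrightarrow> generate G I = {val w |w. set w \<subseteq> I}"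
proof (intro equalityI subsetI)
  fix x assume I: "I \<subseteq> S" and "x \<in> generate G I"
  from this(2) show "x \<in> {val w |w. set w \<subseteq> I}"
  proof induction
    case one
    have "\<one> = val []" "set [] \<subseteq> I" by simp_all
    then show ?case by blast
  next
    case (incl h)
    then have "val [h] = h" "set [h] \<subseteq> I" using I by auto
    then show ?case by (metis (mono_tags, lifting) mem_Collect_eq)
  next
    case (inv h)
    then have "val [h] = inv h" "set [h] \<subseteq> I" using I by auto
    then show ?case by (metis (mono_tags, lifting) mem_Collect_eq)
  next
    case (eng h1 h2)
    then obtain u v where "h1 = val u" "h2 = val v" "set u \<subseteq> I" "set v \<subseteq> I" by auto
    then show ?case using I by (auto intro!: exI[of _ "u @ v"] simp: val_append)
  qed
next
  fix x assume I: "I \<subseteq> S" and "x \<in> {val w |w. set w \<subseteq> I}"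
  then obtain w where x: "x = val w" and "set w \<subseteq> I" by auto
  from this(2) show "x \<in> generate G I" unfolding x
    by (induction w) (auto intro: generate.one generate.incl generate.eng)
qed

lemma ex_word: "g \<in> carrier G \<Longrightarrow> \<exists>w. set w \<subseteq> S \<and> val w = g"
  using generate_eq_val[of S] gen by auto

abbreviation len :: "'a \<Rightarrow> nat" where "len \<equiv> word_length G S"

lemma len_val: "set w \<subseteq> S \<Longrightarrow> len (val w) \<le> length w"
proof -
  assume w: "set w \<subseteq> S"
  let ?m = "map (\<lambda>s. (s, True)) w"
  have "?m \<in> signed_words S" using w by (auto simp: signed_words_def)
  then show ?thesis unfolding word_length_def
    by (intro Least_le) (auto intro!: bexI[of _ ?m] simp: word_eval_val comp_def)
qed

lemma reduced_word:
  assumes "g \<in> carrier G"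
  obtains w where "set w \<subseteq> S" "val w = g" "length w = len g"
proof -
  obtain u where u: "set u \<subseteq> S" "val u = g" using ex_word assms by blast
  let ?m = "map (\<lambda>s. (s, True)) u"
  have "?m \<in> signed_words S" "word_eval G ?m = g" "length ?m = length u"
  proof -
    show *: "?m \<in> signed_words S" using u by (auto simp: signed_words_def)
    show "word_eval G ?m = g" using u word_eval_val[OF *] by (simp add: comp_def)
  qed simp
  then have "\<exists>w\<in>signed_words S. length w = len g \<and> word_eval G w = g"
    unfolding word_length_def by (intro LeastI_ex[of "\<lambda>n. \<exists>w\<in>signed_words S. length w = n \<and> word_eval G w = g"]) blast
  then obtain w where "w \<in> signed_words S" "length w = len g" "word_eval G w = g" by auto
  then show ?thesis using that[of "map fst w"] by (force simp: word_eval_val signed_words_def)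
qed

lemma len_one [simp]: "len \<one> = 0" using len_val[of "[]"] by simp

lemma len_eq_0: "g \<in> carrier G \<Longrightarrow> len g = 0 \<longleftrightarrow> g = \<one>"
  by (metis val_Nil len_one length_0_conv reduced_word)

text \<open>
  All relators have even length, so the sign of an element is well defined; this is why
  multiplication by a generator always changes the length.
\<close>
lemma parity: "set u \<subseteq> S \<Longrightarrow> even (len (val u)) \<longleftrightarrow> even (length u)"
proof -
  assume u: "set u \<subseteq> S"
  obtain w where w: "set w \<subseteq> S" "val w = val u" "length w = len (val u)"
    using reduced_word u by (metis val_closed)
  have "even (length w) = even (length u)"
    by (rule val_invariant[OF w(2,1) u, of "\<lambda>w. even (length w)"]) auto
  then show ?thesis using w by simp
qed

lemma len_mult_ge: "s \<in> S \<Longrightarrow> g \<in> carrier G \<Longrightarrow> len (g \<otimes> s) \<le> Suc (len g)"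
  by (rule reduced_word[of g], simp) (use len_val[of "_ @ [s]"] in \<open>force simp: val_append\<close>)

lemma len_mult_neq: "s \<in> S \<Longrightarrow> g \<in> carrier G \<Longrightarrow> len (g \<otimes> s) \<noteq> len g"
proof (rule reduced_word[of g], simp)
  fix w assume *: "s \<in> S" "g \<in> carrier G" "set w \<subseteq> S" "val w = g" "length w = len g"
  then have "even (len (g \<otimes> s)) \<longleftrightarrow> even (Suc (length w))"
    using parity[of "w @ [s]"] by (simp add: val_append)
  then show "len (g \<otimes> s) \<noteq> len g" using * by auto
qed

lemma len_mult_cases:
  assumes "s \<in> S" "g \<in> carrier G"
  shows "len (g \<otimes> s) = Suc (len g) \<or> Suc (len (g \<otimes> s)) = len g"
  using len_mult_ge[of s g] len_mult_ge[of s "g \<otimes> s"] len_mult_neq[of s g] assms by auto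

section \<open>Reflections and the exchange condition\<close>

text \<open>
  A word \<open>s\<^sub>1 \<dots> s\<^sub>n\<close> passes the reflections \<open>s\<^sub>1 \<dots> s\<^sub>i \<dots> s\<^sub>1\<close>. The parity of the number of \<open>i\<close> for which
  this reflection equals \<open>r\<close> turns out to depend on the value of the word only
  (\<open>refl_parity_invariant\<close>): \<open>r\<close> separates the identity from this value iff the parity is odd.
\<close>
fun refl_parity :: "'a list \<Rightarrow> 'a \<Rightarrow> bool" where
  "refl_parity [] r = False"
| "refl_parity (s # w) r = ((r = s) \<noteq> refl_parity w (s \<otimes> r \<otimes> s))"

lemma refl_parity_append:
  "set u \<subseteq> S \<Longrightarrow> set v \<subseteq> S \<Longrightarrow> r \<in> carrier G \<Longrightarrow>
    refl_parity (u @ v) r \<longleftrightarrow> (refl_parity u r \<noteq> refl_parity v (inv (val u) \<otimes> r \<otimes> val u))"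
  by (induction u arbitrary: r) (auto simp: inv_mult_group m_assoc)

text \<open>
  Counting from 0, the reflection number \<open>i\<close> of the alternating word is \<open>(s t)\<^sup>i s\<close>.
\<close>
lemma refl_parity_alt:
  assumes "s \<in> S" "t \<in> S" "r \<in> carrier G"
  shows "refl_parity (alt_word (2 * n) s t) r \<longleftrightarrow> odd (\<Sum>i<2*n. of_bool (r = (s \<otimes> t) [^] i \<otimes> s) :: nat)"
  using assms(3)
proof (induction n arbitrary: r)
  case (Suc n)
  let ?p = "s \<otimes> t"
  let ?f = "\<lambda>r (i::nat). of_bool (r = ?p [^] i \<otimes> s) :: nat"
  let ?r = "t \<otimes> (s \<otimes> r \<otimes> s) \<otimes> t"
  have [simp]: "s \<in> carrier G" "t \<in> carrier G" "?p \<in> carrier G" using assms by auto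
  have A: "s \<otimes> r \<otimes> s = t \<longleftrightarrow> r = ?p [^] (1::nat) \<otimes> s"
  proof
    assume "s \<otimes> r \<otimes> s = t"
    then have "s \<otimes> (s \<otimes> r \<otimes> s) \<otimes> s = s \<otimes> t \<otimes> s" by simp
    then show "r = ?p [^] (1::nat) \<otimes> s" using assms Suc.prems by (simp add: m_assoc)
  qed (use assms Suc.prems in \<open>simp add: m_assoc\<close>)
  have B: "?r = ?p [^] i \<otimes> s \<longleftrightarrow> r = ?p [^] (Suc (Suc i)) \<otimes> s" for i
  proof
    assume "?r = ?p [^] i \<otimes> s"
    then have "?p \<otimes> ?r \<otimes> (t \<otimes> s) = ?p \<otimes> (?p [^] i \<otimes> s) \<otimes> (t \<otimes> s)" by simp
    also have "\<dots> = ?p \<otimes> ?p [^] i \<otimes> ?p \<otimes> s" by (simp add: m_assoc)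
    also have "\<dots> = ?p [^] (Suc (Suc i)) \<otimes> s" by (metis \<open>?p \<in> carrier G\<close> nat_pow_Suc nat_pow_Suc2)
    also have "?p \<otimes> ?r \<otimes> (t \<otimes> s) = r" using assms Suc.prems by (simp add: m_assoc)
    finally show "r = ?p [^] (Suc (Suc i)) \<otimes> s" .
  next
    assume "r = ?p [^] (Suc (Suc i)) \<otimes> s"
    also have "\<dots> = ?p \<otimes> ?p [^] i \<otimes> ?p \<otimes> s" by (metis \<open>?p \<in> carrier G\<close> nat_pow_Suc nat_pow_Suc2)
    finally show "?r = ?p [^] i \<otimes> s" using assms by (simp add: m_assoc)
  qed
  have "refl_parity (alt_word (2 * Suc n) s t) r \<longleftrightarrow>
      ((r = s) \<noteq> ((s \<otimes> r \<otimes> s = t) \<noteq> refl_parity (alt_word (2 * n) s t) ?r))" by simp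
  also have "refl_parity (alt_word (2 * n) s t) ?r \<longleftrightarrow> odd (\<Sum>i<2*n. ?f ?r i)"
    using Suc by simp
  also have "(\<Sum>i<2*n. ?f ?r i) = (\<Sum>i<2*n. ?f r (Suc (Suc i)))" by (simp only: B)
  also have "((r = s) \<noteq> ((s \<otimes> r \<otimes> s = t) \<noteq> odd (\<Sum>i<2*n. ?f r (Suc (Suc i))))) \<longleftrightarrow>
     odd (?f r 0 + (?f r 1 + (\<Sum>i<2*n. ?f r (Suc (Suc i)))))"
  proof -
    have par: "odd (of_bool a + (of_bool b + c)) \<longleftrightarrow> (a \<noteq> (b \<noteq> odd c))" for a b and c :: nat
      by (cases a; cases b) auto
    have "r = s \<longleftrightarrow> r = ?p [^] (0::nat) \<otimes> s" by simp
    then show ?thesis unfolding par A by (simp only:)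
  qed
  also have "?f r 0 + (?f r 1 + (\<Sum>i<2*n. ?f r (Suc (Suc i)))) = (\<Sum>i<2*Suc n. ?f r i)"
    by (simp only: sum.lessThan_Suc_shift mult_Suc_right add_2_eq_Suc One_nat_def)
  finally show ?case .
qed simp

text \<open>
  If \<open>(s t)\<^sup>n = \<one>\<close>, the reflections number \<open>i\<close> and \<open>n + i\<close> of the relator coincide, so every
  reflection is passed an even number of times.
\<close>
lemma refl_parity_relator:
  assumes "s \<in> S" "t \<in> S" "r \<in> carrier G" "k s t = enat n"
  shows "\<not> refl_parity (alt_word (2 * n) s t) r"
proof -
  let ?p = "s \<otimes> t"
  have c: "?p \<in> carrier G" using assms by simp
  have "val (alt_word (2 * m) s t) = ?p [^] m" for m
  proof (induction m)
    case (Suc m)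
    have "val (alt_word (2 * Suc m) s t) = ?p \<otimes> val (alt_word (2 * m) s t)"
      using assms set_alt[of "2 * m" s t] by (simp add: m_assoc subset_trans)
    then show ?case using Suc c by (simp only: nat_pow_Suc2)
  qed simp
  then have 1: "?p [^] n = \<one>" using relator_word assms by metis
  let ?f = "\<lambda>(i::nat). of_bool (r = ?p [^] i \<otimes> s) :: nat"
  have "(\<Sum>i<n + m. ?f i) = (\<Sum>i<n. ?f i) + (\<Sum>i<m. ?f (n + i))" for m
    by (induction m) (simp_all only: add_Suc_right sum.lessThan_Suc add_0_right lessThan_0 sum.empty add.assoc)
  from this[of n] have "(\<Sum>i<2*n. ?f i) = (\<Sum>i<n. ?f i) + (\<Sum>i<n. ?f (n + i))"
    by (simp only: mult_2)
  also have "(\<Sum>i<n. ?f (n + i)) = (\<Sum>i<n. ?f i)"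
    using 1 c by (simp add: nat_pow_mult[symmetric])
  finally show ?thesis using refl_parity_alt[OF assms(1-3)] by simp
qed

lemma refl_parity_invariant:
  assumes "val u = val v" "set u \<subseteq> S" "set v \<subseteq> S" "r \<in> carrier G"
  shows "refl_parity u r = refl_parity v r"
proof -
  have "(\<lambda>w. \<forall>r\<in>carrier G. refl_parity w r = refl_parity v r) u = (\<lambda>w. \<forall>r\<in>carrier G. refl_parity w r = refl_parity v r) v"
  proof (rule val_invariant[OF assms(1-3)])
    fix x y s assume *: "set x \<subseteq> S" "set y \<subseteq> S" "s \<in> S"
    have "refl_parity (x @ [s, s] @ y) r = refl_parity (x @ y) r" if r: "r \<in> carrier G" for r
    proof -
      let ?q = "inv (val x) \<otimes> r \<otimes> val x"
      have q: "?q \<in> carrier G" using * r by simp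
      have "s \<otimes> ?q \<otimes> s = s \<longleftrightarrow> ?q = s"
      proof
        assume "s \<otimes> ?q \<otimes> s = s"
        then have "s \<otimes> (s \<otimes> ?q \<otimes> s) \<otimes> s = s \<otimes> s \<otimes> s" by simp
        then show "?q = s" using * q by (simp add: m_assoc)
      qed (use * in simp)
      moreover have "s \<otimes> (s \<otimes> ?q \<otimes> s) \<otimes> s = ?q" using * q by (simp add: m_assoc)
      ultimately show ?thesis using * r q by (simp add: refl_parity_append) blast
    qed
    then show "(\<forall>r\<in>carrier G. refl_parity (x @ [s, s] @ y) r = refl_parity v r) = (\<forall>r\<in>carrier G. refl_parity (x @ y) r = refl_parity v r)"
      by simp
  next
    fix x y s t n assume *: "set x \<subseteq> S" "set y \<subseteq> S" "s \<in> S" "t \<in> S" "k s t = enat n"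
    have a: "set (alt_word (2 * n) s t) \<subseteq> S" using set_alt[of "2*n" s t] * by auto
    have "refl_parity (x @ alt_word (2 * n) s t @ y) r = refl_parity (x @ y) r" if r: "r \<in> carrier G" for r
      using * r a by (simp add: refl_parity_append refl_parity_relator relator_word)
    then show "(\<forall>r\<in>carrier G. refl_parity (x @ alt_word (2 * n) s t @ y) r = refl_parity v r) = (\<forall>r\<in>carrier G. refl_parity (x @ y) r = refl_parity v r)"
      by simp
  qed
  then show ?thesis using assms by simp
qed

text \<open>
  Passing \<open>r\<close> at the letter \<open>a\<close> means that multiplication by \<open>r\<close> from the left deletes \<open>a\<close>.
\<close>
lemma refl_parity_delete:
  "refl_parity u r \<Longrightarrow> set u \<subseteq> S \<Longrightarrow> r \<in> carrier G \<Longrightarrow>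
    \<exists>u1 a u2. u = u1 @ a # u2 \<and> r \<otimes> val u = val (u1 @ u2)"
proof (induction u arbitrary: r)
  case (Cons s w)
  have s: "s \<in> S" "set w \<subseteq> S" using Cons.prems by auto
  show ?case
  proof (cases "r = s")
    case True
    then show ?thesis using s by (intro exI[of _ "[]"]) auto
  next
    case False
    then have "refl_parity w (s \<otimes> r \<otimes> s)" using Cons.prems by simp
    then obtain u1 a u2 where *: "w = u1 @ a # u2" "s \<otimes> r \<otimes> s \<otimes> val w = val (u1 @ u2)"
      using Cons.IH[of "s \<otimes> r \<otimes> s"] Cons.prems by auto
    have "r \<otimes> val (s # w) = s \<otimes> (s \<otimes> r \<otimes> s \<otimes> val w)"
      using s Cons.prems(3) by (simp add: m_assoc)
    also have "\<dots> = val ((s # u1) @ u2)" using * by simp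
    finally show ?thesis using *(1) by (intro exI[of _ "s # u1"]) auto
  qed
qed simp

text \<open>
  The word \<open>u s\<close> and a reduced word of its value have the same reflection parities. If the
  reflection \<open>r\<close> with \<open>r u = u s\<close> were not passed by \<open>u\<close>, then it would be passed by the reduced word
  of \<open>u s\<close>, and deleting a letter there would make \<open>u\<close> shorter than \<open>u s\<close>, contrary to the hypothesis.
\<close>
lemma exchange:
  assumes u: "set u \<subseteq> S" "length u = len (val u)" and s: "s \<in> S" and le: "len (val u \<otimes> s) \<le> length u"
  obtains u1 a u2 where "u = u1 @ a # u2" "val u \<otimes> s = val (u1 @ u2)"
proof -
  let ?g = "val u" and ?r = "val u \<otimes> s \<otimes> inv (val u)"
  have c: "?g \<in> carrier G" "?r \<in> carrier G" using u s by auto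
  have "refl_parity u ?r"
  proof (rule ccontr)
    assume n: "\<not> refl_parity u ?r"
    obtain x where x: "set x \<subseteq> S" "val x = ?g \<otimes> s" "length x = len (?g \<otimes> s)"
      using reduced_word[of "?g \<otimes> s"] c s by auto
    have "inv ?g \<otimes> ?r \<otimes> ?g = s"
    proof -
      have "inv ?g \<otimes> ?r \<otimes> ?g = inv ?g \<otimes> (?g \<otimes> s) \<otimes> (inv ?g \<otimes> ?g)"
        using c(1) s by (simp only: m_assoc m_closed inv_closed in_carrier)
      then show ?thesis using c(1) s by (simp add: m_assoc[symmetric])
    qed
    then have "refl_parity (u @ [s]) ?r" using n u s c by (subst refl_parity_append) auto
    then have "refl_parity x ?r" using refl_parity_invariant[of "u @ [s]" x ?r] u s x c by (simp add: val_append)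
    then obtain x1 a x2 where d: "x = x1 @ a # x2" "?r \<otimes> val x = val (x1 @ x2)"
      using refl_parity_delete x c by blast
    have "?r \<otimes> val x = ?g \<otimes> s \<otimes> (inv ?g \<otimes> ?g) \<otimes> s" unfolding x(2)
      using c(1) s by (simp only: m_assoc m_closed inv_closed in_carrier)
    also have "\<dots> = ?g" using c s by simp
    finally have "val (x1 @ x2) = ?g" using d by simp
    then have "len ?g \<le> length (x1 @ x2)" using len_val[of "x1 @ x2"] x d by auto
    then show False using x(3) d len_mult_cases[OF s c(1)] le u by auto
  qed
  then obtain u1 a u2 where d: "u = u1 @ a # u2" "?r \<otimes> ?g = val (u1 @ u2)"
    using refl_parity_delete u c by blast
  have "?r \<otimes> ?g = ?g \<otimes> s \<otimes> (inv ?g \<otimes> ?g)"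
    using c(1) s by (simp only: m_assoc m_closed inv_closed in_carrier)
  then show ?thesis using that[OF d(1)] d(2) c s by simp
qed

end

section \<open>The dual geometric representation and the orders of products\<close>

text \<open>
  The reflections of the geometric representation, acting on functionals. A functional is
  recorded by its values on the simple roots, on which it is altered by a multiple of one row of the cosine
  matrix; so an alternating word in \<open>s\<close> and \<open>t\<close> can be followed by looking at the two values \<open>f s\<close>, \<open>f t\<close>.
\<close>
definition dual_refl :: "('a \<Rightarrow> 'a \<Rightarrow> real) \<Rightarrow> 'a \<Rightarrow> ('a \<Rightarrow> real) \<Rightarrow> 'a \<Rightarrow> real" where
  "dual_refl C s f = (\<lambda>r. f r - 2 * C s r * f s)"

text \<open>
  Solutions of the recursion of Chebyshev type \<open>v\<^sub>n\<^sub>+\<^sub>2 = 2 c v\<^sub>n\<^sub>+\<^sub>1 - v\<^sub>n\<close>, which the values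
  at \<open>s\<close> and \<open>t\<close> of a functional satisfy, up to sign, along an alternating word.
\<close>
fun cheb_seq :: "real \<Rightarrow> real \<Rightarrow> real \<Rightarrow> nat \<Rightarrow> real" where
  "cheb_seq c a b 0 = a"
| "cheb_seq c a b (Suc 0) = b"
| "cheb_seq c a b (Suc (Suc n)) = 2 * c * cheb_seq c a b (Suc n) - cheb_seq c a b n"

lemma cheb_sin:
  assumes "sin \<theta> \<noteq> 0"
  shows "sin \<theta> * cheb_seq (cos \<theta>) a b n = b * sin (n * \<theta>) - a * sin (n * \<theta> - \<theta>)"
proof (induction n rule: induct_nat_012)
  case (ge2 n)
  define x where "x = n * \<theta>"
  have e: "Suc (Suc n) * \<theta> = x + \<theta> + \<theta>" "Suc n * \<theta> = x + \<theta>" "n * \<theta> = x"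
    by (simp_all add: x_def algebra_simps)
  have "sin \<theta> * cheb_seq (cos \<theta>) a b (Suc (Suc n)) =
     2 * cos \<theta> * (sin \<theta> * cheb_seq (cos \<theta>) a b (Suc n)) - sin \<theta> * cheb_seq (cos \<theta>) a b n"
    by (simp add: algebra_simps)
  also have "\<dots> = 2 * cos \<theta> * (b * sin (x + \<theta>) - a * sin x) - (b * sin x - a * sin (x - \<theta>))"
    using ge2 e by simp
  also have "\<dots> = b * (2 * cos \<theta> * sin (x + \<theta>) - sin x) - a * (2 * cos \<theta> * sin x - sin (x - \<theta>))"
    by (simp add: algebra_simps)
  also have "2 * cos \<theta> * sin x - sin (x - \<theta>) = sin (x + \<theta>)"
    by (simp add: sin_add sin_diff)
  also have "2 * cos \<theta> * sin (x + \<theta>) - sin x = sin (x + \<theta> + \<theta>)"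
    using sin_add[of "x + \<theta>" \<theta>] sin_diff[of "x + \<theta>" \<theta>] by simp
  finally show ?case unfolding e by (simp del: cheb_seq.simps add: algebra_simps)
qed (use assms in simp_all)

lemma cheb_one: "cheb_seq 1 a b n = a + n * (b - a)"
  by (induction n rule: induct_nat_012) (auto simp: algebra_simps)

lemma dual_refl_alt:
  assumes C: "C s s = 1" "C t t = 1" "C s t = - c" "C t s = - c"
  defines "v \<equiv> \<lambda>f. cheb_seq c (- f s) (f t)"
  shows "foldr (dual_refl C) (alt_word (2 * m) s t) f =
    (\<lambda>r. f r - 2 * C t r * (\<Sum>i<m. v f (2 * i + 1)) - 2 * C s r * (\<Sum>i<m. v f (2 * i + 2)))"
    and "foldr (dual_refl C) (alt_word (2 * m) s t) f s = - v f (2 * m)"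
    and "foldr (dual_refl C) (alt_word (2 * m) s t) f t = v f (2 * m + 1)"
proof -
  have *: "foldr (dual_refl C) (alt_word (2 * m) s t) f =
    (\<lambda>r. f r - 2 * C t r * (\<Sum>i<m. v f (2 * i + 1)) - 2 * C s r * (\<Sum>i<m. v f (2 * i + 2))) \<and>
     foldr (dual_refl C) (alt_word (2 * m) s t) f s = - v f (2 * m) \<and>
     foldr (dual_refl C) (alt_word (2 * m) s t) f t = v f (2 * m + 1)"
  proof (induction m)
    case (Suc m)
    let ?g = "foldr (dual_refl C) (alt_word (2 * m) s t) f"
    have step: "foldr (dual_refl C) (alt_word (2 * Suc m) s t) f = dual_refl C s (dual_refl C t ?g)" by simp
    define x y where "x = ?g s" and "y = ?g t"
    have x: "x = - v f (2 * m)" and y: "y = v f (2 * m + 1)" using Suc by (auto simp: x_def y_def)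
    have z: "x + 2 * c * y = v f (2 * m + 2)" unfolding x y v_def by (simp add: algebra_simps)
    have z': "2 * c * (x + 2 * c * y) - y = v f (2 * m + 3)"
      unfolding z unfolding y v_def by (simp add: numeral_3_eq_3)
    have r: "foldr (dual_refl C) (alt_word (2 * Suc m) s t) f r = ?g r - 2 * C t r * y - 2 * C s r * (x + 2 * c * y)" for r
      unfolding step by (simp add: dual_refl_def x_def y_def C algebra_simps)
    have g: "?g r = f r - 2 * C t r * (\<Sum>i<m. v f (2 * i + 1)) - 2 * C s r * (\<Sum>i<m. v f (2 * i + 2))" for r
      using Suc by (auto simp: fun_eq_iff)
    have "foldr (dual_refl C) (alt_word (2 * Suc m) s t) f = (\<lambda>r. f r - 2 * C t r * (\<Sum>i<Suc m. v f (2 * i + 1))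
         - 2 * C s r * (\<Sum>i<Suc m. v f (2 * i + 2)))"
      unfolding fun_eq_iff r z g by (simp add: y algebra_simps)
    moreover have "foldr (dual_refl C) (alt_word (2 * Suc m) s t) f s = - v f (2 * Suc m)"
    proof -
      have "foldr (dual_refl C) (alt_word (2 * Suc m) s t) f s = - (x + 2 * c * y)"
        unfolding r by (simp add: C flip: x_def)
      then show ?thesis using z by simp
    qed
    moreover have "foldr (dual_refl C) (alt_word (2 * Suc m) s t) f t = v f (2 * Suc m + 1)"
    proof -
      have "foldr (dual_refl C) (alt_word (2 * Suc m) s t) f t = ?g t - 2 * y + 2 * c * (x + 2 * c * y)"
        unfolding r by (simp add: C)
      then show ?thesis using z' by (simp add: numeral_3_eq_3 flip: y_def)
    qed
    ultimately show ?case by blast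
  qed (simp add: v_def)
  show "foldr (dual_refl C) (alt_word (2 * m) s t) f =
    (\<lambda>r. f r - 2 * C t r * (\<Sum>i<m. v f (2 * i + 1)) - 2 * C s r * (\<Sum>i<m. v f (2 * i + 2)))"
    and "foldr (dual_refl C) (alt_word (2 * m) s t) f s = - v f (2 * m)"
    and "foldr (dual_refl C) (alt_word (2 * m) s t) f t = v f (2 * m + 1)" using * by auto
qed

text \<open>
  The sums over a period vanish without computing them: by the recursion the sum \<open>P\<close> over the odd and
  the sum \<open>Q\<close> over the even indices satisfy \<open>c P = Q\<close> and \<open>c Q = P\<close>, and \<open>c\<^sup>2 \<noteq> 1\<close>.
\<close>
lemma cheb_periodic:
  assumes n: "n \<ge> 2"
  defines "c \<equiv> cos (pi / real n)"
  shows "cheb_seq c a b (2 * n) = a" "cheb_seq c a b (2 * n + 1) = b"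
    and "(\<Sum>i<n. cheb_seq c a b (2 * i + 1)) = 0" "(\<Sum>i<n. cheb_seq c a b (2 * i + 2)) = 0"
proof -
  define \<theta> where "\<theta> = pi / real n"
  have s: "sin \<theta> > 0" unfolding \<theta>_def using n by (intro sin_gt_zero) (auto simp: field_simps)
  then have c1: "c ^ 2 \<noteq> 1" using sin_cos_squared_add[of \<theta>] unfolding c_def \<theta>_def[symmetric] by (metis add_cancel_left_left less_irrefl zero_eq_power2)
  have th: "real n * \<theta> = pi" using n by (simp add: \<theta>_def)
  have c: "c = cos \<theta>" by (simp add: c_def \<theta>_def)
  have e: "real (2 * n) * \<theta> = 2 * pi" "real (2 * n + 1) * \<theta> = \<theta> + 2 * pi"
    using th by (simp_all add: algebra_simps)
  from cheb_sin[of \<theta> a b "2 * n", unfolded e] cheb_sin[of \<theta> a b "2 * n + 1", unfolded e] s c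
  have "sin \<theta> * cheb_seq c a b (2 * n) = sin \<theta> * a" "sin \<theta> * cheb_seq c a b (2 * n + 1) = sin \<theta> * b"
    by (simp_all add: sin_diff)
  then show 1: "cheb_seq c a b (2 * n) = a" "cheb_seq c a b (2 * n + 1) = b" using s by auto
  let ?v = "cheb_seq c a b"
  define P where "P = (\<Sum>i<n. ?v (2 * i + 1))"
  define Q where "Q = (\<Sum>i<n. ?v (2 * i + 2))"
  have Q': "Q = (\<Sum>i<n. ?v (2 * i))"
  proof -
    have "Q + ?v 0 = (\<Sum>i<Suc n. ?v (2 * i))"
      unfolding Q_def by (subst sum.lessThan_Suc_shift) simp
    then show ?thesis using 1 by simp
  qed
  have P': "P = (\<Sum>i<n. ?v (2 * i + 3))"
  proof -
    have "(\<Sum>i<n. ?v (2 * i + 3)) + ?v 1 = (\<Sum>i<Suc n. ?v (2 * i + 1))"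
      by (subst sum.lessThan_Suc_shift) (simp add: numeral_3_eq_3)
    then show ?thesis using 1 by (simp add: P_def)
  qed
  have "2 * c * P = (\<Sum>i<n. ?v (2 * i + 2)) + (\<Sum>i<n. ?v (2 * i))"
    unfolding P_def sum_distrib_left by (simp flip: sum.distrib)
  then have e1: "c * P = Q" using Q' Q_def by simp
  have "2 * c * Q = (\<Sum>i<n. ?v (2 * i + 3)) + (\<Sum>i<n. ?v (2 * i + 1))"
    unfolding Q_def sum_distrib_left by (simp add: numeral_3_eq_3 flip: sum.distrib)
  then have e2: "c * Q = P" using P' P_def by simp
  have "P * (1 - c ^ 2) = P - c * (c * P)" by (simp add: algebra_simps power2_eq_square)
  also have "\<dots> = 0" using e1 e2 by simp
  finally have "P * (1 - c ^ 2) = 0" .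
  then show "P = 0" using c1 by simp
  then show "Q = 0" using e1 by simp
qed

lemma cosine_matrix_sym: "coxeter_matrix S k \<Longrightarrow> s \<in> S \<Longrightarrow> t \<in> S \<Longrightarrow> cosine_matrix k s t = cosine_matrix k t s"
  unfolding cosine_matrix_def coxeter_matrix_def by (cases "s = t") auto

lemma cosine_matrix_self: "coxeter_matrix S k \<Longrightarrow> s \<in> S \<Longrightarrow> cosine_matrix k s s = 1"
  by (auto simp: cosine_matrix_def coxeter_matrix_def one_enat_def)

lemma dual_refl_relator:
  assumes M: "coxeter_matrix S k" and st: "s \<in> S" "t \<in> S" "k s t = enat n"
  shows "foldr (dual_refl (cosine_matrix k)) (alt_word (2 * n) s t) f = f"
proof (cases "s = t")
  case True
  then have "n = 1" using M st by (auto simp: coxeter_matrix_def one_enat_def)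
  then show ?thesis using True cosine_matrix_self[OF M st(1)]
    by (auto simp: dual_refl_def numeral_2_eq_2 fun_eq_iff)
next
  case False
  then have "2 \<le> k s t" using M st False unfolding coxeter_matrix_def by blast
  then have n: "n \<ge> 2" using st by (simp add: numeral_eq_enat)
  show ?thesis
    by (subst dual_refl_alt(1)[where c = "cos (pi / real n)"])
       (use cosine_matrix_self[OF M] cosine_matrix_sym[OF M] st cheb_periodic[OF n] in
         \<open>auto simp: cosine_matrix_def\<close>)
qed

text \<open>
  If \<open>(s t)\<^sup>m\<close> were trivial, it would fix the functional that is 1 at \<open>t\<close> and 0 elsewhere. But
  up to sign its values at \<open>s\<close> and \<open>t\<close> run through \<open>sin (n \<theta>) / sin \<theta>\<close> with \<open>\<theta> = pi / k s t\<close>, or through \<open>n\<close> if \<open>k s t = \<infinity>\<close>. The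
  lemma concerns words rather than elements of a group, because it also serves to separate the
  generators of the group constructed from a matrix.
\<close>
lemma pres_equiv_order:
  fixes S :: "'a set"
  assumes M: "coxeter_matrix S k" and st: "s \<in> S" "t \<in> S" "s \<noteq> t" and m: "0 < m" "enat m < k s t"
    and eq: "pres_equiv S (coxeter_relators S k) u []" "map fst u = alt_word (2 * m) s t"
  shows False
proof -
  let ?C = "cosine_matrix k"
  have "foldr (dual_refl ?C) (map fst u) = foldr (dual_refl ?C) (map fst ([] :: 'a signed_word))"
  proof (rule pres_equiv_invariant[OF eq(1), where \<Phi> = "foldr (dual_refl ?C)"])
    fix x y s assume "s \<in> S"
    then show "foldr (dual_refl ?C) (x @ [s, s] @ y) = foldr (dual_refl ?C) (x @ y)"
      using cosine_matrix_self[OF M] by (auto simp: dual_refl_def fun_eq_iff)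
  next
    fix x y s t n assume "s \<in> S" "t \<in> S" "k s t = enat n"
    then show "foldr (dual_refl ?C) (x @ alt_word (2 * n) s t @ y) = foldr (dual_refl ?C) (x @ y)"
      by (intro ext) (simp add: dual_refl_relator[OF M])
  qed
  then have id: "foldr (dual_refl ?C) (alt_word (2 * m) s t) f = f" for f using eq by simp
  \<comment> \<open>in terms of \<open>cheb_seq\<close>, this functional has the initial values 0 and 1\<close>
  let ?f = "\<lambda>r. of_bool (r = t) :: real"
  define c where "c = - ?C s t"
  have v: "cheb_seq c 0 1 (2 * m) = 0" "cheb_seq c 0 1 (2 * m + 1) = 1"
    using dual_refl_alt(2,3)[of ?C s t c m ?f] id[of ?f] st cosine_matrix_self[OF M] cosine_matrix_sym[OF M]
    by (auto simp: c_def)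
  show False
  proof (cases "k s t")
    case infinity
    then have "c = 1" by (simp add: c_def cosine_matrix_def)
    then show ?thesis using v m by (simp add: cheb_one)
  next
    case (enat n)
    have "2 \<le> k s t" using M st unfolding coxeter_matrix_def by blast
    then have n: "m < n" "n \<ge> 2" using m enat by (auto simp: numeral_eq_enat)
    define \<theta> where "\<theta> = pi / real n"
    have c: "c = cos \<theta>" using enat by (simp add: c_def \<theta>_def cosine_matrix_def)
    have s: "sin \<theta> > 0" unfolding \<theta>_def using n by (intro sin_gt_zero) (auto simp: field_simps)
    let ?x = "real (2 * m) * \<theta>"
    have e: "real (2 * m + 1) * \<theta> = ?x + \<theta>" by (simp add: algebra_simps)
    have "sin ?x = 0" "sin (?x + \<theta>) = sin \<theta>"
      using cheb_sin[of \<theta> 0 1 "2 * m"] cheb_sin[of \<theta> 0 1 "2 * m + 1"] v s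
      unfolding c[symmetric] e by simp_all
    then have "cos ?x = 1" using s by (simp add: sin_add)
    then obtain j :: int where j: "?x = j * (2 * pi)"
      unfolding cos_one_2pi_int by (auto simp: mult.assoc)
    have "real m / real n * (2 * pi) = j * (2 * pi)" using j n by (simp add: \<theta>_def mult_ac)
    then have "real m / real n = j" by (subst (asm) mult_right_cancel) simp_all
    moreover have "0 < real m / real n" "real m / real n < 1" using m n by auto
    ultimately show ?thesis by simp
  qed
qed

context coxeter
begin

lemma order_alt:
  assumes st: "s \<in> S" "t \<in> S" "s \<noteq> t" and m: "0 < m" "enat m < k s t"
  shows "val (alt_word (2 * m) s t) \<noteq> \<one>"
proof
  let ?u = "map (\<lambda>s. (s, True)) (alt_word (2 * m) s t)"
  assume *: "val (alt_word (2 * m) s t) = \<one>"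
  have u: "?u \<in> signed_words S" using set_alt[of "2 * m" s t] st by (auto simp: signed_words_def)
  have "word_eval G ?u = word_eval G []" using * word_eval_val[OF u] by (simp add: comp_def word_eval_def)
  then have "pres_equiv S (coxeter_relators S k) ?u []" using u by (simp add: pres_iff signed_words_def)
  from pres_equiv_order[OF matrix st m this] show False by (simp add: comp_def)
qed

end

section \<open>Descents and finite parabolic subgroups\<close>

context coxeter
begin

definition descents :: "'a \<Rightarrow> 'a set" where
  "descents g = {s \<in> S. len (g \<otimes> s) < len g}"

lemma desc_S: "descents g \<subseteq> S" by (auto simp: descents_def)

lemma finite_descents: "finite (descents g)" using desc_S finite_S by (rule finite_subset)

lemma not_desc_iff: "s \<in> S \<Longrightarrow> g \<in> carrier G \<Longrightarrow> s \<notin> descents g \<longleftrightarrow> len (g \<otimes> s) = Suc (len g)"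
  using len_mult_cases[of s g] by (auto simp: descents_def)

lemma desc_empty:
  assumes g: "g \<in> carrier G"
  shows "descents g = {} \<longleftrightarrow> g = \<one>"
proof
  assume e: "descents g = {}"
  obtain w where w: "set w \<subseteq> S" "val w = g" "length w = len g" using reduced_word g .
  show "g = \<one>"
  proof (cases w rule: rev_cases)
    case (snoc u s)
    have "g \<otimes> s = val u" using w snoc by (auto simp: val_append m_assoc)
    then have "len (g \<otimes> s) \<le> length u" using len_val w snoc by auto
    then have "s \<in> descents g" using w snoc by (auto simp: descents_def)
    then show ?thesis using e by simp
  qed (use w in simp)
qed (auto simp: descents_def)

lemma len_triangle: "a \<in> carrier G \<Longrightarrow> b \<in> carrier G \<Longrightarrow> len (a \<otimes> b) \<le> len a + len b"
proof -
  assume *: "a \<in> carrier G" "b \<in> carrier G"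
  obtain u where u: "set u \<subseteq> S" "val u = a" "length u = len a" using reduced_word *(1) .
  obtain v where v: "set v \<subseteq> S" "val v = b" "length v = len b" using reduced_word *(2) .
  show ?thesis using len_val[of "u @ v"] u v by (simp add: val_append)
qed

text \<open>
  The deleted letter of the exchange condition lies in one of the two factors; in the second case the
  first factor cancels.
\<close>
lemma exchange_append:
  assumes u: "set u \<subseteq> S" and x: "set x \<subseteq> S" and red: "len (val u \<otimes> val x) = length u + length x"
    and s: "s \<in> S" and le: "len (val u \<otimes> val x \<otimes> s) \<le> length u + length x"
  obtains (left) u' where "set u' \<subseteq> set u" "Suc (length u') = length u" "val u \<otimes> val x \<otimes> s = val u' \<otimes> val x"
    | (right) x' where "set x' \<subseteq> set x" "Suc (length x') = length x" "val x \<otimes> s = val x'"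
proof -
  have e: "val (u @ x) = val u \<otimes> val x" using u x by (rule val_append)
  obtain v1 a v2 where v: "u @ x = v1 @ a # v2" "val u \<otimes> val x \<otimes> s = val (v1 @ v2)"
    by (rule exchange[of "u @ x" s]) (use assms e in auto)
  from v(1) have "(\<exists>y. u = v1 @ a # y \<and> v2 = y @ x) \<or> (\<exists>y. v1 = u @ y \<and> x = y @ a # v2)"
    by (auto simp: append_eq_append_conv2 Cons_eq_append_conv append_eq_Cons_conv)
  then consider y where "u = v1 @ a # y" "v2 = y @ x" | y where "v1 = u @ y" "x = y @ a # v2" by blast
  then show thesis
  proof cases
    case 1
    show ?thesis by (rule left[of "v1 @ y"]) (use 1 v u x in \<open>auto simp: val_append m_assoc\<close>)
  next
    case 2
    have "val u \<otimes> (val x \<otimes> s) = val u \<otimes> val (y @ v2)"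
      using v(2) 2 u x s by (auto simp: val_append m_assoc)
    then have "val x \<otimes> s = val (y @ v2)" using u x s 2 by (subst (asm) Units_l_cancel) auto
    then show ?thesis by (rule right[rotated 2]) (use 2 in auto)
  qed
qed

text \<open>
  Letter by letter: if \<open>g = y x\<close> is reduced and \<open>s\<close> is a descent of \<open>g\<close> while \<open>x s\<close> is longer than \<open>x\<close>, the exchange
  condition must delete a letter of \<open>y\<close>, so that \<open>x s\<close> also splits off.
\<close>
lemma desc_absorb:
  assumes g: "g \<in> carrier G" and I: "I \<subseteq> descents g" and x: "set x \<subseteq> I" "len (val x) = length x"
  shows "\<exists>y\<in>carrier G. g = y \<otimes> val x \<and> len y + length x = len g"
  using x
proof (induction x rule: rev_induct)
  case Nil
  then show ?case using g by auto
next
  case (snoc s x)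
  have s: "s \<in> S" "s \<in> descents g" and xS: "set x \<subseteq> S" using snoc.prems I desc_S by auto
  have red: "len (val x) = length x"
    using snoc.prems(2) len_mult_ge[of s "val x"] len_val[of x] s xS by (simp add: val_append)
  then obtain y where y: "y \<in> carrier G" "g = y \<otimes> val x" "len y + length x = len g" using snoc by auto
  obtain u where u: "set u \<subseteq> S" "val u = y" "length u = len y" using reduced_word y(1) .
  have "len (g \<otimes> s) \<le> len g" using s(2) by (auto simp: descents_def)
  then show ?case
  proof (rule exchange_append[OF u(1) xS _ s(1), unfolded u y(2)[symmetric] y(3), OF HOL.refl])
    fix u' assume u': "set u' \<subseteq> set u" "Suc (length u') = len y" "g \<otimes> s = val u' \<otimes> val x"
    have c: "val u' \<in> carrier G" using u' u by simp
    have "g = g \<otimes> s \<otimes> s" using g s by simp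
    also have "\<dots> = val u' \<otimes> val (x @ [s])" using u' c s xS by (simp add: val_append m_assoc)
    finally have eq: "g = val u' \<otimes> val (x @ [s])" .
    have "len (val u') \<le> length u'" using u' u by (intro len_val) auto
    moreover have "len g \<le> len (val u') + length (x @ [s])"
      using len_triangle[of "val u'" "val (x @ [s])"] snoc.prems(2) c eq s xS by auto
    ultimately have "len (val u') + length (x @ [s]) = len g" using u'(2) y(3) by simp
    then show ?thesis using c eq by blast
  next
    fix x' assume x': "set x' \<subseteq> set x" "Suc (length x') = length x" "val x \<otimes> s = val x'"
    have "len (val (x @ [s])) \<le> length x'" using x' xS s len_val[of x'] by (simp add: val_append)
    then show ?thesis using snoc.prems(2) x' by simp
  qed
qed

lemma deletion:
  "set w \<subseteq> S \<Longrightarrow> len (val w) \<noteq> length w \<Longrightarrow> \<exists>w'. set w' \<subseteq> set w \<and> length w' < length w \<and> val w' = val w"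
proof (induction w rule: rev_induct)
  case (snoc s u)
  have s: "s \<in> S" "set u \<subseteq> S" using snoc by auto
  show ?case
  proof (cases "len (val u) = length u")
    case True
    have "len (val u \<otimes> s) \<le> length u" using snoc.prems True s len_mult_cases[of s "val u"] by (simp add: val_append)
    then obtain u1 a u2 where "u = u1 @ a # u2" "val u \<otimes> s = val (u1 @ u2)"
      using exchange[of u s] True s by metis
    moreover have "val (u @ [s]) = val u \<otimes> s" using s by (simp add: val_append)
    ultimately have "val (u1 @ u2) = val (u @ [s])" "set (u1 @ u2) \<subseteq> set (u @ [s])" "length (u1 @ u2) < length (u @ [s])"
      by (simp, auto)
    then show ?thesis by blast
  next
    case False
    then obtain u' where "set u' \<subseteq> set u" "length u' < length u" "val u' = val u"
      using snoc s by auto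
    then show ?thesis using s by (intro exI[of _ "u' @ [s]"]) (auto simp: val_append)
  qed
qed simp

lemma parabolic_reduced:
  assumes "I \<subseteq> S" "h \<in> generate G I"
  shows "\<exists>x. set x \<subseteq> I \<and> val x = h \<and> len h = length x"
proof -
  obtain w where w: "set w \<subseteq> I" "val w = h" using assms generate_eq_val by auto
  then show ?thesis
  proof (induction "length w" arbitrary: w rule: less_induct)
    case less
    show ?case
    proof (cases "len (val w) = length w")
      case False
      have "set w \<subseteq> S" using less.prems assms(1) by blast
      then obtain w' where "set w' \<subseteq> set w" "length w' < length w" "val w' = val w"
        using deletion[of w] False by blast
      then show ?thesis using less.hyps[of w'] less.prems by auto
    qed (use less in auto)
  qed
qed

text \<open>
  All reduced words in \<open>I\<close> are suffixes of reduced words of \<open>g\<close>, so their lengths are bounded.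
\<close>
lemma desc_finite:
  assumes "g \<in> carrier G" "I \<subseteq> descents g"
  shows "finite (generate G I)"
proof (rule finite_subset)
  have I: "I \<subseteq> S" using assms desc_S by blast
  show "generate G I \<subseteq> val ` {x. set x \<subseteq> I \<and> length x \<le> len g}"
  proof
    fix h assume "h \<in> generate G I"
    then obtain x where x: "set x \<subseteq> I" "val x = h" "len h = length x" using parabolic_reduced I by blast
    then have "length x \<le> len g" using desc_absorb[OF assms, of x] by auto
    then show "h \<in> val ` {x. set x \<subseteq> I \<and> length x \<le> len g}" using x by auto
  qed
  show "finite (val ` {x. set x \<subseteq> I \<and> length x \<le> len g})"
    using finite_subset[OF I finite_S] by (intro finite_imageI finite_lists_length_le)
qed

section \<open>Cosets of dihedral subgroups\<close>

lemma alt_S: "a \<in> S \<Longrightarrow> b \<in> S \<Longrightarrow> set (alt_word j a b) \<subseteq> S"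
  using set_alt[of j a b] by auto

lemma dihedral_word:
  "set w \<subseteq> {s, t} \<Longrightarrow> s \<in> S \<Longrightarrow> t \<in> S \<Longrightarrow>
    \<exists>a b j. (a, b) \<in> {(s, t), (t, s)} \<and> j \<le> length w \<and> even (j + length w) \<and> val w = val (alt_word j a b)"
proof (induction w)
  case Nil
  then show ?case by (intro exI[of _ s] exI[of _ t] exI[of _ 0]) auto
next
  case (Cons c w)
  then have "\<exists>a b j. (a, b) \<in> {(s, t), (t, s)} \<and> j \<le> length w \<and> even (j + length w) \<and> val w = val (alt_word j a b)"
    by simp
  then obtain a b j where *: "(a, b) \<in> {(s, t), (t, s)}" "j \<le> length w" "even (j + length w)" "val w = val (alt_word j a b)"
    by blast
  have ab: "a \<in> S" "b \<in> S" using *(1) Cons.prems by auto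
  have "c = a \<or> c = b" using *(1) Cons.prems by auto
  then consider "c = b" | "c = a" "j = 0" | i where "c = a" "j = Suc i"
    by (cases j) auto
  then show ?case
  proof cases
    case 1
    then show ?thesis using * by (intro exI[of _ b] exI[of _ a] exI[of _ "Suc j"]) auto
  next
    case 2
    then show ?thesis using * by (intro exI[of _ a] exI[of _ b] exI[of _ 1]) auto
  next
    case 3
    then show ?thesis using * ab alt_S[of b a i]
      by (intro exI[of _ b] exI[of _ a] exI[of _ i]) auto
  qed
qed

lemma order_alt':
  assumes st: "s \<in> S" "t \<in> S" "s \<noteq> t" "(a, b) \<in> {(s, t), (t, s)}" and m: "even m" "0 < m" "enat m < 2 * k s t"
  shows "val (alt_word m a b) \<noteq> \<one>"
proof -
  obtain i where i: "m = 2 * i" using m(1) by blast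
  have "enat i < k s t" using m(3) i by (cases "k s t") (auto simp: numeral_eq_enat)
  moreover have "a \<in> S" "b \<in> S" "a \<noteq> b" "k a b = k s t" using st k_sym by auto
  ultimately show ?thesis using order_alt[of a b i] i m by auto
qed

text \<open>
  Otherwise the alternating word with \<open>i + j\<close> letters would be a relator shorter than the order of \<open>s t\<close>
  permits.
\<close>
lemma alt_neq_swap:
  assumes st: "s \<in> S" "t \<in> S" "s \<noteq> t" and m: "even (i + j)" "0 < i + j" "enat (i + j) < 2 * k s t"
  shows "val (alt_word i t s) \<noteq> val (alt_word j s t)"
proof
  assume *: "val (alt_word i t s) = val (alt_word j s t)"
  let ?a = "if even i then s else t" and ?b = "if even i then t else s"
  have "val (alt_word (i + j) ?a ?b) = val (rev (alt_word i t s)) \<otimes> val (alt_word j s t)"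
    using st alt_S by (simp only: flip: rev_alt_append_alt) (simp add: val_append)
  also have "\<dots> = \<one>" using st alt_S[of s t j] alt_S[of t s i] by (simp flip: inv_val *)
  finally show False using order_alt'[of s t ?a ?b "i + j"] st m by auto
qed

lemma alt_neq:
  assumes st: "s \<in> S" "t \<in> S" "s \<noteq> t" and m: "i < j" "even (i + j)" "enat (i + j) < 2 * k s t"
  shows "val (alt_word i s t) \<noteq> val (alt_word j s t)"
  using assms
proof (induction i arbitrary: j s t)
  case 0
  then show ?case using order_alt'[of s t s t j] by auto
next
  case (Suc i)
  then obtain j' where j: "j = Suc j'" by (cases j) auto
  have "enat (i + j') < 2 * k t s"
    by (rule le_less_trans[OF _ Suc.prems(6)[unfolded k_sym[OF Suc.prems(1,2)]]]) (simp add: j)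
  then have "val (alt_word i t s) \<noteq> val (alt_word j' t s)" using Suc j by (intro Suc.IH) auto
  then show ?case using Suc.prems alt_S[of t s] unfolding j by simp
qed

definition min_coset_reps :: "'a \<Rightarrow> 'a \<Rightarrow> 'a set" where
  "min_coset_reps s t = {u \<in> carrier G. \<forall>x\<in>generate G {s, t}. len u \<le> len (u \<otimes> x)}"

lemma alt_generate: "(a, b) \<in> {(s, t), (t, s)} \<Longrightarrow> s \<in> S \<Longrightarrow> t \<in> S \<Longrightarrow> val (alt_word j a b) \<in> generate G {s, t}"
  using set_alt[of j a b] generate_eq_val[of "{s, t}"] by auto

lemma generate_carrier: "I \<subseteq> S \<Longrightarrow> generate G I \<subseteq> carrier G"
  using generate_in_carrier[of I] S_carrier by blast

text \<open>
  Add the letters of the alternating word one at a time. If the length dropped, the exchange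
  condition would delete a letter of \<open>u\<close>, contradicting minimality, or a letter of the alternating
  word, contradicting the order of \<open>s t\<close>.
\<close>
lemma len_coset_alt:
  assumes st: "s \<in> S" "t \<in> S" "s \<noteq> t" "(a, b) \<in> {(s, t), (t, s)}" and u: "u \<in> min_coset_reps s t"
    and j: "enat j \<le> k s t"
  shows "len (u \<otimes> val (alt_word j a b)) = len u + j"
  using j
proof (induction j)
  case 0
  then show ?case using u by (simp add: min_coset_reps_def)
next
  case (Suc j)
  define c where "c = (if even j then a else b)"
  have ab: "a \<in> S" "b \<in> S" "a \<noteq> b" "c \<in> S" "k a b = k s t" using st k_sym by (auto simp: c_def)
  have uc: "u \<in> carrier G" using u by (simp add: min_coset_reps_def)
  have le: "enat j \<le> k s t" using Suc.prems by (meson Suc_ile_eq order_less_imp_le)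
  obtain w where w: "set w \<subseteq> S" "val w = u" "length w = len u" using reduced_word uc .
  have aS: "set (alt_word j a b) \<subseteq> S" "set (alt_word (Suc j) a b) \<subseteq> S" using alt_S ab by blast+
  then have ac: "val (alt_word j a b) \<in> carrier G" by simp
  have snoc: "val (alt_word (Suc j) a b) = val (alt_word j a b) \<otimes> c"
    using ab aS unfolding alt_Suc_snoc c_def by (simp add: val_append)
  have IH: "len (u \<otimes> val (alt_word j a b)) = len u + j" using Suc.IH le by simp
  show ?case
  proof (rule ccontr)
    assume "len (u \<otimes> val (alt_word (Suc j) a b)) \<noteq> len u + Suc j"
    then have "len (val w \<otimes> val (alt_word j a b) \<otimes> c) \<le> length w + length (alt_word j a b)"
      using len_mult_cases[of c "u \<otimes> val (alt_word j a b)"] ab uc ac IH w unfolding snoc by (simp add: m_assoc)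
    moreover have red: "len (val w \<otimes> val (alt_word j a b)) = length w + length (alt_word j a b)" using IH w by simp
    ultimately show False
    proof (rule_tac exchange_append[OF w(1) aS(1) red ab(4)])
      fix w' assume w': "set w' \<subseteq> set w" "Suc (length w') = length w"
        "val w \<otimes> val (alt_word j a b) \<otimes> c = val w' \<otimes> val (alt_word j a b)"
      let ?x = "val (alt_word (Suc j) a b) \<otimes> inv (val (alt_word j a b))"
      have c: "val w' \<in> carrier G" using w w' by simp
      have "u \<otimes> ?x = u \<otimes> val (alt_word j a b) \<otimes> c \<otimes> inv (val (alt_word j a b))"
        using uc ac ab by (simp add: snoc m_assoc del: alt_word.simps)
      also have "\<dots> = val w'" using w' w(2) c ac by (simp add: m_assoc)
      finally have 1: "u \<otimes> ?x = val w'" .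
      have I: "{s, t} \<subseteq> carrier G" using st by auto
      have "?x \<in> generate G {s, t}"
        by (intro generate.eng generate_m_inv_closed[OF I] alt_generate[OF st(4) st(1,2)])
      then have "len u \<le> len (val w')" using u 1 by (auto simp: min_coset_reps_def)
      moreover have "len (val w') \<le> length w'" using w' w by (intro len_val) blast
      ultimately show False using w(3) w'(2) by linarith
    next
      fix x' assume x': "set x' \<subseteq> set (alt_word j a b)" "Suc (length x') = length (alt_word j a b)"
         "val (alt_word j a b) \<otimes> c = val x'"
      have "set x' \<subseteq> {a, b}" using x'(1) set_alt[of j a b] by (rule subset_trans)
      then obtain p q i where i: "(p, q) \<in> {(a, b), (b, a)}" "i \<le> length x'" "even (i + length x')" "val x' = val (alt_word i p q)"
        using dihedral_word[of x' a b] ab by blast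
      have "enat (i + Suc j) \<le> enat (2 * j)" using i x' by simp
      also have "\<dots> < 2 * k a b" using Suc.prems ab by (cases "k s t") (auto simp: numeral_eq_enat)
      finally have lt: "enat (i + Suc j) < 2 * k a b" .
      have ev: "even (i + Suc j)" using i(3) x'(2)[symmetric] by simp
      consider "p = a" "q = b" | "p = b" "q = a" using i(1) by auto
      then have "val (alt_word i p q) \<noteq> val (alt_word (Suc j) a b)"
      proof cases
        case 1
        then show ?thesis using alt_neq[of a b i "Suc j"] lt ev ab i x' by auto
      next
        case 2
        then show ?thesis using alt_neq_swap[of a b i "Suc j"] lt ev ab by auto
      qed
      then show False using x' i snoc by simp
    qed
  qed
qed

lemma one_min_coset_reps: "\<one> \<in> min_coset_reps s t" by (simp add: min_coset_reps_def)

lemma len_alt: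
  assumes "s \<in> S" "t \<in> S" "s \<noteq> t" "(a, b) \<in> {(s, t), (t, s)}" "enat j \<le> k s t"
  shows "len (val (alt_word j a b)) = j"
proof -
  have "a \<in> S" "b \<in> S" using assms by auto
  then show ?thesis using len_coset_alt[OF assms(1-4) one_min_coset_reps assms(5)] alt_S[of a b] by simp
qed

text \<open>
  The alternating words of all lengths are reduced.
\<close>
lemma generate_pair_infinite:
  assumes "s \<in> S" "t \<in> S" "s \<noteq> t" "k s t = \<infinity>"
  shows "infinite (generate G {s, t})"
proof -
  have l: "len (val (alt_word j s t)) = j" for j by (rule len_alt[OF assms(1-3)]) (simp_all add: assms(4))
  have "inj (\<lambda>j. val (alt_word j s t))" by (rule inj_on_inverseI[where g = len]) (rule l)
  then have "infinite (range (\<lambda>j. val (alt_word j s t)))" by (simp add: range_inj_infinite)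
  moreover have "range (\<lambda>j. val (alt_word j s t)) \<subseteq> generate G {s, t}" using alt_generate assms by auto
  ultimately show ?thesis using finite_subset by blast
qed

end

locale coxeter_pair = coxeter +
  fixes s t n
  assumes s: "s \<in> S" and t: "t \<in> S" and neq: "s \<noteq> t" and n: "k s t = enat n"
begin

lemma n2: "2 \<le> n" using k_ge2[OF s t neq] n by (simp add: numeral_eq_enat)

abbreviation "W \<equiv> generate G {s, t}"
abbreviation "U \<equiv> min_coset_reps s t"

lemma W_carrier: "W \<subseteq> carrier G" using generate_carrier s t by auto

lemma alt_c [simp]: "val (alt_word j s t) \<in> carrier G" "val (alt_word j t s) \<in> carrier G"
  using alt_S s t by simp_all

lemma braid: "val (alt_word n t s) = val (alt_word n s t)"
proof -
  let ?a = "if even n then s else t" and ?b = "if even n then t else s"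
  have "val (alt_word (n + n) ?a ?b) = \<one>"
    using relator_word[of s t n] relator_word[of t s n] s t n k_sym by (simp flip: mult_2)
  moreover have "val (alt_word (n + n) ?a ?b) = inv (val (alt_word n t s)) \<otimes> val (alt_word n s t)"
    using s t alt_S by (simp only: flip: rev_alt_append_alt) (simp add: val_append inv_val)
  ultimately show ?thesis by (metis alt_c inv_closed inv_equality inv_inv)
qed

text \<open>
  The \<open>2 n\<close> elements of the dihedral group are listed as the alternating words with fewer than \<open>n\<close> letters
  that start with \<open>s\<close>, and those with \<open>1\<close> to \<open>n\<close> letters that start with \<open>t\<close>. In this form the sum of \<open>w\<close> to the
  power of the length is visibly \<open>[n](w) + w [n](w)\<close>.
\<close>
lemma W_eq: "W = (\<lambda>j. val (alt_word j s t)) ` {..<n} \<union> (\<lambda>j. val (alt_word (Suc j) t s)) ` {..<n}" (is "_ = ?R")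
proof
  have in1: "val (alt_word j s t) \<in> ?R" if "j < n" for j using that by blast
  have in2: "val (alt_word j t s) \<in> ?R" if "j \<le> n" for j
    using that in1[of 0] n2 by (cases j) (auto simp del: alt_word.simps(2))
  have in1': "val (alt_word j s t) \<in> ?R" if "j \<le> n" for j
    using that in1[of j] in2[of n] braid by (cases "j = n") auto
  have tR: "t \<otimes> h \<in> ?R" if h: "h \<in> ?R" for h
  proof -
    from h consider j where "j < n" "h = val (alt_word j s t)" | j where "j < n" "h = val (alt_word (Suc j) t s)" by blast
    then show ?thesis
    proof cases
      case 1
      then show ?thesis using in2[of "Suc j"] by simp
    next
      case 2
      then show ?thesis using in1[of j] t by simp
    qed
  qed
  have sR: "s \<otimes> h \<in> ?R" if h: "h \<in> ?R" for h
  proof -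
    from h consider j where "j < n" "h = val (alt_word (Suc j) s t)" | "h = \<one>" | j where "j < n" "h = val (alt_word j t s)"
      | "h = val (alt_word n s t)"
      by (auto simp del: alt_word.simps(2)) (metis alt_word.simps(1) val_Nil not0_implies_Suc Suc_lessD,
         metis braid less_antisym not_less_eq)
    then show ?thesis
    proof cases
      case 1
      then show ?thesis using in2[of j] s by simp
    next
      case 2
      then show ?thesis using in1[of 1] s n2 by simp
    next
      case 3
      then show ?thesis using in1'[of "Suc j"] by simp
    next
      case 4
      then obtain i where "n = Suc i" using n2 by (cases n) auto
      then show ?thesis using in2[of i] 4 s by simp
    qed
  qed
  show "W \<subseteq> ?R"
  proof
    fix h assume "h \<in> W"
    then obtain w where h: "h = val w" and "set w \<subseteq> {s, t}" using generate_eq_val[of "{s, t}"] s t by auto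
    from this(2) show "h \<in> ?R" unfolding h
    proof (induction w)
      case Nil
      then show ?case using in1[of 0] n2 by simp
    next
      case (Cons c w)
      then have "c = s \<or> c = t" and w: "val w \<in> ?R" by auto
      then show ?case using tR[OF w] sR[OF w] unfolding val_Cons by blast
    qed
  qed
  show "?R \<subseteq> W" using alt_generate[of s t s t] alt_generate[of t s s t] s t by (auto simp del: alt_word.simps)
qed

lemma W_cases:
  assumes "x \<in> W"
  obtains j where "j \<le> n" "x = val (alt_word j s t)" | j where "j \<le> n" "x = val (alt_word j t s)"
proof -
  from assms consider j where "j < n" "x = val (alt_word j s t)" | j where "j < n" "x = val (alt_word (Suc j) t s)"
    unfolding W_eq by blast
  then show thesis
  proof cases
    case (1 j)
    then show thesis using that(1)[of j] by simp
  next
    case (2 j)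
    show thesis by (rule that(2)[of "Suc j"]) (use 2 in \<open>simp_all del: alt_word.simps\<close>)
  qed
qed

lemma len_st: "j \<le> n \<Longrightarrow> len (val (alt_word j s t)) = j" and len_ts: "j \<le> n \<Longrightarrow> len (val (alt_word j t s)) = j"
  using len_alt[of s t s t j] len_alt[of s t t s j] s t neq n by auto

lemma inj_st: "inj_on (\<lambda>j. val (alt_word j s t)) {..<n}"
  and inj_ts: "inj_on (\<lambda>j. val (alt_word (Suc j) t s)) {..<n}"
  by (rule inj_onI, metis len_st lessThan_iff order_less_imp_le)
     (rule inj_onI, metis len_ts lessThan_iff Suc_leI Suc_inject)

lemma disj: "(\<lambda>j. val (alt_word j s t)) ` {..<n} \<inter> (\<lambda>j. val (alt_word (Suc j) t s)) ` {..<n} = {}"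
proof -
  have False if "j < n" "i < n" "val (alt_word j s t) = val (alt_word (Suc i) t s)" for i j
  proof -
    have "j = Suc i" using len_st[of j] len_ts[of "Suc i"] that by simp
    then show False using alt_neq_swap[of s t "Suc i" j] that s t neq n by (auto simp: numeral_eq_enat)
  qed
  then show ?thesis by blast
qed

lemma sum_W: "(\<Sum>x\<in>W. f (len x)) = (\<Sum>j<n. f j) + (\<Sum>j<n. f (Suc j))"
proof -
  have "(\<Sum>x\<in>W. f (len x)) = (\<Sum>x\<in>(\<lambda>j. val (alt_word j s t)) ` {..<n}. f (len x)) +
      (\<Sum>x\<in>(\<lambda>j. val (alt_word (Suc j) t s)) ` {..<n}. f (len x))"
    unfolding W_eq by (rule sum.union_disjoint[OF _ _ disj]) simp_all
  also have "\<dots> = (\<Sum>j<n. f (len (val (alt_word j s t)))) + (\<Sum>j<n. f (len (val (alt_word (Suc j) t s))))"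
    by (simp only: sum.reindex[OF inj_st] sum.reindex[OF inj_ts] comp_def)
  also have "\<dots> = (\<Sum>j<n. f j) + (\<Sum>j<n. f (Suc j))"
    using len_st len_ts by (intro arg_cong2[where f = "(+)"] sum.cong) (simp_all del: alt_word.simps)
  finally show ?thesis .
qed

lemma finite_W: "finite W" unfolding W_eq by simp

lemma card_W: "card W = 2 * n" using sum_W[of "\<lambda>_. 1::nat"] by simp

lemma len_UW: "u \<in> U \<Longrightarrow> x \<in> W \<Longrightarrow> len (u \<otimes> x) = len u + len x"
proof -
  assume u: "u \<in> U" and "x \<in> W"
  from this(2) show ?thesis
    by (cases rule: W_cases) (use len_coset_alt[of s t s t u] len_coset_alt[of s t t s u] s t neq n u len_st len_ts in auto)
qed

text \<open>
  Two shortest elements of one coset have equal length, so by additivity of the length they differ by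
  an element of length 0; this is what makes the factorisation unique.
\<close>
lemma UW_bij: "bij_betw (\<lambda>(u, x). u \<otimes> x) (U \<times> W) (carrier G)"
proof (rule bij_betwI')
  have Uc: "u \<in> carrier G" if "u \<in> U" for u using that by (simp add: min_coset_reps_def)
  have Wc: "x \<in> carrier G" if "x \<in> W" for x using that W_carrier by auto
  have sub: "{s, t} \<subseteq> carrier G" using s t by auto
  fix p q assume pq: "p \<in> U \<times> W" "q \<in> U \<times> W"
  obtain u x v y where e: "p = (u, x)" "q = (v, y)" by fastforce
  have c: "u \<in> U" "v \<in> U" "x \<in> W" "y \<in> W" using pq e by auto
  note cc = Uc[OF c(1)] Uc[OF c(2)] Wc[OF c(3)] Wc[OF c(4)]
  have "u = v \<and> x = y" if *: "u \<otimes> x = v \<otimes> y"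
  proof -
    let ?z = "x \<otimes> inv y"
    have z: "?z \<in> W" using c generate_m_inv_closed[OF sub] by (auto intro: generate.eng)
    have iz: "inv ?z \<in> W" using z generate_m_inv_closed[OF sub] by blast
    have "u \<otimes> ?z = u \<otimes> x \<otimes> inv y" using cc by (simp add: m_assoc)
    also have "\<dots> = v" using * cc by (simp add: m_assoc)
    finally have v: "v = u \<otimes> ?z" ..
    then have u: "u = v \<otimes> inv ?z" using cc by (simp add: m_assoc)
    have "len v = len u + len ?z" using v len_UW[OF c(1) z] by simp
    moreover have "len v \<le> len u" using c(2) iz u by (auto simp: min_coset_reps_def)
    ultimately have "len ?z = 0" by simp
    then have "?z = \<one>" using cc by (simp add: len_eq_0)
    then have "u = v" using v cc by simp
    then show ?thesis using * cc by simp
  qed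
  then show "((case p of (u, x) \<Rightarrow> u \<otimes> x) = (case q of (u, x) \<Rightarrow> u \<otimes> x)) = (p = q)"
    using e by auto
  show "(case p of (u, x) \<Rightarrow> u \<otimes> x) \<in> carrier G" using e cc by simp
next
  have sub: "{s, t} \<subseteq> carrier G" using s t by auto
  fix g assume g: "g \<in> carrier G"
  obtain x where x: "x \<in> W" "\<And>y. y \<in> W \<Longrightarrow> len (g \<otimes> x) \<le> len (g \<otimes> y)"
    using ex_has_least_nat[of "\<lambda>x. x \<in> W" \<one> "\<lambda>x. len (g \<otimes> x)"] generate.one[of G "{s, t}"] by blast
  have xc: "x \<in> carrier G" using x W_carrier by auto
  have "g \<otimes> x \<in> U" unfolding min_coset_reps_def
  proof (intro CollectI conjI ballI)
    fix y assume y: "y \<in> W"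
    have "len (g \<otimes> x) \<le> len (g \<otimes> (x \<otimes> y))" by (rule x(2)) (rule generate.eng[OF x(1) y])
    moreover have "y \<in> carrier G" using y W_carrier by blast
    ultimately show "len (g \<otimes> x) \<le> len (g \<otimes> x \<otimes> y)" using g xc by (simp add: m_assoc)
  qed (use g xc in simp)
  moreover have "inv x \<in> W" using x generate_m_inv_closed[OF sub] by blast
  ultimately show "\<exists>p\<in>U \<times> W. g = (case p of (u, x) \<Rightarrow> u \<otimes> x)"
    using g xc by (intro bexI[of _ "(g \<otimes> x, inv x)"]) (auto simp: m_assoc)
qed

text \<open>
  As lengths add in \<open>u x\<close>, the descents among \<open>s\<close> and \<open>t\<close> are those of \<open>x\<close>. An alternating word with fewer than \<open>n\<close>
  letters can be prolonged, so it does not have both; the word with \<open>n\<close> letters has both, because by the braid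
  relation it can end in either letter.
\<close>
lemma both_desc: "{g \<in> carrier G. {s, t} \<subseteq> descents g} = (\<lambda>u. u \<otimes> val (alt_word n s t)) ` U"
proof (intro equalityI subsetI)
  fix g assume "g \<in> {g \<in> carrier G. {s, t} \<subseteq> descents g}"
  then have g: "g \<in> carrier G" "s \<in> descents g" "t \<in> descents g" by auto
  obtain u x where ux: "u \<in> U" "x \<in> W" "g = u \<otimes> x"
  proof -
    have "g \<in> (\<lambda>(u, x). u \<otimes> x) ` (U \<times> W)" using UW_bij g(1) by (simp only: bij_betw_def)
    then obtain p where "p \<in> U \<times> W" "g = (case p of (u, x) \<Rightarrow> u \<otimes> x)" by blast
    then show thesis using that[of "fst p" "snd p"] by (simp add: mem_Times_iff case_prod_unfold)
  qed
  have uc: "u \<in> carrier G" and xc: "x \<in> carrier G" using ux W_carrier by (auto simp: min_coset_reps_def)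
  have d: "len (x \<otimes> c) < len x" if c: "c \<in> {s, t}" for c
  proof -
    have cS: "c \<in> S" using c s t by auto
    have "x \<otimes> c \<in> W" using ux c by (auto intro: generate.eng generate.incl)
    then have "len (g \<otimes> c) = len u + len (x \<otimes> c)" using len_UW[OF ux(1)] ux uc xc cS by (simp add: m_assoc)
    moreover have "len (g \<otimes> c) < len g" using c g by (auto simp: descents_def)
    ultimately show ?thesis using len_UW[OF ux(1,2)] ux by simp
  qed
  have *: "j = n" if j: "j \<le> n" "(a, b) \<in> {(s, t), (t, s)}" "x = val (alt_word j a b)" for j a b
  proof (rule ccontr)
    assume "j \<noteq> n"
    let ?c = "if even j then a else b"
    have c: "?c \<in> {s, t}" "?c \<in> S" "a \<in> S" "b \<in> S" using j s t by auto
    have "x \<otimes> ?c = val (alt_word (Suc j) a b)"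
      unfolding alt_Suc_snoc using j c alt_S[of a b j] by (simp add: val_append split del: if_split)
    then have "len (x \<otimes> ?c) = Suc j" using len_alt[of s t a b "Suc j"] j \<open>j \<noteq> n\<close> n s t neq by simp
    moreover have "len x = j" using len_alt[of s t a b j] j n s t neq by simp
    ultimately show False using d[OF c(1)] by simp
  qed
  from ux(2) have "x = val (alt_word n s t)"
    by (cases rule: W_cases) (use *[of _ s t] *[of _ t s] braid in auto)
  then show "g \<in> (\<lambda>u. u \<otimes> val (alt_word n s t)) ` U" using ux by auto
next
  fix g assume "g \<in> (\<lambda>u. u \<otimes> val (alt_word n s t)) ` U"
  then obtain u where u: "u \<in> U" "g = u \<otimes> val (alt_word n s t)" by auto
  have uc: "u \<in> carrier G" using u by (auto simp: min_coset_reps_def)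
  have lg: "len g = len u + n" using u len_UW[of u "val (alt_word n s t)"] len_st[of n] alt_generate[of s t s t n] s t by simp
  obtain i where i: "n = Suc i" using n2 by (cases n) auto
  have 1: "g = u \<otimes> val (alt_word n a b)" if "(a, b) \<in> {(s, t), (t, s)}" for a b
    using u braid that by auto
  have "(if even i then a else b) \<in> descents g" if ab: "(a, b) \<in> {(s, t), (t, s)}" for a b
  proof -
    let ?c = "if even i then a else b"
    have c: "?c \<in> S" "a \<in> S" "b \<in> S" using ab s t by auto
    have "val (alt_word n a b) = val (alt_word i a b) \<otimes> ?c"
      unfolding i alt_Suc_snoc using c alt_S[of a b i] by (simp add: val_append split del: if_split)
    then have "g \<otimes> ?c = u \<otimes> val (alt_word i a b)" using 1[OF ab] c uc alt_S[of a b i] by (simp add: m_assoc split del: if_split)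
    then have "len (g \<otimes> ?c) = len u + i"
      using len_coset_alt[OF s t neq ab u(1), of i] i n by simp
    then show ?thesis using c lg i by (simp add: descents_def)
  qed
  from this[of s t] this[of t s] show "g \<in> {g \<in> carrier G. {s, t} \<subseteq> descents g}"
    using uc u by (auto split: if_splits)
qed

end

section \<open>The growth series\<close>

context coxeter
begin

definition len_sphere :: "nat \<Rightarrow> 'a set" where "len_sphere n = {g \<in> carrier G. len g = n}"

lemma finite_len_sphere: "finite (len_sphere n)"
proof (rule finite_subset)
  show "len_sphere n \<subseteq> val ` {w. set w \<subseteq> S \<and> length w \<le> n}"
  proof
    fix g assume "g \<in> len_sphere n"
    then obtain w where "set w \<subseteq> S" "val w = g" "length w = n"
      using reduced_word[of g] by (auto simp: len_sphere_def)
    then show "g \<in> val ` {w. set w \<subseteq> S \<and> length w \<le> n}" by auto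
  qed
qed (intro finite_imageI finite_lists_length_le finite_S)

definition growth_series :: "'a set \<Rightarrow> complex fps" where
  "growth_series A = Abs_fps (\<lambda>n. of_nat (card {g \<in> A. len g = n}))"

lemma len_sphere_sub: "A \<subseteq> carrier G \<Longrightarrow> {g \<in> A. len g = n} \<subseteq> len_sphere n"
  by (auto simp: len_sphere_def)

lemma growth_series_nth: "A \<subseteq> carrier G \<Longrightarrow> fps_nth (growth_series A) n = (\<Sum>g\<in>len_sphere n. of_bool (g \<in> A))"
proof -
  assume A: "A \<subseteq> carrier G"
  have "{g \<in> A. len g = n} = {g \<in> len_sphere n. g \<in> A}" using A by (auto simp: len_sphere_def)
  then show ?thesis using finite_len_sphere by (simp add: growth_series_def sum.If_cases of_bool_def Int_def)
qed

lemma growth_series_UN: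
  assumes "finite X" "\<And>x. x \<in> X \<Longrightarrow> A x \<subseteq> carrier G" "disjoint_family_on A X"
  shows "growth_series (\<Union>x\<in>X. A x) = (\<Sum>x\<in>X. growth_series (A x))"
proof (rule fps_ext)
  fix n
  have "card {g \<in> \<Union>x\<in>X. A x. len g = n} = card (\<Union>x\<in>X. {g \<in> A x. len g = n})"
    by (rule arg_cong[of _ _ card]) auto
  also have "\<dots> = (\<Sum>x\<in>X. card {g \<in> A x. len g = n})"
  proof (rule card_UN_disjoint[OF assms(1)])
    show "\<forall>i\<in>X. finite {g \<in> A i. len g = n}"
      using assms(2) finite_subset[OF len_sphere_sub finite_len_sphere] by blast
    show "\<forall>i\<in>X. \<forall>j\<in>X. i \<noteq> j \<longrightarrow> {g \<in> A i. len g = n} \<inter> {g \<in> A j. len g = n} = {}"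
      using assms(3) unfolding disjoint_family_on_def by blast
  qed
  finally show "fps_nth (growth_series (\<Union>x\<in>X. A x)) n = fps_nth (\<Sum>x\<in>X. growth_series (A x)) n"
    by (simp add: growth_series_def fps_sum_nth)
qed

lemma growth_series_shift:
  assumes "inj_on f A" "\<And>a. a \<in> A \<Longrightarrow> len (f a) = len a + m"
  shows "growth_series (f ` A) = fps_X ^ m * growth_series A"
proof (rule fps_ext)
  fix n
  have "{g \<in> f ` A. len g = n} = f ` {a \<in> A. len a + m = n}" using assms(2) by auto
  moreover have "inj_on f {a \<in> A. len a + m = n}" using assms(1) by (rule inj_on_subset) auto
  ultimately have c: "card {g \<in> f ` A. len g = n} = card {a \<in> A. len a + m = n}" by (simp add: card_image)
  show "fps_nth (growth_series (f ` A)) n = fps_nth (fps_X ^ m * growth_series A) n"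
  proof (cases "n < m")
    case True
    then have "{a \<in> A. len a + m = n} = {}" by auto
    then show ?thesis using True unfolding growth_series_def fps_nth_Abs_fps c by (simp add: fps_X_power_mult_nth)
  next
    case False
    then have "{a \<in> A. len a + m = n} = {a \<in> A. len a = n - m}" by auto
    then show ?thesis using False unfolding growth_series_def fps_nth_Abs_fps c by (simp add: fps_X_power_mult_nth)
  qed
qed

lemma right_mult_inj: "x \<in> carrier G \<Longrightarrow> A \<subseteq> carrier G \<Longrightarrow> inj_on (\<lambda>g. g \<otimes> x) A"
  by (intro inj_onI) (auto simp: subset_iff)

lemma single_image:
  assumes s: "s \<in> S"
  shows "{g \<in> carrier G. s \<in> descents g} = (\<lambda>g. g \<otimes> s) ` {g \<in> carrier G. s \<notin> descents g}"
proof (intro equalityI subsetI)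
  fix g assume g: "g \<in> {g \<in> carrier G. s \<in> descents g}"
  then have "s \<notin> descents (g \<otimes> s)" using s by (auto simp: descents_def)
  then show "g \<in> (\<lambda>g. g \<otimes> s) ` {g \<in> carrier G. s \<notin> descents g}"
    using g s by (intro image_eqI[of _ _ "g \<otimes> s"]) auto
next
  fix g assume "g \<in> (\<lambda>g. g \<otimes> s) ` {g \<in> carrier G. s \<notin> descents g}"
  then obtain h where h: "h \<in> carrier G" "s \<notin> descents h" "g = h \<otimes> s" by auto
  then have "len g = Suc (len h)" "g \<otimes> s = h" using s not_desc_iff[of s h] by auto
  then show "g \<in> {g \<in> carrier G. s \<in> descents g}" using h s by (simp add: descents_def)
qed

text \<open>
  Multiplication by \<open>s\<close> pairs the elements without the descent \<open>s\<close> with those having it, which are one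
  longer.
\<close>
lemma growth_series_single:
  assumes s: "s \<in> S"
  shows "(1 + fps_X) * growth_series {g \<in> carrier G. s \<in> descents g} = fps_X * growth_series (carrier G)"
proof -
  let ?D = "{g \<in> carrier G. s \<in> descents g}" and ?N = "{g \<in> carrier G. s \<notin> descents g}"
  have "growth_series (carrier G) = growth_series (\<Union>b\<in>{True, False}. if b then ?D else ?N)"
    by (rule arg_cong[of _ _ growth_series]) auto
  also have "\<dots> = growth_series ?D + growth_series ?N"
    by (subst growth_series_UN) (auto simp: disjoint_family_on_def)
  finally have 1: "growth_series (carrier G) = growth_series ?D + growth_series ?N" .
  have "growth_series ?D = fps_X ^ 1 * growth_series ?N" unfolding single_image[OF s]
  proof (rule growth_series_shift)
    show "inj_on (\<lambda>g. g \<otimes> s) ?N" using s by (intro right_mult_inj) auto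
    show "len (g \<otimes> s) = len g + 1" if "g \<in> ?N" for g using that s not_desc_iff[of s g] by simp
  qed
  then show ?thesis using 1 by (simp add: algebra_simps)
qed

text \<open>
  Each coset of the dihedral group contributes \<open>(1 + w) [n](w)\<close> times a power of \<open>w\<close> to the whole series, and
  only its longest element, which is \<open>n\<close> longer than the shortest, to the series of elements with both
  descents.
\<close>
lemma growth_series_pair:
  assumes "s \<in> S" "t \<in> S" "s \<noteq> t" "k s t = enat n"
  shows "(1 + fps_X) * (\<Sum>i<n. fps_X ^ i) * growth_series {g \<in> carrier G. {s, t} \<subseteq> descents g} = fps_X ^ n * growth_series (carrier G)"
proof -
  interpret coxeter_pair G S k s t n using assms by unfold_locales auto
  have Uc: "U \<subseteq> carrier G" by (auto simp: min_coset_reps_def)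
  have inj: "inj_on (\<lambda>u. u \<otimes> x) U" if "x \<in> W" for x
    using that W_carrier Uc by (intro right_mult_inj) auto
  have shift: "growth_series ((\<lambda>u. u \<otimes> x) ` U) = fps_X ^ len x * growth_series U" if "x \<in> W" for x
    using that by (intro growth_series_shift inj len_UW)
  have img: "(\<lambda>(u, x). u \<otimes> x) ` (U \<times> W) = carrier G" and ij: "inj_on (\<lambda>(u, x). u \<otimes> x) (U \<times> W)"
    using UW_bij by (auto simp: bij_betw_def)
  have "carrier G = (\<Union>x\<in>W. (\<lambda>u. u \<otimes> x) ` U)" unfolding img[symmetric] by auto
  then have "growth_series (carrier G) = growth_series (\<Union>x\<in>W. (\<lambda>u. u \<otimes> x) ` U)" by (rule arg_cong)
  also have "\<dots> = (\<Sum>x\<in>W. growth_series ((\<lambda>u. u \<otimes> x) ` U))"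
  proof (rule growth_series_UN[OF finite_W])
    show "(\<lambda>u. u \<otimes> x) ` U \<subseteq> carrier G" if "x \<in> W" for x using that Uc W_carrier by auto
    have "x = y" if "x \<in> W" "y \<in> W" "u \<in> U" "v \<in> U" "u \<otimes> x = v \<otimes> y" for x y u v
      using inj_onD[OF ij, of "(u, x)" "(v, y)"] that by simp
    then show "disjoint_family_on (\<lambda>x. (\<lambda>u. u \<otimes> x) ` U) W" by (auto simp: disjoint_family_on_def)
  qed
  also have "\<dots> = (\<Sum>x\<in>W. fps_X ^ len x) * growth_series U" using shift by (simp add: sum_distrib_right)
  also have "(\<Sum>x\<in>W. fps_X ^ len x) = (\<Sum>i<n. fps_X ^ i) + (\<Sum>i<n. fps_X ^ Suc i :: complex fps)"
    by (rule sum_W)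
  also have "\<dots> = (1 + fps_X) * (\<Sum>i<n. fps_X ^ i)" by (simp add: distrib_right sum_distrib_left sum.distrib)
  finally have 1: "growth_series (carrier G) = (1 + fps_X) * (\<Sum>i<n. fps_X ^ i) * growth_series U" .
  have "val (alt_word n s t) \<in> W" using alt_generate[of s t s t n] assms by simp
  then have "growth_series {g \<in> carrier G. {s, t} \<subseteq> descents g} = fps_X ^ n * growth_series U"
    using shift len_st[of n] unfolding both_desc by simp
  then show ?thesis using 1 by (simp add: mult_ac)
qed

lemma card_single: "finite (carrier G) \<Longrightarrow> s \<in> S \<Longrightarrow> 2 * card {g \<in> carrier G. s \<in> descents g} = card (carrier G)"
proof -
  assume f: "finite (carrier G)" and s: "s \<in> S"
  let ?D = "{g \<in> carrier G. s \<in> descents g}" and ?N = "{g \<in> carrier G. s \<notin> descents g}"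
  have "card (carrier G) = card (?D \<union> ?N)" by (rule arg_cong[of _ _ card]) auto
  also have "\<dots> = card ?D + card ?N" using f by (intro card_Un_disjoint) auto
  also have "card ?D = card ?N" unfolding single_image[OF s] using s by (intro card_image right_mult_inj) auto
  finally show ?thesis unfolding single_image[OF s, symmetric] using \<open>card ?D = card ?N\<close> by simp
qed

lemma card_pair:
  assumes "finite (carrier G)" "s \<in> S" "t \<in> S" "s \<noteq> t" "k s t = enat n"
  shows "2 * n * card {g \<in> carrier G. {s, t} \<subseteq> descents g} = card (carrier G)"
proof -
  interpret coxeter_pair G S k s t n using assms by unfold_locales auto
  have "card (carrier G) = card (U \<times> W)" using UW_bij by (simp add: bij_betw_same_card)
  also have "\<dots> = card U * (2 * n)" using card_W by (simp add: card_cartesian_product)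
  also have "card U = card {g \<in> carrier G. {s, t} \<subseteq> descents g}"
    unfolding both_desc using s t by (intro card_image[symmetric] right_mult_inj) (auto simp: min_coset_reps_def)
  finally show ?thesis by simp
qed

text \<open>
  These are the simplices of dimension 1 of the nerve (\<open>finite_generate_pair_iff\<close>).
\<close>
definition edges :: "'a set set" where
  "edges = {{s, t} |s t. s \<in> S \<and> t \<in> S \<and> s \<noteq> t \<and> k s t \<noteq> \<infinity>}"

definition label :: "'a set \<Rightarrow> nat" where
  "label e = (SOME n. \<exists>s\<in>S. \<exists>t\<in>S. s \<noteq> t \<and> e = {s, t} \<and> k s t = enat n)"

lemma label_eq: "s \<in> S \<Longrightarrow> t \<in> S \<Longrightarrow> s \<noteq> t \<Longrightarrow> k s t = enat n \<Longrightarrow> label {s, t} = n"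
  unfolding label_def by (rule some_equality) (auto simp: doubleton_eq_iff k_sym)

lemma edgesE:
  assumes "e \<in> edges"
  obtains s t where "s \<in> S" "t \<in> S" "s \<noteq> t" "e = {s, t}" "k s t = enat (label e)"
proof -
  from assms obtain s t where st: "s \<in> S" "t \<in> S" "s \<noteq> t" "e = {s, t}" "k s t \<noteq> \<infinity>"
    by (auto simp: edges_def)
  then obtain n where "k s t = enat n" by auto
  then show thesis using that[OF st(1-4)] label_eq[OF st(1-3)] st(4) by simp
qed

lemma edges_sub: "edges \<subseteq> Pow S" by (auto simp: edges_def)

lemma finite_edges: "finite edges" using edges_sub finite_S by (meson finite_Pow_iff finite_subset)

lemma label_ge2: "e \<in> edges \<Longrightarrow> 2 \<le> label e"
  by (erule edgesE) (metis k_ge2 enat_ord_simps(1) numeral_eq_enat)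

text \<open>
  Two descents generate a finite group, hence span an edge.
\<close>
lemma pairs_desc:
  assumes "g \<in> carrier G"
  shows "{e. e \<subseteq> descents g \<and> card e = 2} = {e \<in> edges. e \<subseteq> descents g}"
proof (intro equalityI subsetI)
  fix e assume "e \<in> {e. e \<subseteq> descents g \<and> card e = 2}"
  then obtain s t where e: "e = {s, t}" "s \<noteq> t" "{s, t} \<subseteq> descents g" by (auto simp: card_2_iff)
  then have st: "s \<in> S" "t \<in> S" using desc_S by auto
  have "k s t \<noteq> \<infinity>" using desc_finite[OF assms e(3)] generate_pair_infinite[OF st e(2)] by blast
  then show "e \<in> {e \<in> edges. e \<subseteq> descents g}" using e st by (auto simp: edges_def)
qed (auto elim!: edgesE)

text \<open>
  This is \<open>1 - d + d (d - 1) / 2 = 0\<close> for \<open>d = 1\<close> and \<open>d = 2\<close>; only the identity has no descent.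
\<close>
lemma alternating_descents:
  assumes "g \<in> carrier G" "card (descents g) \<le> 2"
  shows "of_bool (g = \<one>) = (1 :: 'c::comm_ring_1) - of_nat (card (descents g)) + of_nat (card {e \<in> edges. e \<subseteq> descents g})"
proof -
  have c: "card {e \<in> edges. e \<subseteq> descents g} = card (descents g) choose 2"
    using n_subsets[OF finite_descents, of g 2] pairs_desc[OF assms(1)] by simp
  have z: "g = \<one> \<longleftrightarrow> card (descents g) = 0" using desc_empty[OF assms(1)] finite_descents by simp
  consider "card (descents g) = 0" | "card (descents g) = 1" | "card (descents g) = 2" using assms(2) by linarith
  then show ?thesis unfolding c z by cases (auto simp: binomial_eq_0)
qed

lemma growth_series_inclusion_exclusion:
  assumes d: "\<And>g. g \<in> carrier G \<Longrightarrow> card (descents g) \<le> 2"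
  shows "growth_series (carrier G) - (\<Sum>s\<in>S. growth_series {g \<in> carrier G. s \<in> descents g}) +
     (\<Sum>e\<in>edges. growth_series {g \<in> carrier G. e \<subseteq> descents g}) = 1"
proof (rule fps_ext)
  fix n
  have cS: "(\<Sum>s\<in>S. of_bool (s \<in> descents g)) = (of_nat (card (descents g)) :: complex)" for g
    using finite_S desc_S[of g] by (simp add: of_bool_def sum.If_cases Int_absorb1)
  have cE: "(\<Sum>e\<in>edges. of_bool (e \<subseteq> descents g)) = (of_nat (card {e \<in> edges. e \<subseteq> descents g}) :: complex)" for g
    using finite_edges by (simp add: of_bool_def sum.If_cases Int_def)
  have "fps_nth (growth_series (carrier G) - (\<Sum>s\<in>S. growth_series {g \<in> carrier G. s \<in> descents g}) +
     (\<Sum>e\<in>edges. growth_series {g \<in> carrier G. e \<subseteq> descents g})) n =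
     (\<Sum>g\<in>len_sphere n. 1) - (\<Sum>s\<in>S. \<Sum>g\<in>len_sphere n. of_bool (s \<in> descents g)) + (\<Sum>e\<in>edges. \<Sum>g\<in>len_sphere n. of_bool (e \<subseteq> descents g))"
  proof -
    have a: "fps_nth (growth_series {g \<in> carrier G. P g}) n = (\<Sum>g\<in>len_sphere n. of_bool (P g))" for P
      by (subst growth_series_nth) (auto simp: len_sphere_def intro!: sum.cong)
    from a[of "\<lambda>_. True"] show ?thesis by (simp add: fps_sum_nth a)
  qed
  also have "\<dots> = (\<Sum>g\<in>len_sphere n. 1 - (\<Sum>s\<in>S. of_bool (s \<in> descents g)) + (\<Sum>e\<in>edges. of_bool (e \<subseteq> descents g)))"
    by (simp add: sum.distrib sum_subtractf sum.swap[of _ S] sum.swap[of _ edges])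
  also have "\<dots> = (\<Sum>g\<in>len_sphere n. of_bool (g = \<one>))"
    unfolding cS cE using d by (intro sum.cong alternating_descents[symmetric]) (auto simp: len_sphere_def)
  also have "\<dots> = fps_nth 1 n"
  proof (cases n)
    case 0
    then have "len_sphere n = {\<one>}" using len_eq_0 by (auto simp: len_sphere_def)
    then show ?thesis using 0 by simp
  next
    case (Suc m)
    then have "\<one> \<notin> len_sphere n" by (simp add: len_sphere_def)
    then have "(\<Sum>g\<in>len_sphere n. of_bool (g = \<one>)) = (\<Sum>g\<in>len_sphere n. 0::complex)" by (intro sum.cong) auto
    then show ?thesis using Suc by simp
  qed
  finally show "fps_nth (growth_series (carrier G) - (\<Sum>s\<in>S. growth_series {g \<in> carrier G. s \<in> descents g}) +
     (\<Sum>e\<in>edges. growth_series {g \<in> carrier G. e \<subseteq> descents g})) n = fps_nth 1 n" .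
qed

text \<open>
  The inclusion-exclusion formula with all denominators cleared.
\<close>
lemma growth_series_rational:
  assumes d: "\<And>g. g \<in> carrier G \<Longrightarrow> card (descents g) \<le> 2"
  shows "growth_series (carrier G) * ((1 + fps_X - of_nat (card S) * fps_X) * (\<Prod>e\<in>edges. \<Sum>i<label e. fps_X ^ i)
      + (\<Sum>e\<in>edges. fps_X ^ label e * (\<Prod>e'\<in>edges - {e}. \<Sum>i<label e'. fps_X ^ i)))
    = (1 + fps_X) * (\<Prod>e\<in>edges. \<Sum>i<label e. fps_X ^ i)"
proof -
  let ?f = "growth_series (carrier G)" and ?b = "\<lambda>e. growth_series {g \<in> carrier G. e \<subseteq> descents g}"
  let ?h = "\<lambda>s. growth_series {g \<in> carrier G. s \<in> descents g}"
  let ?q = "\<lambda>e. \<Sum>i<label e. fps_X ^ i :: complex fps"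
  let ?P = "\<Prod>e\<in>edges. ?q e"
  have b: "(1 + fps_X) * ?P * ?b e = fps_X ^ label e * (\<Prod>e'\<in>edges - {e}. ?q e') * ?f" if e: "e \<in> edges" for e
  proof -
    obtain s t where st: "s \<in> S" "t \<in> S" "s \<noteq> t" "e = {s, t}" "k s t = enat (label e)" using edgesE[OF e] .
    have 1: "(1 + fps_X) * ?q e * ?b e = fps_X ^ label e * ?f"
      using growth_series_pair[OF st(1-3,5)] st(4) by simp
    have "(1 + fps_X) * ?P * ?b e = (\<Prod>e'\<in>edges - {e}. ?q e') * ((1 + fps_X) * ?q e * ?b e)"
      using prod.remove[OF finite_edges e, of ?q] by (simp add: mult_ac)
    then show ?thesis unfolding 1 by (simp add: mult_ac)
  qed
  have h: "(\<Sum>s\<in>S. (1 + fps_X) * ?h s) = of_nat (card S) * (fps_X * ?f)"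
    using growth_series_single by simp
  have "(1 + fps_X) * ?P = (1 + fps_X) * ?P * (?f - (\<Sum>s\<in>S. ?h s) + (\<Sum>e\<in>edges. ?b e))"
    using growth_series_inclusion_exclusion[OF d] by simp
  also have "\<dots> = (1 + fps_X) * ?P * ?f - ?P * (\<Sum>s\<in>S. (1 + fps_X) * ?h s) + (\<Sum>e\<in>edges. (1 + fps_X) * ?P * ?b e)"
    by (simp add: sum_distrib_left algebra_simps sum.distrib)
  also have "(\<Sum>e\<in>edges. (1 + fps_X) * ?P * ?b e) =
      (\<Sum>e\<in>edges. fps_X ^ label e * (\<Prod>e'\<in>edges - {e}. ?q e')) * ?f"
    using b by (simp add: sum_distrib_right)
  finally show ?thesis unfolding h by (simp add: algebra_simps)
qed

text \<open>
  Sum \<open>1 - d + d (d - 1) / 2\<close> over the group, where \<open>d\<close> is the number of descents. Each term is nonnegative and the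
  identity contributes 1, while the sum is \<open>n / 2\<close> times \<open>\<Sum> 1 / k - 1\<close> for a group with \<open>n\<close> elements. So only the
  spherical triangle groups are finite.
\<close>
lemma finite_rank_3:
  assumes f: "finite (carrier G)" and S: "card S = 3"
  shows "1 < (\<Sum>e\<in>edges. 1 / real (label e))"
proof -
  let ?n = "real (card (carrier G))"
  have cS: "(\<Sum>s\<in>S. of_bool (s \<in> descents g)) = real (card (descents g))" for g
    using finite_S desc_S[of g] by (simp add: of_bool_def sum.If_cases Int_absorb1)
  have cE: "(\<Sum>e\<in>edges. of_bool (e \<subseteq> descents g)) = real (card {e \<in> edges. e \<subseteq> descents g})" for g
    using finite_edges by (simp add: of_bool_def sum.If_cases Int_def)
  have count: "(\<Sum>g\<in>carrier G. of_bool (P g)) = real (card {g \<in> carrier G. P g})" for P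
    using f by (simp add: of_bool_def sum.If_cases Int_def)
  have ge: "of_bool (g = \<one>) \<le> (1 :: real) - real (card (descents g)) + real (card {e \<in> edges. e \<subseteq> descents g})"
    if g: "g \<in> carrier G" for g
  proof (cases "card (descents g) \<le> 2")
    case True
    then show ?thesis using alternating_descents[OF g, where 'c = real] by simp
  next
    case False
    then have 3: "card (descents g) = 3" using card_mono[OF finite_S desc_S[of g]] S by simp
    have "card {e \<in> edges. e \<subseteq> descents g} = card (descents g) choose 2"
      using n_subsets[OF finite_descents, of g 2] pairs_desc[OF g] by simp
    then show ?thesis using 3 by (simp add: numeral_3_eq_3 binomial_eq_0 choose_two)
  qed
  have "1 \<le> (\<Sum>g\<in>carrier G. of_bool (g = \<one>) :: real)"
    using f by (simp add: of_bool_def)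
  also have "\<dots> \<le> (\<Sum>g\<in>carrier G. 1 - (\<Sum>s\<in>S. of_bool (s \<in> descents g)) + (\<Sum>e\<in>edges. of_bool (e \<subseteq> descents g)))"
    unfolding cS cE by (intro sum_mono ge)
  also have "\<dots> = ?n - (\<Sum>s\<in>S. \<Sum>g\<in>carrier G. of_bool (s \<in> descents g)) + (\<Sum>e\<in>edges. \<Sum>g\<in>carrier G. of_bool (e \<subseteq> descents g))"
    by (simp add: sum.distrib sum_subtractf sum.swap[of _ S] sum.swap[of _ edges])
  also have "(\<Sum>s\<in>S. \<Sum>g\<in>carrier G. of_bool (s \<in> descents g)) = (\<Sum>s\<in>S. ?n / 2)"
    unfolding count
  proof (rule sum.cong[OF HOL.refl])
    fix s assume "s \<in> S"
    from card_single[OF f this] show "real (card {g \<in> carrier G. s \<in> descents g}) = ?n / 2" by simp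
  qed
  also have "(\<Sum>e\<in>edges. \<Sum>g\<in>carrier G. of_bool (e \<subseteq> descents g)) = (\<Sum>e\<in>edges. ?n / 2 * (1 / real (label e)))"
    unfolding count
  proof (rule sum.cong[OF HOL.refl])
    fix e assume e: "e \<in> edges"
    obtain s t where st: "s \<in> S" "t \<in> S" "s \<noteq> t" "e = {s, t}" "k s t = enat (label e)" using edgesE[OF e] .
    have "real (2 * label e * card {g \<in> carrier G. e \<subseteq> descents g}) = ?n"
      using card_pair[OF f st(1-3,5)] st(4) by simp
    then show "real (card {g \<in> carrier G. e \<subseteq> descents g}) = ?n / 2 * (1 / real (label e))"
      using label_ge2[OF e] by (simp add: field_simps)
  qed
  also have "?n - (\<Sum>s\<in>S. ?n / 2) + (\<Sum>e\<in>edges. ?n / 2 * (1 / real (label e))) =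
      ?n / 2 * ((\<Sum>e\<in>edges. 1 / real (label e)) - 1)"
    unfolding sum_distrib_left[symmetric] by (simp add: S field_simps)
  finally have "0 < ?n / 2 * ((\<Sum>e\<in>edges. 1 / real (label e)) - 1)" by linarith
  then show ?thesis by (simp add: zero_less_mult_iff)
qed

end

section \<open>Zeros of the characteristic function\<close>

definition qsum :: "nat \<Rightarrow> 'a::comm_semiring_1 \<Rightarrow> 'a" where
  "qsum n w = (\<Sum>i<n. w ^ i)"

text \<open>
  This is \<open>(1 + w) / f(w)\<close> for the growth series \<open>f\<close> of a system with \<open>N\<close> generators whose nerve is a graph
  with edges \<open>J\<close> and labels \<open>L\<close>. The index set is arbitrary, since the positions of the edges do not matter.
\<close>
definition charfun :: "nat \<Rightarrow> 'j set \<Rightarrow> ('j \<Rightarrow> nat) \<Rightarrow> 'a::field \<Rightarrow> 'a" where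
  "charfun N J L w = 1 + w - of_nat N * w + (\<Sum>j\<in>J. w ^ L j / qsum (L j) w)"

lemma qsum_geometric: "(1 - w) * qsum n (w :: 'a::comm_ring_1) = 1 - w ^ n"
  unfolding qsum_def by (simp add: one_diff_power_eq)

text \<open>
  The Cayley transform maps the unit disk to the right half plane and the unit circle to the imaginary
  axis.
\<close>
definition cayley :: "'a::field \<Rightarrow> 'a" where
  "cayley w = (1 + w) / (1 - w)"

text \<open>
  Both \<open>w / (1 - w)\<close> and \<open>w\<^sup>k / (1 - w\<^sup>k)\<close> are of the form \<open>(cayley - 1) / 2\<close>; the constants add up to the Euler
  characteristic.
\<close>
lemma charfun_cayley:
  fixes w :: complex
  assumes J: "finite J" and w: "w \<noteq> 1" "\<And>j. j \<in> J \<Longrightarrow> w ^ L j \<noteq> 1"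
  shows "2 * charfun N J L w / (1 - w) =
    (of_nat N - of_nat (card J)) - (of_nat N - 2) * cayley w + (\<Sum>j\<in>J. cayley (w ^ L j))"
proof -
  have summand: "2 * (w ^ L j / qsum (L j) w) / (1 - w) = cayley (w ^ L j) - 1" if "j \<in> J" for j
  proof -
    have "2 * (w ^ L j / qsum (L j) w) / (1 - w) = 2 * w ^ L j / ((1 - w) * qsum (L j) w)" by simp
    also have "\<dots> = cayley (w ^ L j) - 1"
      unfolding qsum_geometric cayley_def using w(2)[OF that] by (simp add: field_simps)
    finally show ?thesis .
  qed
  have "2 * charfun N J L w / (1 - w) = 2 * (1 + w - of_nat N * w) / (1 - w)
      + (\<Sum>j\<in>J. 2 * (w ^ L j / qsum (L j) w) / (1 - w))"
    by (simp add: charfun_def add_divide_distrib diff_divide_distrib sum_distrib_left sum_divide_distrib distrib_left)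
  also have "(\<Sum>j\<in>J. 2 * (w ^ L j / qsum (L j) w) / (1 - w)) = (\<Sum>j\<in>J. cayley (w ^ L j)) - of_nat (card J)"
    using summand by (simp add: sum_subtractf)
  also have "2 * (1 + w - of_nat N * w) / (1 - w) = of_nat N - (of_nat N - 2) * cayley w"
    using w(1) by (simp add: cayley_def field_simps)
  finally show ?thesis by simp
qed

lemma cayley_kernel:
  fixes a b :: complex
  assumes "a \<noteq> 1" "b \<noteq> 1"
  shows "cayley a + cnj (cayley b) = 2 * (1 - a * cnj b) / ((1 - a) * (1 - cnj b))"
proof -
  have "cnj b \<noteq> 1" using assms(2) by (metis complex_cnj_cnj complex_cnj_one)
  then show ?thesis using assms(1) by (simp add: cayley_def field_simps)
qed

lemma norm_less_1_power_neq_1: "norm (w::complex) < 1 \<Longrightarrow> n > 0 \<Longrightarrow> w ^ n \<noteq> 1"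
  by (metis norm_one norm_power order_less_irrefl power_less_one_iff norm_ge_zero)

text \<open>
  The equation \<open>F = 0\<close>, written with Cayley transforms at \<open>w\<close> and conjugated at \<open>v\<close>, added up and divided by
  the kernel of the Cayley transform itself. Since \<open>1 - (w cnj v)\<^sup>k\<close> is divisible by \<open>1 - w cnj v\<close>, every edge
  contributes a positive definite kernel with an explicit factorisation; the term with \<open>N - 2\<close> has become constant.
\<close>
lemma charfun_kernel:
  fixes v w :: complex
  assumes J: "finite J" "\<And>j. j \<in> J \<Longrightarrow> 2 \<le> L j" and norms: "norm v < 1" "norm w < 1"
    and zeros: "charfun N J L v = 0" "charfun N J L w = 0"
  shows "(of_nat N - of_nat (card J)) * ((1 - w) * cnj (1 - v) / (1 - w * cnj v)) +
    (\<Sum>j\<in>J. \<Sum>i<L j. (w ^ i / qsum (L j) w) * cnj (v ^ i / qsum (L j) v)) = of_nat N - 2"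
proof -
  let ?\<chi> = "of_nat N - of_nat (card J) :: complex"
  have ne: "v \<noteq> 1" "w \<noteq> 1" "cnj v \<noteq> 1" using norms by (auto simp: complex_cnj_one_iff)
  have pw: "v ^ L j \<noteq> 1" "w ^ L j \<noteq> 1" if "j \<in> J" for j
    using norm_less_1_power_neq_1[of _ "L j"] norms J(2)[OF that] by auto
  have "norm (w * cnj v) < 1" using norms using mult_left_le[of "norm v" "norm w"] by (simp add: norm_mult)
  then have wv: "1 - w * cnj v \<noteq> 0" by auto
  have v0: "0 = ?\<chi> - (of_nat N - 2) * cayley v + (\<Sum>j\<in>J. cayley (v ^ L j))"
    using charfun_cayley[OF J(1) ne(1), where L = L and N = N] pw zeros by simp
  have w0: "0 = ?\<chi> - (of_nat N - 2) * cayley w + (\<Sum>j\<in>J. cayley (w ^ L j))"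
    using charfun_cayley[OF J(1) ne(2), where L = L and N = N] pw zeros by simp
  from v0 have "cnj 0 = cnj (?\<chi> - (of_nat N - 2) * cayley v + (\<Sum>j\<in>J. cayley (v ^ L j)))" by (simp only:)
  then have v0': "0 = ?\<chi> - (of_nat N - 2) * cnj (cayley v) + (\<Sum>j\<in>J. cnj (cayley (v ^ L j)))"
    by (simp add: cnj_sum)
  let ?K = "(1 - w) * (1 - cnj v) / (1 - w * cnj v)"
  have K0: "?K \<noteq> 0" using ne wv by simp
  have solve: "a + c = b" if "0 = a - b + c" for a b c :: complex using that by algebra
  have rescale: "x / 2 * (2 * a - b * (2 / x) + 2 / x * c) = a * x - b + c" if "x \<noteq> 0" for a b c x :: complex
    using that by (simp add: field_simps)
  have cancel: "2 / x * (x * y) = 2 * y" if "x \<noteq> 0" for x y :: complex using that by simp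
  have "0 = (?\<chi> - (of_nat N - 2) * cayley w + (\<Sum>j\<in>J. cayley (w ^ L j))) +
      (?\<chi> - (of_nat N - 2) * cnj (cayley v) + (\<Sum>j\<in>J. cnj (cayley (v ^ L j))))"
    unfolding v0'[symmetric] w0[symmetric] by simp
  also have "\<dots> = 2 * ?\<chi> - (of_nat N - 2) * (cayley w + cnj (cayley v))
      + (\<Sum>j\<in>J. cayley (w ^ L j) + cnj (cayley (v ^ L j)))"
    by (simp add: sum.distrib algebra_simps del: complex_cnj_power)
  also have "cayley w + cnj (cayley v) = 2 / ?K"
    using cayley_kernel[OF ne(2,1)] wv by simp
  also have "(\<Sum>j\<in>J. cayley (w ^ L j) + cnj (cayley (v ^ L j))) =
      (\<Sum>j\<in>J. 2 / ?K * (\<Sum>i<L j. (w ^ i / qsum (L j) w) * cnj (v ^ i / qsum (L j) v)))"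
  proof (rule sum.cong[OF HOL.refl])
    fix j assume j: "j \<in> J"
    have q: "qsum (L j) w = (1 - w ^ L j) / (1 - w)" "qsum (L j) v = (1 - v ^ L j) / (1 - v)"
      using qsum_geometric[of w "L j"] qsum_geometric[of v "L j"] ne by (simp_all add: field_simps)
    have "(\<Sum>i<L j. (w ^ i / qsum (L j) w) * cnj (v ^ i / qsum (L j) v)) =
        (\<Sum>i<L j. (w * cnj v) ^ i) / (qsum (L j) w * cnj (qsum (L j) v))"
      by (simp add: sum_divide_distrib power_mult_distrib)
    also have "(\<Sum>i<L j. (w * cnj v) ^ i) = (1 - (w * cnj v) ^ L j) / (1 - w * cnj v)"
      using wv sum_gp_strict[of "w * cnj v" "L j"] by auto
    also have "\<dots> / (qsum (L j) w * cnj (qsum (L j) v)) =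
        ?K * ((1 - w ^ L j * cnj (v ^ L j)) / ((1 - w ^ L j) * (1 - cnj (v ^ L j))))"
      unfolding q by (simp add: power_mult_distrib)
    finally have "2 / ?K * (\<Sum>i<L j. (w ^ i / qsum (L j) w) * cnj (v ^ i / qsum (L j) v)) =
        2 / ?K * (?K * ((1 - w ^ L j * cnj (v ^ L j)) / ((1 - w ^ L j) * (1 - cnj (v ^ L j)))))"
      by (simp only:)
    also have "\<dots> = 2 * ((1 - w ^ L j * cnj (v ^ L j)) / ((1 - w ^ L j) * (1 - cnj (v ^ L j))))"
      by (rule cancel[OF K0])
    also have "\<dots> = cayley (w ^ L j) + cnj (cayley (v ^ L j))"
      using cayley_kernel[OF pw(2,1)[OF j]] by simp
    finally show "cayley (w ^ L j) + cnj (cayley (v ^ L j)) =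
      2 / ?K * (\<Sum>i<L j. (w ^ i / qsum (L j) w) * cnj (v ^ i / qsum (L j) v))" by (simp only:)
  qed
  also have "\<dots> = 2 / ?K * (\<Sum>j\<in>J. \<Sum>i<L j. (w ^ i / qsum (L j) w) * cnj (v ^ i / qsum (L j) v))"
    by (rule sum_distrib_left[symmetric])
  finally have *: "0 = 2 * ?\<chi> - (of_nat N - 2) * (2 / ?K) +
     2 / ?K * (\<Sum>j\<in>J. \<Sum>i<L j. (w ^ i / qsum (L j) w) * cnj (v ^ i / qsum (L j) v))" .
  have "0 = ?K / 2 * (2 * ?\<chi> - (of_nat N - 2) * (2 / ?K) +
     2 / ?K * (\<Sum>j\<in>J. \<Sum>i<L j. (w ^ i / qsum (L j) w) * cnj (v ^ i / qsum (L j) v)))"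
    by (subst *[symmetric]) simp
  also have "\<dots> = ?\<chi> * ?K - (of_nat N - 2) +
     (\<Sum>j\<in>J. \<Sum>i<L j. (w ^ i / qsum (L j) w) * cnj (v ^ i / qsum (L j) v))"
    by (rule rescale[OF K0])
  finally show ?thesis unfolding complex_cnj_diff complex_cnj_one by (rule solve)
qed

text \<open>
  The kernel \<open>1 / (1 - w cnj v)\<close> is positive definite. For two points this is the Cauchy-Schwarz
  inequality, which comes from
  \<open>(norm (1 - w * cnj v))\<^sup>2 - (1 - (norm w)\<^sup>2) * (1 - (norm v)\<^sup>2) = (norm (w - v))\<^sup>2\<close>.
\<close>
lemma szego:
  fixes v w :: complex
  assumes "norm v < 1" "norm w < 1"
  defines "A \<equiv> \<lambda>w v. (1 - w) * cnj (1 - v) / (1 - w * cnj v)"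
  shows "Re (A w w + A v v - A w v - A v w) \<ge> 0"
proof -
  define a where "a = norm (1 - w) / sqrt (1 - (norm w)\<^sup>2)"
  define b where "b = norm (1 - v) / sqrt (1 - (norm v)\<^sup>2)"
  have pos: "1 - (norm w)\<^sup>2 > 0" "1 - (norm v)\<^sup>2 > 0" using assms(1,2) by (simp_all add: power_less_one_iff abs_square_less_1)
  have diag: "Re (A x x) = (norm (1 - x) / sqrt (1 - (norm x)\<^sup>2))\<^sup>2" if "1 - (norm x)\<^sup>2 > 0" for x
  proof -
    have "A x x = complex_of_real ((norm (1 - x))\<^sup>2 / (1 - (norm x)\<^sup>2))"
      unfolding A_def by (simp only: complex_norm_square[symmetric] of_real_divide of_real_diff of_real_1 of_real_power)
    then show ?thesis using that by (simp add: power_divide)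
  qed
  have cs: "(1 - (norm w)\<^sup>2) * (1 - (norm v)\<^sup>2) \<le> (norm (1 - w * cnj v))\<^sup>2"
  proof -
    have "complex_of_real ((norm (1 - w * cnj v))\<^sup>2 - (1 - (norm w)\<^sup>2) * (1 - (norm v)\<^sup>2)) = of_real ((norm (w - v))\<^sup>2)"
      by (simp only: of_real_diff of_real_mult of_real_1 complex_norm_square)
         (simp add: algebra_simps)
    then have "(norm (1 - w * cnj v))\<^sup>2 - (1 - (norm w)\<^sup>2) * (1 - (norm v)\<^sup>2) = (norm (w - v))\<^sup>2"
      by (simp only: of_real_eq_iff)
    then show ?thesis by (metis diff_ge_0_iff_ge zero_le_power2)
  qed
  have off: "norm (A w v) \<le> a * b"
  proof -
    have "sqrt (1 - (norm w)\<^sup>2) * sqrt (1 - (norm v)\<^sup>2) \<le> norm (1 - w * cnj v)"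
      using cs by (simp add: real_le_lsqrt flip: real_sqrt_mult)
    moreover have "sqrt (1 - (norm w)\<^sup>2) * sqrt (1 - (norm v)\<^sup>2) > 0" using pos by simp
    ultimately have "norm (1 - w) * norm (1 - v) / norm (1 - w * cnj v) \<le>
        norm (1 - w) * norm (1 - v) / (sqrt (1 - (norm w)\<^sup>2) * sqrt (1 - (norm v)\<^sup>2))"
      by (intro divide_left_mono) (auto intro!: mult_pos_pos simp del: real_sqrt_gt_0_iff)
    moreover have "norm (A w v) = norm (1 - w) * norm (1 - v) / norm (1 - w * cnj v)"
      unfolding A_def norm_divide norm_mult complex_mod_cnj ..
    ultimately show ?thesis by (simp add: a_def b_def)
  qed
  have sym: "A v w = cnj (A w v)" by (simp add: A_def mult.commute)
  have "Re (A w v) \<le> a * b" using off complex_Re_le_cmod order_trans by blast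
  moreover have "a\<^sup>2 + b\<^sup>2 - 2 * (a * b) = (a - b)\<^sup>2" by (simp add: power2_diff)
  ultimately have "a\<^sup>2 + b\<^sup>2 - 2 * Re (A w v) \<ge> 0" by (smt (verit) zero_le_power2)
  then show ?thesis using diag[of w] diag[of v] pos sym by (simp add: a_def b_def)
qed

text \<open>
  In \<open>B(w, w) + B(v, v) - B(w, v) - B(v, w)\<close> the constant \<open>N - 2\<close> cancels, while the edges contribute squares.
  The squares must vanish, and the first two of one edge already force \<open>w = v\<close>. Without edges the
  equation is linear.
\<close>
lemma charfun_zero_unique:
  fixes v w :: complex
  assumes J: "finite J" "\<And>j. j \<in> J \<Longrightarrow> 2 \<le> L j" "card J \<le> N" and norms: "norm v < 1" "norm w < 1"
    and zeros: "charfun N J L v = 0" "charfun N J L w = 0"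
  shows "v = w"
proof (cases "J = {}")
  case True
  then have "1 + v = of_nat N * v" "1 + w = of_nat N * w" using zeros by (auto simp: charfun_def)
  then have "(of_nat N - 1) * v = 1" "(of_nat N - 1) * w = 1" by (auto simp: algebra_simps)
  then show ?thesis by (metis mult_cancel_left zero_neq_one mult_zero_left)
next
  case False
  then obtain j where j: "j \<in> J" by auto
  let ?A = "\<lambda>w v. (1 - w) * cnj (1 - v) / (1 - w * cnj v)"
  let ?c = "\<lambda>w j i. w ^ i / qsum (L j) w"
  let ?B = "\<lambda>w v. (of_nat N - of_nat (card J)) * ?A w v + (\<Sum>j\<in>J. \<Sum>i<L j. ?c w j i * cnj (?c v j i))"
  have "0 = ?B w w + ?B v v - ?B w v - ?B v w"
    using charfun_kernel[OF J(1,2)] norms zeros by (simp del: complex_cnj_diff complex_cnj_divide complex_cnj_power)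
  also have "\<dots> = (of_nat N - of_nat (card J)) * (?A w w + ?A v v - ?A w v - ?A v w) +
     (\<Sum>j\<in>J. \<Sum>i<L j. (?c w j i - ?c v j i) * cnj (?c w j i - ?c v j i))"
    by (simp add: algebra_simps sum.distrib sum_subtractf del: complex_cnj_divide complex_cnj_power)
  also have "(\<Sum>j\<in>J. \<Sum>i<L j. (?c w j i - ?c v j i) * cnj (?c w j i - ?c v j i)) =
      complex_of_real (\<Sum>j\<in>J. \<Sum>i<L j. (norm (?c w j i - ?c v j i))\<^sup>2)"
    by (simp only: complex_norm_square of_real_sum)
  also have "(of_nat N - of_nat (card J) :: complex) = of_real (real (N - card J))"
    using J(3) by (simp add: of_nat_diff)
  finally have "0 = Re (of_real (real (N - card J)) * (?A w w + ?A v v - ?A w v - ?A v w) +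
     complex_of_real (\<Sum>j\<in>J. \<Sum>i<L j. (norm (?c w j i - ?c v j i))\<^sup>2))" by (metis zero_complex.sel(1))
  also have "\<dots> = real (N - card J) * Re (?A w w + ?A v v - ?A w v - ?A v w) +
     (\<Sum>j\<in>J. \<Sum>i<L j. (norm (?c w j i - ?c v j i))\<^sup>2)"
    by (simp only: plus_complex.sel Re_complex_of_real scaleR_conv_of_real[symmetric] scaleR_complex.sel)
  finally have "(\<Sum>j\<in>J. \<Sum>i<L j. (norm (?c w j i - ?c v j i))\<^sup>2) \<le> 0"
    using mult_nonneg_nonneg[OF of_nat_0_le_iff szego[OF norms], of "N - card J"] by linarith
  moreover have nn: "(\<Sum>i<L j. (norm (?c w j i - ?c v j i))\<^sup>2) \<ge> 0" for j by (intro sum_nonneg) auto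
  ultimately have "(\<Sum>j\<in>J. \<Sum>i<L j. (norm (?c w j i - ?c v j i))\<^sup>2) = 0"
    by (intro order_antisym sum_nonneg zero_le_power2)
  then have "(\<Sum>i<L j. (norm (?c w j i - ?c v j i))\<^sup>2) = 0"
    using j J(1) nn by (subst (asm) sum_nonneg_eq_0_iff) auto
  then have all: "\<forall>i<L j. ?c w j i = ?c v j i"
    by (subst (asm) sum_nonneg_eq_0_iff) auto
  have "1 / qsum (L j) w = 1 / qsum (L j) v" "w / qsum (L j) w = v / qsum (L j) v"
    using all[rule_format, of 0] all[rule_format, of 1] J(2)[OF j] by auto
  moreover have "qsum (L j) w \<noteq> 0"
    using qsum_geometric[of w "L j"] norm_less_1_power_neq_1[OF norms(2), of "L j"] J(2)[OF j] by auto
  ultimately show "v = w" by (auto simp: field_simps)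
qed

lemma cayley_circle:
  assumes "norm (a::complex) = 1" "a \<noteq> 1"
  shows "Re (cayley a) = 0"
proof -
  have "cayley a + cnj (cayley a) = 0"
    using cayley_kernel[OF assms(2,2)] assms(1) by (simp flip: complex_norm_square)
  then show ?thesis by (simp add: complex_eq_iff)
qed

text \<open>
  On the unit circle the Cayley transforms are imaginary, so the real part of \<open>2 F(w) / (1 - w)\<close> is the Euler
  characteristic \<open>N - card J\<close>.
\<close>
lemma charfun_circle:
  fixes w :: complex
  assumes J: "finite J" and w: "norm w = 1" "w \<noteq> 1" "\<And>j. j \<in> J \<Longrightarrow> w ^ L j \<noteq> 1"
    and zero: "charfun N J L w = 0"
  shows "card J = N"
proof -
  have "0 = Re (of_nat N - of_nat (card J) - (of_nat N - 2) * cayley w + (\<Sum>j\<in>J. cayley (w ^ L j)))"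
    using charfun_cayley[OF J w(2), where L = L and N = N] w(3) zero by simp
  also have "\<dots> = real N - real (card J) - (real N - 2) * Re (cayley w) + (\<Sum>j\<in>J. Re (cayley (w ^ L j)))"
    by (simp add: Re_sum)
  also have "\<dots> = real N - real (card J)"
    using cayley_circle w by (simp add: norm_power)
  finally show ?thesis by simp
qed

section \<open>Pisot numbers\<close>

text \<open>
  The numerator of \<open>z F(1 / z)\<close>, whose denominator is the product of the \<open>[k](z)\<close>; see \<open>charpoly_eval\<close>.
\<close>
definition charpoly :: "nat \<Rightarrow> 'j set \<Rightarrow> ('j \<Rightarrow> nat) \<Rightarrow> int poly" where
  "charpoly N J L = [:1 - int N, 1:] * (\<Prod>j\<in>J. qsum (L j) [:0, 1:]) +
     (\<Sum>j\<in>J. \<Prod>i\<in>J - {j}. qsum (L i) [:0, 1:])"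

lemma qsum_monom: "qsum n [:0, 1:] = (\<Sum>i<n. monom 1 i :: int poly)"
  unfolding qsum_def by (simp add: monom_altdef)

lemma degree_qsum: "n > 0 \<Longrightarrow> degree (qsum n [:0, 1 :: int:]) = n - 1 \<and> lead_coeff (qsum n [:0, 1 :: int:]) = 1"
proof -
  assume n: "n > 0"
  have c: "coeff (qsum n [:0, 1 :: int:]) i = of_bool (i < n)" for i
    unfolding qsum_monom by (simp add: coeff_sum of_bool_def)
  have "degree (qsum n [:0, 1 :: int:]) = n - 1"
    by (rule antisym[OF degree_le le_degree]) (use n in \<open>auto simp: c\<close>)
  then show ?thesis using n c by simp
qed

lemma monic_charpoly:
  assumes J: "finite J" "\<And>j. j \<in> J \<Longrightarrow> 2 \<le> L j"
  shows "lead_coeff (charpoly N J L) = 1"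
proof -
  let ?Q = "\<lambda>j. qsum (L j) [:0, 1 :: int:]"
  let ?A = "[:1 - int N, 1:] * (\<Prod>j\<in>J. ?Q j)" and ?B = "\<Sum>j\<in>J. \<Prod>i\<in>J - {j}. ?Q i"
  have q: "degree (?Q j) = L j - 1" "lead_coeff (?Q j) = 1" "?Q j \<noteq> 0" if "j \<in> J" for j
    using degree_qsum[of "L j"] J(2)[OF that] by auto
  have nz: "(\<Prod>j\<in>J'. ?Q j) \<noteq> 0" if "J' \<subseteq> J" for J' using that q finite_subset[OF that J(1)] by auto
  have d: "degree (\<Prod>j\<in>J'. ?Q j) = (\<Sum>j\<in>J'. L j - 1)" if "J' \<subseteq> J" for J'
  proof -
    have "degree (\<Prod>j\<in>J'. ?Q j) = (\<Sum>j\<in>J'. degree (?Q j))"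
      by (rule degree_prod_eq_sum_degree) (use that q(3) in blast)
    also have "\<dots> = (\<Sum>j\<in>J'. L j - 1)" by (rule sum.cong) (use that q(1) in auto)
    finally show ?thesis .
  qed
  have dA: "degree ?A = Suc (\<Sum>j\<in>J. L j - 1)"
    using degree_mult_eq[of "[:1 - int N, 1:]" "\<Prod>j\<in>J. ?Q j"] nz[of J] d[of J] by simp
  have lA: "lead_coeff ?A = 1"
    using q(2) by (simp only: lead_coeff_mult lead_coeff_prod) simp
  have "degree ?B \<le> (\<Sum>j\<in>J. L j - 1)"
  proof (rule degree_sum_le[OF J(1)])
    fix j assume "j \<in> J"
    then show "degree (\<Prod>i\<in>J - {j}. ?Q i) \<le> (\<Sum>j\<in>J. L j - 1)"
      using d[of "J - {j}"] J(1) by (auto intro!: sum_mono2)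
  qed
  then have "degree ?B < degree ?A" using dA by simp
  then show ?thesis unfolding charpoly_def using lA by (metis lead_coeff_add_le add.commute)
qed

text \<open>
  Evaluation of a polynomial after mapping its coefficients into another ring. It is needed for three
  coefficient maps, from the integers to the reals and to the complex numbers and from the rationals
  to the complex numbers.
\<close>
locale ring_hom_eval =
  fixes h :: "'c::comm_ring_1 \<Rightarrow> 'd::comm_ring_1"
  assumes h0: "h 0 = 0" and h1: "h 1 = 1" and hadd: "h (a + b) = h a + h b" and hmult: "h (a * b) = h a * h b"
begin

definition hom_eval :: "'c poly \<Rightarrow> 'd \<Rightarrow> 'd" where "hom_eval p z = poly (map_poly h p) z"

lemma hom_eval_0 [simp]: "hom_eval 0 z = 0" by (simp add: hom_eval_def)

lemma hom_eval_pCons [simp]: "hom_eval (pCons a p) z = h a + z * hom_eval p z"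
  by (simp add: hom_eval_def map_poly_pCons h0)

lemma hom_eval_1 [simp]: "hom_eval 1 z = 1" by (simp add: one_pCons h1)

lemma hom_eval_add [simp]: "hom_eval (p + q) z = hom_eval p z + hom_eval q z"
  by (induction p q rule: poly_induct2) (simp_all add: hadd algebra_simps)

lemma hom_eval_smult [simp]: "hom_eval (smult a p) z = h a * hom_eval p z"
  by (induction p) (simp_all add: hmult algebra_simps)

lemma hom_eval_mult [simp]: "hom_eval (p * q) z = hom_eval p z * hom_eval q z"
  by (induction p) (simp_all add: algebra_simps h0)

lemma hom_eval_power [simp]: "hom_eval (p ^ n) z = hom_eval p z ^ n"
  by (induction n) simp_all

lemma hom_eval_sum [simp]: "hom_eval (sum f A) z = (\<Sum>x\<in>A. hom_eval (f x) z)"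
  by (induction A rule: infinite_finite_induct) simp_all

lemma hom_eval_prod [simp]: "hom_eval (prod f A) z = (\<Prod>x\<in>A. hom_eval (f x) z)"
  by (induction A rule: infinite_finite_induct) simp_all

lemma hom_eval_qsum [simp]: "hom_eval (qsum n [:0, 1:]) z = qsum n z"
  by (simp add: qsum_def h0 h1)

end

interpretation int_real: ring_hom_eval "of_int :: int \<Rightarrow> real" by unfold_locales auto
interpretation int_complex: ring_hom_eval "of_int :: int \<Rightarrow> complex" by unfold_locales auto
interpretation rat_complex: ring_hom_eval "of_rat :: rat \<Rightarrow> complex"
  by unfold_locales (auto simp: of_rat_add of_rat_mult)

lemma charpoly_eval:
  fixes z :: "'d::field"
  assumes J: "finite J" and nz: "z \<noteq> 0" "\<And>j. j \<in> J \<Longrightarrow> 2 \<le> L j" "\<And>j. j \<in> J \<Longrightarrow> qsum (L j) z \<noteq> 0"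
  shows "(1 - of_nat N + z) * (\<Prod>j\<in>J. qsum (L j) z) + (\<Sum>j\<in>J. \<Prod>i\<in>J - {j}. qsum (L i) z) =
    z * charfun N J L (1 / z) * (\<Prod>j\<in>J. qsum (L j) z)"
proof -
  have q: "z * ((1 / z) ^ L j / qsum (L j) (1 / z)) = 1 / qsum (L j) z" if j: "j \<in> J" for j
  proof -
    obtain m where m: "L j = Suc m" using nz(2)[OF j] by (cases "L j") auto
    have "z ^ m * qsum (L j) (1 / z) = (\<Sum>i<Suc m. z ^ (m - i))"
      unfolding qsum_def m sum_distrib_left using nz(1)
      by (intro sum.cong) (auto simp: power_diff power_one_over field_simps)
    also have "\<dots> = qsum (L j) z" unfolding qsum_def m using sum.nat_diff_reindex[of "\<lambda>i. z ^ i" "Suc m"] by simp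
    finally have e: "qsum (L j) (1 / z) = qsum (L j) z / z ^ m" using nz(1) by (simp add: field_simps)
    show ?thesis unfolding e using nz(1) by (simp add: m power_one_over)
  qed
  have "z * charfun N J L (1 / z) = 1 - of_nat N + z + (\<Sum>j\<in>J. 1 / qsum (L j) z)"
    using nz(1) q by (simp add: charfun_def distrib_left sum_distrib_left right_diff_distrib)
  moreover have "(\<Sum>j\<in>J. 1 / qsum (L j) z) * (\<Prod>j\<in>J. qsum (L j) z) = (\<Sum>j\<in>J. \<Prod>i\<in>J - {j}. qsum (L i) z)"
    unfolding sum_distrib_right
    by (rule sum.cong) (use nz(3) prod.remove[OF J, of _ "\<lambda>j. qsum (L j) z"] in auto)
  ultimately show ?thesis by (simp add: distrib_right)
qed

text \<open>
  The polynomial \<open>m\<close> of least degree vanishing at \<open>x\<close> divides every polynomial that vanishes at \<open>x\<close>; it is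
  associated with the irreducible \<open>p\<close>, so \<open>p\<close> divides \<open>q\<close>.
\<close>
lemma conjugate_root:
  fixes x z :: complex and p q :: "rat poly"
  assumes p: "irreducible p" "rat_complex.hom_eval p x = 0" "rat_complex.hom_eval p z = 0" and q: "rat_complex.hom_eval q x = 0"
  shows "rat_complex.hom_eval q z = 0"
proof -
  have p0: "p \<noteq> 0" using p(1) by auto
  obtain m where m: "m \<noteq> 0" "rat_complex.hom_eval m x = 0" and
    min: "\<And>r. r \<noteq> 0 \<Longrightarrow> rat_complex.hom_eval r x = 0 \<Longrightarrow> degree m \<le> degree r"
    using ex_has_least_nat[of "\<lambda>r. r \<noteq> 0 \<and> rat_complex.hom_eval r x = 0" p degree] p p0 by auto
  have dvd: "m dvd r" if r: "rat_complex.hom_eval r x = 0" for r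
  proof -
    have "r = r div m * m + r mod m" by simp
    then have "rat_complex.hom_eval r x = rat_complex.hom_eval (r div m) x * rat_complex.hom_eval m x + rat_complex.hom_eval (r mod m) x"
      by (metis rat_complex.hom_eval_add rat_complex.hom_eval_mult)
    then have "rat_complex.hom_eval (r mod m) x = 0" using r m by simp
    then have "r mod m = 0" using min[of "r mod m"] degree_mod_less[OF m(1), of r] by force
    then show "m dvd r" by auto
  qed
  obtain c where c: "p = m * c" using dvd[OF p(2)] by (elim dvdE)
  have "\<not> is_unit m"
  proof
    assume "is_unit m"
    then obtain a where "m = [:a:]" by (auto simp: is_unit_poly_iff)
    then show False using m by simp
  qed
  then have "is_unit c" using p(1) c by (auto dest: irreducibleD)
  then have "p dvd m" unfolding c by auto
  then have "p dvd q" using dvd[OF q] by (rule dvd_trans)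
  then show ?thesis using p(3) by (auto elim!: dvdE)
qed

text \<open>
  A conjugate \<open>z\<close> of \<open>1 / R\<close> is not a root of unity, as \<open>1 / R\<close> is none, so no denominator vanishes there and
  \<open>F(1 / z) = 0\<close>. If \<open>norm z > 1\<close>, uniqueness of the zero in the disk gives \<open>z = 1 / R\<close>; if \<open>norm z = 1\<close>, the Euler characteristic
  would be 0.
\<close>
lemma pisot_charfun:
  fixes R :: real
  assumes J: "finite J" "\<And>j. j \<in> J \<Longrightarrow> 2 \<le> L j" "card J < N" and R: "0 < R" "R < 1"
    and zero: "charfun N J L (complex_of_real R) = 0"
  shows "pisot_number (1 / R)"
proof -
  let ?p = "charpoly N J L" and ?t = "complex_of_real (1 / R)"
  have ev: "int_complex.hom_eval ?p z = (1 - of_nat N + z) * (\<Prod>j\<in>J. qsum (L j) z) + (\<Sum>j\<in>J. \<Prod>i\<in>J - {j}. qsum (L i) z)" for z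
    unfolding charpoly_def by (simp add: distrib_right)
  have nzq: "qsum (L j) z \<noteq> 0" if "j \<in> J" "z ^ L j \<noteq> 1" for j and z :: complex
    using qsum_geometric[of z "L j"] that by auto
  have t1: "?t ^ n \<noteq> 1" if "n > 0" for n
  proof -
    have "(1 / R) ^ n > 1" using R that by (intro one_less_power) auto
    then show ?thesis by (metis of_real_1 of_real_eq_iff of_real_power order_less_irrefl)
  qed
  have ev0: "int_complex.hom_eval ?p z = 0 \<longleftrightarrow> charfun N J L (1 / z) = 0"
    if "z \<noteq> 0" "\<And>n. n > 0 \<Longrightarrow> z ^ n \<noteq> 1" for z
  proof -
    have *: "qsum (L j) z \<noteq> 0" if j: "j \<in> J" for j using nzq[OF j] \<open>\<And>n. n > 0 \<Longrightarrow> z ^ n \<noteq> 1\<close>[of "L j"] J(2)[OF j] by simp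
    then show ?thesis unfolding ev using charpoly_eval[OF J(1) that(1) J(2) *, where N = N] J(1) that(1) by simp
  qed
  have root: "int_complex.hom_eval ?p ?t = 0" using ev0[of ?t] t1 R zero by simp
  have re: "complex_of_real (int_real.hom_eval q x) = int_complex.hom_eval q (complex_of_real x)" for q x
    by (induction q) (simp_all)
  have "int_real.hom_eval ?p (1 / R) = 0" using re[of ?p "1 / R"] root by simp
  then have "algebraic_int (1 / R)"
    using monic_charpoly[of J L, OF J(1,2)] by (auto simp: algebraic_int_altdef_ipoly int_real.hom_eval_def)
  moreover have "1 / R > 1" using R by simp
  moreover have "norm z < 1" if z: "galois_conjugate ?t z" "z \<noteq> ?t" for z
  proof (rule ccontr)
    assume n: "\<not> norm z < 1"
    obtain q where q: "irreducible q" "rat_complex.hom_eval q ?t = 0" "rat_complex.hom_eval q z = 0"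
      using z(1) by (auto simp: galois_conjugate_def rat_complex.hom_eval_def)
    have rat: "rat_complex.hom_eval (map_poly of_int r) y = int_complex.hom_eval r y" for r y
      unfolding rat_complex.hom_eval_def int_complex.hom_eval_def by (simp add: map_poly_map_poly comp_def)
    have rz: "int_complex.hom_eval ?p z = 0"
      using conjugate_root[OF q, of "map_poly of_int ?p"] root by (simp add: rat)
    have "z ^ i \<noteq> 1" if "i > 0" for i
    proof
      assume "z ^ i = 1"
      then have "rat_complex.hom_eval ([:0, 1:] ^ i + [:-1:]) z = 0" by simp
      then have "rat_complex.hom_eval ([:0, 1:] ^ i + [:-1:]) ?t = 0" using conjugate_root[OF q(1,3,2)] by blast
      then show False using t1[OF that] by simp
    qed
    note zp = this
    have z0: "z \<noteq> 0" using n by auto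
    have cz: "charfun N J L (1 / z) = 0" using ev0[OF z0 zp] rz by blast
    show False
    proof (cases "norm z = 1")
      case True
      have p: "(1 / z) ^ i \<noteq> 1" if "i > 0" for i using zp[OF that] by (simp add: power_one_over)
      have "card J = N"
      proof (rule charfun_circle[OF J(1) _ _ _ cz])
        show "norm (1 / z) = 1" using True by (simp add: norm_divide)
        show "1 / z \<noteq> 1" using p[of 1] by simp
        show "(1 / z) ^ L j \<noteq> 1" if "j \<in> J" for j using J(2)[OF that] by (intro p) simp
      qed
      then show False using J(3) by simp
    next
      case False
      then have "1 < norm z" using n by simp
      then have "inverse (norm z) < 1" by (simp add: inverse_less_1_iff)
      then have n1: "norm (1 / z) < 1" by (simp add: norm_divide inverse_eq_divide)
      have "1 / z = complex_of_real R"
        by (rule charfun_zero_unique[OF J(1,2) _ n1 _ cz zero]) (use J(3) R in auto)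
      then show False using z(2) by (metis of_real_1 of_real_divide divide_divide_eq_right mult_1 div_by_1 divide_self_if)
    qed
  qed
  ultimately show ?thesis by (auto simp: pisot_number_def)
qed

section \<open>The radius of convergence\<close>

text \<open>
  The series is the quotient of two polynomials \<open>B / A\<close>. In the unit disk the only zero of \<open>A\<close> is \<open>R\<close>, which
  bounds the radius of convergence from below; it is a true pole, because \<open>B\<close> does not vanish there.
\<close>
lemma growth_from_series:
  fixes a :: "nat \<Rightarrow> nat" and R :: real
  assumes J: "finite J" "\<And>j. j \<in> J \<Longrightarrow> 2 \<le> L j" "card J \<le> N" and R: "0 < R" "R < 1"
    and zero: "charfun N J L (complex_of_real R) = 0"
    and series: "Abs_fps (\<lambda>n. of_nat (a n)) * ((1 + fps_X - of_nat N * fps_X) * (\<Prod>j\<in>J. qsum (L j) fps_X)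
      + (\<Sum>j\<in>J. fps_X ^ L j * (\<Prod>i\<in>J - {j}. qsum (L i) fps_X))) = (1 + fps_X) * (\<Prod>j\<in>J. qsum (L j) fps_X :: complex fps)"
  shows "limsup (\<lambda>n. ereal (root n (real (a n)))) = ereal (1 / R)"
proof -
  define f :: "complex fps" where "f = Abs_fps (\<lambda>n. of_nat (a n))"
  define A :: "complex poly" where "A = [:1, 1 - of_nat N:] * (\<Prod>j\<in>J. qsum (L j) [:0, 1:])
    + (\<Sum>j\<in>J. [:0, 1:] ^ L j * (\<Prod>i\<in>J - {j}. qsum (L i) [:0, 1:]))"
  define B :: "complex poly" where "B = [:1, 1:] * (\<Prod>j\<in>J. qsum (L j) [:0, 1:])"
  have q: "fps_of_poly (qsum n [:0, 1 :: complex:]) = qsum n fps_X" for n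
    by (simp add: qsum_def fps_of_poly_sum fps_of_poly_power)
  have lin: "fps_of_poly [:1, 1 :: complex:] = 1 + fps_X" by (simp add: fps_of_poly_linear')
  have lin1: "fps_of_poly [:1, 1 - of_nat N:] = 1 + fps_X - of_nat N * (fps_X :: complex fps)"
  proof -
    have "fps_const (1 - of_nat N :: complex) = 1 - of_nat N" by (metis fps_const_1_eq_1 fps_const_sub fps_of_nat)
    then show ?thesis unfolding fps_of_poly_linear' by (simp only:) (simp add: algebra_simps)
  qed
  have eq: "f * fps_of_poly A = fps_of_poly B"
    using series unfolding A_def B_def f_def
    by (simp add: fps_of_poly_add fps_of_poly_mult fps_of_poly_prod fps_of_poly_sum fps_of_poly_power q lin lin1
        del: mult_pCons_left)
  have pq: "poly (qsum n [:0, 1:]) z = qsum n z" for n and z :: complex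
    by (simp add: qsum_def poly_sum)
  have evB: "poly B z = (1 + z) * (\<Prod>j\<in>J. qsum (L j) z)" for z
    by (simp add: B_def poly_prod pq del: mult_pCons_left)
  have nzq: "qsum (L j) z \<noteq> 0" if "j \<in> J" "norm z < 1" for j and z :: complex
    using qsum_geometric[of z "L j"] norm_less_1_power_neq_1[OF that(2), of "L j"] J(2)[OF that(1)] by auto
  have evA: "poly A z = charfun N J L z * (\<Prod>j\<in>J. qsum (L j) z)" if z: "norm z < 1" for z
  proof -
    have "(\<Sum>j\<in>J. z ^ L j / qsum (L j) z) * (\<Prod>j\<in>J. qsum (L j) z) = (\<Sum>j\<in>J. z ^ L j * (\<Prod>i\<in>J - {j}. qsum (L i) z))"
      unfolding sum_distrib_right
      by (rule sum.cong) (use nzq[OF _ z] prod.remove[OF J(1), of _ "\<lambda>j. qsum (L j) z"] in auto)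
    then show ?thesis
      by (simp add: A_def charfun_def poly_sum poly_prod pq algebra_simps del: mult_pCons_left)
  qed
  have nzP: "(\<Prod>j\<in>J. qsum (L j) z) \<noteq> 0" if "norm z < 1" for z :: complex
    using nzq that J(1) by simp
  have nzA: "poly A z \<noteq> 0" if "norm z < R" for z
  proof
    assume "poly A z = 0"
    then have z0: "charfun N J L z = 0" using evA[of z] nzP[of z] that R by simp
    have "z = complex_of_real R"
      by (rule charfun_zero_unique[OF J _ _ z0 zero]) (use R that in auto)
    then show False using that R by simp
  qed
  have A0: "fps_nth (fps_of_poly A) 0 \<noteq> 0"
    using nzA[of 0] R by (simp add: poly_0_coeff_0)
  have feq: "f = fps_of_poly B / fps_of_poly A"
  proof -
    have "fps_of_poly A \<noteq> 0" using A0 by (metis fps_zero_nth)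
    then show ?thesis unfolding eq[symmetric] by simp
  qed
  have "ereal R \<le> fps_conv_radius f"
  proof -
    have "Min {ereal R, fps_conv_radius (fps_of_poly B), fps_conv_radius (fps_of_poly A)} \<le> fps_conv_radius f"
      unfolding feq
    proof (rule fps_conv_radius_divide')
      fix z :: complex assume "z \<in> eball 0 (ereal R)"
      then show "eval_fps (fps_of_poly A) z \<noteq> 0" using nzA[of z] by (simp add: eval_fps_of_poly in_eball_iff)
    qed (use R in \<open>simp_all\<close>)
    then show ?thesis by simp
  qed
  moreover have "fps_conv_radius f \<le> ereal R"
  proof (rule ccontr)
    assume "\<not> fps_conv_radius f \<le> ereal R"
    then have r: "ereal (norm (complex_of_real R)) < fps_conv_radius f" using R by simp
    have "eval_fps f R * poly A R = poly B R"
      using eval_fps_mult[OF r, of "fps_of_poly A"] eq by (simp add: eval_fps_of_poly)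
    moreover have "poly A R = 0" using evA[of R] zero R by simp
    ultimately have "poly B R = 0" by simp
    then have "1 + complex_of_real R = 0" using evB[of R] nzP[of R] R by simp
    then have "complex_of_real (1 + R) = 0" by simp
    then show False using R by (simp only: of_real_eq_0_iff)
  qed
  ultimately have "fps_conv_radius f = ereal R" by (rule antisym[rotated])
  then have "inverse (limsup (\<lambda>n. ereal (root n (real (a n))))) = ereal R"
    by (simp add: fps_conv_radius_def conv_radius_def f_def)
  then show ?thesis using R
    by (cases "limsup (\<lambda>n. ereal (root n (real (a n))))") (auto simp: field_simps split: if_splits)
qed

section \<open>Nerves and growth rates in dimension at most 2\<close>

context coxeter
begin

lemma finite_generate_single: "s \<in> S \<Longrightarrow> finite (generate G {s})"
proof -
  assume s: "s \<in> S"
  have "odd (len s)" using parity[of "[s]"] s by simp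
  then have "s \<in> descents s" using s by (simp add: descents_def odd_pos)
  then show ?thesis using s by (intro desc_finite[of s]) auto
qed

lemma finite_generate_pair_iff:
  assumes "s \<in> S" "t \<in> S" "s \<noteq> t"
  shows "finite (generate G {s, t}) \<longleftrightarrow> k s t \<noteq> \<infinity>"
proof
  assume "k s t \<noteq> \<infinity>"
  then obtain n where "k s t = enat n" by auto
  then interpret coxeter_pair G S k s t n using assms by unfold_locales auto
  show "finite (generate G {s, t})" by (rule finite_W)
qed (use generate_pair_infinite[OF assms] in blast)

lemma finite_nerve: "finite (nerve G S)"
proof (rule finite_subset)
  show "nerve G S \<subseteq> Pow S" unfolding nerve_def by blast
qed (simp add: finite_S)

lemma dim_le_iff: "coxeter_dim G S \<le> d \<longleftrightarrow> (\<forall>T\<in>nerve G S. card T \<le> d)"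
proof -
  have "finite (card ` insert {} (nerve G S))" "card ` insert {} (nerve G S) \<noteq> {}"
    using finite_nerve by simp_all
  from Max_le_iff[OF this, of d] show ?thesis unfolding coxeter_dim_def by simp
qed

lemma card_desc_le:
  assumes d: "coxeter_dim G S \<le> d" and g: "g \<in> carrier G"
  shows "card (descents g) \<le> d"
proof (cases "descents g = {}")
  case False
  have "finite (generate G (descents g))" using g by (rule desc_finite) (rule subset_refl)
  then have "descents g \<in> nerve G S" using False desc_S by (simp add: nerve_def)
  then show ?thesis using d unfolding dim_le_iff by blast
qed simp

lemma nerve_dim_2:
  assumes "coxeter_dim G S \<le> 2"
  shows "nerve G S = (\<lambda>s. {s}) ` S \<union> edges"
proof (intro equalityI subsetI)
  fix T assume T: "T \<in> nerve G S"
  then have "T \<subseteq> S" "T \<noteq> {}" "finite (generate G T)" unfolding nerve_def by blast+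
  then have "card T \<noteq> 0" using finite_subset[OF _ finite_S] by (simp add: card_eq_0_iff)
  moreover have "card T \<le> 2" using assms T unfolding dim_le_iff by blast
  ultimately have "card T = 1 \<or> card T = 2" by linarith
  then show "T \<in> (\<lambda>s. {s}) ` S \<union> edges"
  proof
    assume "card T = 1"
    then obtain s where "T = {s}" by (rule card_1_singletonE)
    then show ?thesis using \<open>T \<subseteq> S\<close> by auto
  next
    assume "card T = 2"
    then obtain s t where st: "T = {s, t}" "s \<noteq> t" by (auto simp: card_2_iff)
    then have "s \<in> S" "t \<in> S" using \<open>T \<subseteq> S\<close> by auto
    then show ?thesis using finite_generate_pair_iff[of s t] \<open>finite (generate G T)\<close> st by (auto simp: edges_def)
  qed
next
  fix T assume "T \<in> (\<lambda>s. {s}) ` S \<union> edges"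
  then show "T \<in> nerve G S"
  proof
    assume "T \<in> (\<lambda>s. {s}) ` S"
    then show ?thesis using finite_generate_single by (auto simp: nerve_def)
  next
    assume "T \<in> edges"
    then obtain s t where st: "s \<in> S" "t \<in> S" "s \<noteq> t" "T = {s, t}" "k s t = enat (label T)" using edgesE by blast
    then have "finite (generate G T)" using finite_generate_pair_iff[OF st(1-3)] by simp
    then show ?thesis using st by (simp add: nerve_def)
  qed
qed

lemma card_edge: "e \<in> edges \<Longrightarrow> card e = 2" by (auto simp: edges_def)

lemma euler_dim_2:
  assumes "coxeter_dim G S \<le> 2"
  shows "euler_characteristic (nerve G S) = int (card S) - int (card edges)"
proof -
  have "euler_characteristic (nerve G S) = (\<Sum>T\<in>(\<lambda>s. {s}) ` S. (-1) ^ (card T - 1)) + (\<Sum>T\<in>edges. (-1) ^ (card T - 1))"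
    unfolding euler_characteristic_def nerve_dim_2[OF assms]
  proof (rule sum.union_disjoint)
    show "(\<lambda>s. {s}) ` S \<inter> edges = {}" using card_edge by fastforce
  qed (use finite_S finite_edges in auto)
  also have "(\<Sum>T\<in>(\<lambda>s. {s}) ` S. (-1) ^ (card T - 1)) = int (card S)"
    by (subst sum.reindex) auto
  also have "(\<Sum>T\<in>edges. (-1) ^ (card T - 1)) = (\<Sum>T\<in>edges. - 1 :: int)"
    using card_edge by (intro sum.cong) auto
  finally show ?thesis by simp
qed

lemma growth_rate_eq:
  assumes "coxeter_dim G S \<le> 2" "card edges \<le> card S" "0 < R" "R < 1"
    and "charfun (card S) edges label (complex_of_real R) = 0"
  shows "growth_rate G S = 1 / R"
proof -
  have "growth_series (carrier G) = Abs_fps (\<lambda>n. of_nat (sphere_size G S n))"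
    by (simp add: growth_series_def sphere_size_def)
  then have "limsup (\<lambda>n. ereal (root n (real (sphere_size G S n)))) = ereal (1 / R)"
    using growth_from_series[OF finite_edges label_ge2 assms(2-5), of "sphere_size G S"]
      growth_series_rational[OF card_desc_le[OF assms(1)]] unfolding qsum_def by simp
  then show ?thesis by (simp add: growth_rate_def)
qed

lemma finite_carrier_rank_3:
  assumes "card S = 3" "S \<in> nerve G S"
  shows "1 < (\<Sum>e\<in>edges. 1 / real (label e))"
proof (rule finite_rank_3[OF _ assms(1)])
  have "finite (generate G S)" using assms(2) unfolding nerve_def by blast
  then show "finite (carrier G)" using gen by simp
qed

text \<open>
  As there are fewer edges than generators and all labels are at least 2, \<open>\<Sum> 1 / k\<close> is at most \<open>(N - 1) / 2\<close>, which
  suffices for \<open>N \<ge> 4\<close>. For \<open>N \<le> 2\<close> the cosine matrix is semidefinite. For \<open>N = 3\<close> the inequality can only fail for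
  two edges labelled 2; then one generator commutes with the two others and the matrix is semidefinite
  again.
\<close>
lemma not_affine_imp:
  assumes na: "\<not> coxeter_affine S k" and E: "card edges < card S"
  shows "(\<Sum>e\<in>edges. 1 / real (label e)) < real (card S) - 2"
proof -
  let ?C = "cosine_matrix k"
  let ?q = "\<lambda>x. \<Sum>s\<in>S. \<Sum>t\<in>S. x s * ?C s t * x t"
  have C1: "?C s s = 1" if "s \<in> S" for s using cosine_matrix_self[OF matrix that] .
  have Csym: "?C s t = ?C t s" if "s \<in> S" "t \<in> S" for s t using cosine_matrix_sym[OF matrix that] .
  have Cb: "\<bar>?C s t\<bar> \<le> 1" for s t by (auto simp: cosine_matrix_def split: enat.split)
  obtain x where x: "?q x < 0" using na by (auto simp: coxeter_affine_def pos_semidefinite_on_def not_le)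
  have half: "(\<Sum>e\<in>edges. 1 / real (label e)) \<le> (\<Sum>e\<in>edges. 1 / 2)"
    using label_ge2 by (intro sum_mono) (fastforce simp: field_simps)
  consider "card S = 0" | "card S = 1" | "card S = 2" | "card S = 3" | "card S \<ge> 4" by linarith
  then show ?thesis
  proof cases
    case 1
    then show ?thesis using x finite_S by simp
  next
    case 2
    then obtain a where "S = {a}" by (rule card_1_singletonE)
    then show ?thesis using x C1[of a] by (simp add: not_less[symmetric])
  next
    case 3
    then obtain a b where ab: "S = {a, b}" "a \<noteq> b" by (auto simp: card_2_iff)
    have "?q x = (x a)\<^sup>2 + (x b)\<^sup>2 + 2 * ?C a b * (x a * x b)"
      using ab C1 Csym[of b a] by (simp add: power2_eq_square algebra_simps)
    moreover have "\<bar>?C a b * (x a * x b)\<bar> \<le> \<bar>x a * x b\<bar>"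
      using Cb[of a b] by (simp add: abs_mult mult_left_le_one_le)
    moreover have "2 * \<bar>x a * x b\<bar> \<le> (x a)\<^sup>2 + (x b)\<^sup>2"
      using sum_squares_bound[of "\<bar>x a\<bar>" "\<bar>x b\<bar>"] by (simp add: abs_mult)
    ultimately show ?thesis using x by linarith
  next
    case 5
    then show ?thesis using half E by simp
  next
    case 4
    show ?thesis
    proof (rule ccontr)
      assume c: "\<not> ?thesis"
      then have c1: "1 \<le> (\<Sum>e\<in>edges. 1 / real (label e))" using 4 by simp
      then have "card edges = 2" using half E 4 by simp
      then obtain e f where ef: "edges = {e, f}" "e \<noteq> f" by (auto simp: card_2_iff)
      have l2: "label e = 2" "label f = 2"
      proof -
        have ge: "label e \<ge> 2" "label f \<ge> 2" using label_ge2 ef by auto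
        have sum: "1 \<le> 1 / real (label e) + 1 / real (label f)" using c1 ef by simp
        have third: "1 / real m \<le> 1 / 3" if "2 \<le> m" "m \<noteq> 2" for m using that by (simp add: field_simps)
        have half: "1 / real m \<le> 1 / 2" if "2 \<le> m" for m using that by (simp add: field_simps)
        show "label e = 2"
        proof (rule ccontr)
          assume "label e \<noteq> 2"
          from third[OF ge(1) this] half[OF ge(2)] sum show False by linarith
        qed
        show "label f = 2"
        proof (rule ccontr)
          assume "label f \<noteq> 2"
          from third[OF ge(2) this] half[OF ge(1)] sum show False by linarith
        qed
      qed
      obtain a b where ab: "a \<in> S" "b \<in> S" "a \<noteq> b" "e = {a, b}" "k a b = enat (label e)"
        by (rule edgesE[of e]) (use ef(1) in simp, blast)
      obtain p q where pq: "p \<in> S" "q \<in> S" "p \<noteq> q" "f = {p, q}" "k p q = enat (label f)"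
        by (rule edgesE[of f]) (use ef(1) in simp, blast)
      have zero: "?C s t = 0" if "k s t = enat 2" for s t using that by (simp add: cosine_matrix_def)
      have "\<exists>u v w. S = {u, v, w} \<and> u \<noteq> v \<and> u \<noteq> w \<and> v \<noteq> w \<and> ?C u v = 0 \<and> ?C u w = 0"
      proof -
        have z: "?C a b = 0" "?C b a = 0" "?C p q = 0" "?C q p = 0"
          using zero[of a b] zero[of p q] ab(5) pq(5) l2 Csym[OF ab(2,1)] Csym[OF pq(2,1)] by simp_all
        have "card (S - {a, b}) = 1" using 4 ab by (simp add: card_Diff_subset)
        then obtain r where r: "S - {a, b} = {r}" by (rule card_1_singletonE)
        then have S: "S = {a, b, r}" "r \<noteq> a" "r \<noteq> b" using ab by auto
        have "(p = r \<and> (q = a \<or> q = b)) \<or> (q = r \<and> (p = a \<or> p = b))"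
        proof -
          have "p = a \<or> p = b \<or> p = r" "q = a \<or> q = b \<or> q = r" using pq(1,2) S(1) by auto
          moreover have "\<not> (p = a \<and> q = b)" "\<not> (p = b \<and> q = a)" using ef(2) ab(4) pq(4) by auto
          ultimately show ?thesis using pq(3) by blast
        qed
        then have "?C a r = 0 \<or> ?C b r = 0" using z by auto
        moreover have "S = {b, a, r}" using S by auto
        ultimately show ?thesis using S z ab(3) by metis
      qed
      then obtain u v w where S: "S = {u, v, w}" "u \<noteq> v" "u \<noteq> w" "v \<noteq> w" "?C u v = 0" "?C u w = 0" by blast
      have "?q x = (x u)\<^sup>2 + ((x v)\<^sup>2 + (x w)\<^sup>2 + 2 * ?C v w * (x v * x w))"
        using S C1 Csym[of v u] Csym[of w u] Csym[of w v] by (simp add: power2_eq_square algebra_simps)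
      moreover have "\<bar>?C v w * (x v * x w)\<bar> \<le> \<bar>x v * x w\<bar>"
        using Cb[of v w] by (simp add: abs_mult mult_left_le_one_le)
      moreover have "2 * \<bar>x v * x w\<bar> \<le> (x v)\<^sup>2 + (x w)\<^sup>2"
        using sum_squares_bound[of "\<bar>x v\<bar>" "\<bar>x w\<bar>"] by (simp add: abs_mult)
      moreover have "0 \<le> (x u)\<^sup>2" by simp
      ultimately show False using x by linarith
    qed
  qed
qed

end

section \<open>The positive zero and its limits\<close>

lemma qsum_pos: "0 < n \<Longrightarrow> 0 \<le> x \<Longrightarrow> 0 < qsum n (x::real)"
  unfolding qsum_def by (intro sum_pos2[of _ 0]) auto

lemma qsum_one: "qsum n (1 :: real) = real n" by (simp add: qsum_def)

lemma charfun_of_real: "charfun N J L (complex_of_real x) = complex_of_real (charfun N J L x)"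
  by (simp add: charfun_def qsum_def)

lemma continuous_charfun:
  assumes "\<And>j. j \<in> J \<Longrightarrow> 2 \<le> L j"
  shows "continuous_on {0..1} (charfun N J L :: real \<Rightarrow> real)"
proof -
  have "continuous_on {0..1} (\<lambda>x::real. 1 + x - real N * x + (\<Sum>j\<in>J. x ^ L j / qsum (L j) x))"
  proof (intro continuous_intros ballI)
    fix j and x :: real assume "j \<in> J" "x \<in> {0..1}"
    then show "qsum (L j) x \<noteq> 0" using qsum_pos[of "L j" x] assms[of j] by force
  next
    fix j show "continuous_on {0..1} (\<lambda>x::real. qsum (L j) x)" unfolding qsum_def by (intro continuous_intros)
  qed
  then show ?thesis by (simp add: charfun_def[abs_def])
qed

lemma charfun_1:
  "charfun N J L (1 :: real) = 2 - real N + (\<Sum>j\<in>J. 1 / real (L j))"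
  by (simp add: charfun_def qsum_one)

lemma charfun_0:
  assumes "\<And>j. j \<in> J \<Longrightarrow> 2 \<le> L j"
  shows "charfun N J L (0::real) = 1"
proof -
  have "(0::real) ^ L j = 0" if "j \<in> J" for j using assms[OF that] by simp
  then have "(\<Sum>j\<in>J. (0::real) ^ L j / qsum (L j) 0) = 0" by (intro sum.neutral) simp
  then show ?thesis by (simp add: charfun_def)
qed

text \<open>
  The intermediate value theorem on \<open>[a, 1]\<close>. The lower bound \<open>a\<close> makes it possible to locate the zeros of
  modified label functions relative to the original one.
\<close>
lemma charfun_root:
  assumes J: "finite J" "\<And>j. j \<in> J \<Longrightarrow> 2 \<le> L j" and neg: "(\<Sum>j\<in>J. 1 / real (L j)) < real N - 2"
    and a: "0 \<le> a" "a < 1" "charfun N J L a \<ge> 0"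
  shows "\<exists>R. a \<le> R \<and> 0 < R \<and> R < 1 \<and> charfun N J L R = (0::real)"
proof -
  have "\<exists>x\<ge>a. x \<le> 1 \<and> charfun N J L x = 0"
    by (rule IVT2') (use a neg continuous_on_subset[OF continuous_charfun[of J L N, OF J(2)]] in \<open>auto simp: charfun_1\<close>)
  then obtain R where R: "a \<le> R" "R \<le> 1" "charfun N J L R = 0" by blast
  have "charfun N J L (0::real) = 1" using J(2) by (rule charfun_0)
  then have "R \<noteq> 0" using R by auto
  moreover have "R \<noteq> 1" using R neg by (auto simp: charfun_1)
  ultimately show ?thesis using R a by (intro exI[of _ R]) auto
qed

lemma charfun_root_unique:
  assumes J: "finite J" "\<And>j. j \<in> J \<Longrightarrow> 2 \<le> L j" "card J \<le> N"
    and "0 < x" "x < 1" "charfun N J L x = (0::real)" "0 < y" "y < 1" "charfun N J L y = 0"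
  shows "x = y"
proof -
  have "complex_of_real x = complex_of_real y"
    by (rule charfun_zero_unique[OF J]) (use assms in \<open>simp_all add: charfun_of_real\<close>)
  then show ?thesis by simp
qed

text \<open>
  The labels of the approximating cycles: those of the given system, and \<open>m\<close> on the edges that are left over.
\<close>
definition filled :: "nat \<Rightarrow> (nat \<Rightarrow> nat) \<Rightarrow> nat \<Rightarrow> nat \<Rightarrow> nat" where
  "filled E L m i = (if i < E then L i else m)"

lemma sum_filled:
  assumes "E \<le> N"
  shows "(\<Sum>i<N. f (filled E L m i)) = (\<Sum>i<E. f (L i)) + of_nat (N - E) * (f m :: 'b::comm_semiring_1)"
proof -
  have "(\<Sum>i<N. f (filled E L m i)) = (\<Sum>i<E. f (filled E L m i)) + (\<Sum>i=E..<N. f (filled E L m i))"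
    using sum.atLeastLessThan_concat[of 0 E N "\<lambda>i. f (filled E L m i)"] assms by (simp add: lessThan_atLeast0)
  then show ?thesis by (simp add: filled_def)
qed

lemma charfun_filled:
  "E \<le> N \<Longrightarrow> charfun N {..<N} (filled E L m) x =
    charfun N {..<E} L x + of_nat (N - E) * (x ^ m / qsum m x)"
  unfolding charfun_def by (simp add: sum_filled[where f = "\<lambda>n. x ^ n / qsum n x"])

text \<open>
  The additional edges increase \<open>F\<close> on the positive axis, so the zeros move to the right. To the right of
  \<open>R\<close> the function \<open>F\<close> is negative by uniqueness of the zero, and the additional terms tend to 0 there; so
  the zeros tend to \<open>R\<close>.
\<close>
lemma filled_roots:
  assumes L: "\<And>j. j < E \<Longrightarrow> 2 \<le> L j" and EN: "E < N" and neg: "(\<Sum>j<E. 1 / real (L j)) < real N - 2"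
    and R: "0 < R" "R < 1" "charfun N {..<E} L R = (0::real)"
  obtains m r where "\<And>n. 2 \<le> m n" "\<And>n. (\<Sum>j<N. 1 / real (filled E L (m n) j)) < real N - 2"
    "\<And>n. R \<le> r n" "\<And>n. 0 < r n" "\<And>n. r n < 1" "\<And>n. charfun N {..<N} (filled E L (m n)) (r n) = 0"
    "r \<longlonglongrightarrow> R"
proof -
  let ?F = "charfun N {..<E} L :: real \<Rightarrow> real" and ?d = "real (N - E)"
  let ?c = "real N - 2 - (\<Sum>j<E. 1 / real (L j))"
  have c: "?c > 0" using neg by simp
  \<comment> \<open>from this label on, the additional edges keep the sum of the \<open>1 / k\<close> below \<open>N - 2\<close>\<close>
  obtain n0 where n0: "real n0 > ?d / ?c" using reals_Archimedean2 by blast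
  define m where "m n = n + n0 + 2" for n
  have neg': "(\<Sum>j<N. 1 / real (filled E L (m n) j)) < real N - 2" for n
  proof -
    have "?d < ?c * real n0" using n0 c by (simp add: field_simps)
    also have "\<dots> \<le> ?c * real (m n)" using c by (intro mult_left_mono) (auto simp: m_def)
    finally have "?d * (1 / real (m n)) < ?c" by (simp add: m_def field_simps)
    then show ?thesis using EN by (subst sum_filled) auto
  qed
  have f2: "2 \<le> filled E L (m n) j" for n j using L by (simp add: filled_def m_def)
  have "\<exists>r. R \<le> r \<and> 0 < r \<and> r < 1 \<and> charfun N {..<N} (filled E L (m n)) r = 0" for n
  proof (rule charfun_root[OF _ f2 neg'])
    have "0 < qsum (m n) R" using R by (intro qsum_pos) (auto simp: m_def)
    then show "0 \<le> charfun N {..<N} (filled E L (m n)) R" using R EN by (simp add: charfun_filled)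
  qed (use R in auto)
  then obtain r where r: "\<And>n. R \<le> r n" "\<And>n. 0 < r n" "\<And>n. r n < 1"
      "\<And>n. charfun N {..<N} (filled E L (m n)) (r n) = 0" by metis
  have "r \<longlonglongrightarrow> R"
  proof (rule LIMSEQ_I)
    fix \<epsilon> :: real assume e: "\<epsilon> > 0"
    \<comment> \<open>a point to the right of \<open>R\<close>, but within \<open>\<epsilon>\<close> of it and below 1\<close>
    define x where "x = min (R + \<epsilon> / 2) ((R + 1) / 2)"
    have x: "R < x" "x < R + \<epsilon>" "x < 1" using e R by (auto simp: x_def min_def)
    have Fx: "?F x < 0"
    proof (rule ccontr)
      assume "\<not> ?F x < 0"
      then obtain y where "x \<le> y" "0 < y" "y < 1" "?F y = 0"
        using charfun_root[of "{..<E}" L N x] L neg x R by auto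
      then show False using charfun_root_unique[of "{..<E}" L N y R] L EN R x by auto
    qed
    have "(\<lambda>n. ?d * (x ^ m n / qsum (m n) x)) \<longlonglongrightarrow> 0"
    proof (rule Lim_null_comparison)
      show "\<forall>\<^sub>F n in sequentially. norm (?d * (x ^ m n / qsum (m n) x)) \<le> ?d * x ^ n"
      proof (rule always_eventually, rule allI)
        fix n
        have q: "1 \<le> qsum (m n) x"
          using sum_mono2[of "{..<m n}" "{0}" "\<lambda>i. x ^ i"] x R by (simp add: qsum_def m_def)
        have "x ^ m n / qsum (m n) x \<le> x ^ m n / 1" using q x R by (intro divide_left_mono) auto
        also have "\<dots> = x ^ m n" by simp
        also have "\<dots> \<le> x ^ n" by (rule power_decreasing) (use x R in \<open>auto simp: m_def\<close>)
        finally have "?d * (x ^ m n / qsum (m n) x) \<le> ?d * x ^ n" by (intro mult_left_mono) simp_all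
        moreover have "norm (?d * (x ^ m n / qsum (m n) x)) = ?d * (x ^ m n / qsum (m n) x)"
          unfolding real_norm_def by (rule abs_of_nonneg) (use q x R in auto)
        ultimately show "norm (?d * (x ^ m n / qsum (m n) x)) \<le> ?d * x ^ n" by (simp only:)
      qed
      show "(\<lambda>n. ?d * x ^ n) \<longlonglongrightarrow> 0" using x R by (intro tendsto_mult_right_zero LIMSEQ_realpow_zero) auto
    qed
    then have "(\<lambda>n. ?F x + ?d * (x ^ m n / qsum (m n) x)) \<longlonglongrightarrow> ?F x + 0" by (intro tendsto_intros)
    then have "\<forall>\<^sub>F n in sequentially. ?F x + ?d * (x ^ m n / qsum (m n) x) < 0"
      using Fx by (intro order_tendstoD) auto
    then obtain n1 where n1: "\<And>n. n \<ge> n1 \<Longrightarrow> ?F x + ?d * (x ^ m n / qsum (m n) x) < 0"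
      by (auto simp: eventually_sequentially)
    have "norm (r n - R) < \<epsilon>" if "n \<ge> n1" for n
    proof -
      have "r n < x"
      proof (rule ccontr)
        assume "\<not> r n < x"
        let ?Fn = "charfun N {..<N} (filled E L (m n)) :: real \<Rightarrow> real"
        have "?Fn x < 0" using n1[OF that] EN by (simp add: charfun_filled)
        have "?Fn R \<ge> 0"
        proof -
          have "0 < qsum (m n) R" using R by (intro qsum_pos) (auto simp: m_def)
          then show ?thesis using R EN by (simp add: charfun_filled)
        qed
        have "\<exists>y\<ge>R. y \<le> x \<and> ?Fn y = 0"
        proof (rule IVT2')
          show "continuous_on {R..x} ?Fn"
            using continuous_on_subset[OF continuous_charfun[of "{..<N}" "filled E L (m n)" N, OF f2], of "{R..x}"] R x by auto
        qed (use \<open>?Fn x < 0\<close> \<open>?Fn R \<ge> 0\<close> x in auto)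
        then obtain y where y: "R \<le> y" "y \<le> x" "?Fn y = 0" by blast
        have "y = r n" using charfun_root_unique[of "{..<N}" "filled E L (m n)" N y "r n"] f2 r y x R by auto
        then show False using y \<open>?Fn x < 0\<close> \<open>\<not> r n < x\<close> by auto
      qed
      then show ?thesis using r(1)[of n] x by simp
    qed
    then show "\<exists>no. \<forall>n\<ge>no. norm (r n - R) < \<epsilon>" by blast
  qed
  moreover have "2 \<le> m n" for n by (simp add: m_def)
  ultimately show thesis using that neg' r by blast
qed

section \<open>The Coxeter group of a Coxeter matrix\<close>

lemma pres_equiv_words: "pres_equiv S R u v \<Longrightarrow> u \<in> signed_words S \<and> v \<in> signed_words S"
  by (induction rule: pres_equiv.induct) (auto simp: signed_words_def)

lemma pres_equiv_append_left:
  "pres_equiv S R u v \<Longrightarrow> w \<in> signed_words S \<Longrightarrow> pres_equiv S R (w @ u) (w @ v)"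
proof (induction rule: pres_equiv.induct)
  case (refl u)
  then show ?case by (intro pres_equiv.refl) (auto simp: signed_words_def)
next
  case (cancel u v s b)
  then show ?case using pres_equiv.cancel[of "w @ u" S v s R b] by (auto simp: signed_words_def)
next
  case (relator u v r)
  then show ?case using pres_equiv.relator[of "w @ u" S v r R] by (auto simp: signed_words_def)
qed (blast intro: pres_equiv.sym pres_equiv.trans)+

lemma pres_equiv_append_right:
  "pres_equiv S R u v \<Longrightarrow> w \<in> signed_words S \<Longrightarrow> pres_equiv S R (u @ w) (v @ w)"
proof (induction rule: pres_equiv.induct)
  case (refl u)
  then show ?case by (intro pres_equiv.refl) (auto simp: signed_words_def)
next
  case (cancel u v s b)
  then show ?case using pres_equiv.cancel[of u S "v @ w" s R b] by (auto simp: signed_words_def)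
next
  case (relator u v r)
  then show ?case using pres_equiv.relator[of u S "v @ w" r R] by (auto simp: signed_words_def)
qed (blast intro: pres_equiv.sym pres_equiv.trans)+

lemma pres_equiv_inverse:
  assumes "w \<in> signed_words S"
  shows "pres_equiv S R (rev (map (\<lambda>(s, b). (s, \<not> b)) w) @ w) []"
  using assms
proof (induction w)
  case Nil
  then show ?case by (simp add: pres_equiv.refl)
next
  case (Cons p w)
  obtain s b where p: "p = (s, b)" by (cases p)
  let ?i = "rev (map (\<lambda>(s, b). (s, \<not> b)) w)"
  have w: "w \<in> signed_words S" "?i \<in> signed_words S" "s \<in> S" using Cons.prems p by (auto simp: signed_words_def)
  have "pres_equiv S R (?i @ [(s, \<not> b), (s, \<not> \<not> b)] @ w) (?i @ w)"
    using w by (intro pres_equiv.cancel)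
  then show ?case using Cons.IH[OF w(1)] p by (simp add: pres_equiv.trans)
qed

text \<open>
  Applied to a bijection and to its inverse, this identifies the presentations over two sets of generators.
\<close>
lemma pres_equiv_transport:
  assumes f: "\<And>s. s \<in> S \<Longrightarrow> f s \<in> S'" and k: "\<And>s t. s \<in> S \<Longrightarrow> t \<in> S \<Longrightarrow> k' (f s) (f t) = k s t"
    and e: "pres_equiv S (coxeter_relators S k) u v"
  shows "pres_equiv S' (coxeter_relators S' k') (map (apfst f) u) (map (apfst f) v)"
proof -
  have m: "map (apfst f) w \<in> signed_words S'" if "w \<in> signed_words S" for w
    using that by (induction w) (use f in \<open>auto simp: signed_words_def\<close>)
  from e show ?thesis
  proof induction
    case (refl u)
    then show ?case using m by (intro pres_equiv.refl)
  next
    case (cancel u v s b)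
    then show ?case using pres_equiv.cancel[OF m m f, of u v s "coxeter_relators S' k'" b] by simp
  next
    case (relator u v r)
    then obtain s t n where r: "r = concat (replicate n [(s, True), (t, True)])" "s \<in> S" "t \<in> S" "k s t = enat n"
      by (auto simp: coxeter_relators_def)
    have "map (apfst f) r = concat (replicate n [(f s, True), (f t, True)])"
      unfolding r(1) by (simp add: map_concat)
    then have "map (apfst f) r \<in> coxeter_relators S' k'"
      using r f k unfolding coxeter_relators_def by (intro CollectI exI[of _ "f s"] exI[of _ "f t"] exI[of _ n]) auto
    then show ?case using pres_equiv.relator[OF m m _ m, of u v r "coxeter_relators S' k'"] relator by simp
  qed (blast intro: pres_equiv.sym pres_equiv.trans)+
qed

text \<open>
  The group consists of equivalence classes of words. To have it on natural numbers, a class is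
  represented by the least code of its members. Distinct generators stay distinct because \<open>s t\<close> has order
  at least 2 by \<open>pres_equiv_order\<close>.
\<close>
theorem coxeter_system_exists:
  fixes A :: "nat set" and \<kappa> :: "nat \<Rightarrow> nat \<Rightarrow> enat"
  assumes fin: "finite A" and M: "coxeter_matrix A \<kappa>"
  shows "\<exists>(H :: nat monoid) T m \<phi>. coxeter_system H T m \<and> bij_betw \<phi> A T \<and>
    (\<forall>a\<in>A. \<forall>b\<in>A. m (\<phi> a) (\<phi> b) = \<kappa> a b)"
proof -
  let ?R = "coxeter_relators A \<kappa>" and ?W = "signed_words A"
  define eqv where "eqv = pres_equiv A ?R"
  define rep :: "nat signed_word \<Rightarrow> nat" where "rep w = (LEAST n. eqv w (from_nat n))" for w
  have W_app: "u @ v \<in> ?W" if "u \<in> ?W" "v \<in> ?W" for u v using that by (auto simp: signed_words_def)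
  have W_nil: "[] \<in> ?W" by (simp add: signed_words_def)
  have eqv_rep: "eqv w (from_nat (rep w))" if "w \<in> ?W" for w
    unfolding rep_def by (rule LeastI[of _ "to_nat w"]) (use that in \<open>simp add: eqv_def pres_equiv.refl\<close>)
  have rep_eq: "rep u = rep v \<longleftrightarrow> eqv u v" if "u \<in> ?W" "v \<in> ?W" for u v
  proof
    assume "rep u = rep v"
    then have "eqv u (from_nat (rep v))" using eqv_rep[OF that(1)] by simp
    then show "eqv u v" using eqv_rep[OF that(2)] unfolding eqv_def by (blast intro: pres_equiv.sym pres_equiv.trans)
  next
    assume "eqv u v"
    then have "eqv u w \<longleftrightarrow> eqv v w" for w unfolding eqv_def by (blast intro: pres_equiv.sym pres_equiv.trans)
    then show "rep u = rep v" by (simp add: rep_def)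
  qed
  have dec: "from_nat (rep w) \<in> ?W" if "w \<in> ?W" for w
    using eqv_rep[OF that] pres_equiv_words unfolding eqv_def by blast
  define H :: "nat monoid" where
    "H = \<lparr>carrier = rep ` ?W, mult = (\<lambda>x y. rep (from_nat x @ from_nat y)), one = rep []\<rparr>"
  have H_mult: "rep u \<otimes>\<^bsub>H\<^esub> rep v = rep (u @ v)" if "u \<in> ?W" "v \<in> ?W" for u v
  proof -
    have "eqv (from_nat (rep u) @ from_nat (rep v)) (u @ v)"
      using pres_equiv_append_left[OF eqv_rep[OF that(2), unfolded eqv_def] dec[OF that(1)]]
        pres_equiv_append_right[OF eqv_rep[OF that(1), unfolded eqv_def] that(2)]
      unfolding eqv_def by (blast intro: pres_equiv.sym pres_equiv.trans)
    then show ?thesis using rep_eq that dec W_app by (simp add: H_def)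
  qed
  have H_one: "\<one>\<^bsub>H\<^esub> = rep []" and H_carrier: "carrier H = rep ` ?W" by (simp_all add: H_def)
  have grp: "group H"
  proof (rule groupI)
    show "x \<otimes>\<^bsub>H\<^esub> y \<in> carrier H" if "x \<in> carrier H" "y \<in> carrier H" for x y
      using that H_mult W_app unfolding H_carrier by auto
    show "\<one>\<^bsub>H\<^esub> \<in> carrier H" using W_nil unfolding H_carrier H_one by auto
    show "x \<otimes>\<^bsub>H\<^esub> y \<otimes>\<^bsub>H\<^esub> z = x \<otimes>\<^bsub>H\<^esub> (y \<otimes>\<^bsub>H\<^esub> z)" if "x \<in> carrier H" "y \<in> carrier H" "z \<in> carrier H" for x y z
      using that H_mult W_app unfolding H_carrier by auto
    show "\<one>\<^bsub>H\<^esub> \<otimes>\<^bsub>H\<^esub> x = x" if "x \<in> carrier H" for x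
      using that H_mult[OF W_nil] unfolding H_carrier H_one by auto
    show "\<exists>y\<in>carrier H. y \<otimes>\<^bsub>H\<^esub> x = \<one>\<^bsub>H\<^esub>" if x: "x \<in> carrier H" for x
    proof -
      obtain w where w: "w \<in> ?W" "x = rep w" using x H_carrier by auto
      let ?i = "rev (map (\<lambda>(s, b). (s, \<not> b)) w)"
      have i: "?i \<in> ?W" using w by (auto simp: signed_words_def)
      have "rep ?i \<otimes>\<^bsub>H\<^esub> x = \<one>\<^bsub>H\<^esub>"
        using pres_equiv_inverse[OF w(1), of ?R] rep_eq[OF W_app[OF i w(1)] W_nil] H_mult[OF i w(1)] w
        by (simp add: eqv_def H_one)
      then show ?thesis using i H_carrier by blast
    qed
  qed
  interpret H: group H by (rule grp)
  define \<phi> where "\<phi> s = rep [(s, True)]" for s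
  define T where "T = \<phi> ` A"
  have lW: "[(s, b)] \<in> ?W" if "s \<in> A" for s b using that by (simp add: signed_words_def)
  have inj: "inj_on \<phi> A"
  proof (rule inj_onI, rule ccontr)
    fix s t assume st: "s \<in> A" "t \<in> A" "\<phi> s = \<phi> t" "s \<noteq> t"
    have "eqv [(s, True)] [(t, True)]" using st rep_eq lW by (simp add: \<phi>_def)
    then have 1: "eqv ([(s, True)] @ [(t, True)]) ([(t, True)] @ [(t, True)])"
      unfolding eqv_def by (rule pres_equiv_append_right) (use st lW in auto)
    have "[(t, True), (t, True)] \<in> ?R" unfolding coxeter_relators_def
      using st M by (intro CollectI exI[of _ t] exI[of _ 1]) (auto simp: coxeter_matrix_def one_enat_def)
    then have "eqv ([] @ [(t, True), (t, True)] @ []) ([] @ [])"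
      unfolding eqv_def using W_nil st by (intro pres_equiv.relator) (auto simp: signed_words_def)
    then have "eqv [(s, True), (t, True)] []" using 1 unfolding eqv_def by (auto intro: pres_equiv.trans)
    moreover have "enat 1 < \<kappa> s t"
    proof -
      have "enat 2 \<le> \<kappa> s t" using M st unfolding coxeter_matrix_def by (auto simp: numeral_eq_enat)
      then show ?thesis by (rule less_le_trans[rotated]) simp
    qed
    ultimately show False
      using pres_equiv_order[OF M st(1,2,4), of 1 "[(s, True), (t, True)]"] by (simp add: eqv_def numeral_2_eq_2)
  qed
  define \<psi> where "\<psi> = inv_into A \<phi>"
  have psi: "\<psi> (\<phi> s) = s" if "s \<in> A" for s using inj that by (simp add: \<psi>_def)
  have psiT: "\<psi> x \<in> A" "\<phi> (\<psi> x) = x" if "x \<in> T" for x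
    using that by (auto simp: T_def \<psi>_def inv_into_into f_inv_into_f)
  define m where "m x y = \<kappa> (\<psi> x) (\<psi> y)" for x y
  have m: "m (\<phi> a) (\<phi> b) = \<kappa> a b" if "a \<in> A" "b \<in> A" for a b using that psi by (simp add: m_def)
  have invg: "inv\<^bsub>H\<^esub> (\<phi> s) = rep [(s, False)]" if "s \<in> A" for s
  proof (rule H.inv_equality)
    have "eqv ([] @ [(s, False), (s, \<not> False)] @ []) ([] @ [])"
      unfolding eqv_def using W_nil that by (intro pres_equiv.cancel)
    then show "rep [(s, False)] \<otimes>\<^bsub>H\<^esub> \<phi> s = \<one>\<^bsub>H\<^esub>"
      using H_mult[OF lW[OF that] lW[OF that]] rep_eq[OF W_app[OF lW[OF that] lW[OF that]] W_nil] by (simp add: \<phi>_def H_one)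
  qed (use lW[OF that] in \<open>auto simp: \<phi>_def H_carrier\<close>)
  have letter: "(if b then \<phi> s else inv\<^bsub>H\<^esub> (\<phi> s)) = rep [(s, b)]" if "s \<in> A" for s b
    using invg[OF that] by (simp add: \<phi>_def)
  have eval: "word_eval H (map (apfst \<phi>) w) = rep w" if "w \<in> ?W" for w
    using that
  proof (induction w)
    case Nil
    then show ?case by (simp add: word_eval_def H_one)
  next
    case (Cons p w)
    obtain s b where p: "p = (s, b)" by (cases p)
    have s: "s \<in> A" and w: "w \<in> ?W" using Cons.prems p by (auto simp: signed_words_def)
    have "word_eval H (map (apfst \<phi>) (p # w)) = rep [(s, b)] \<otimes>\<^bsub>H\<^esub> word_eval H (map (apfst \<phi>) w)"
      using letter[OF s, of b] by (simp add: word_eval_def p)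
    also have "\<dots> = rep [(s, b)] \<otimes>\<^bsub>H\<^esub> rep w" by (simp only: Cons.IH[OF w])
    also have "\<dots> = rep (p # w)" using H_mult[OF lW[OF s] w] p by simp
    finally show ?case .
  qed
  have pull: "map (apfst \<psi>) w \<in> ?W \<and> map (apfst \<phi>) (map (apfst \<psi>) w) = w"
    if "w \<in> signed_words T" for w
    using that by (induction w) (use psiT in \<open>auto simp: signed_words_def\<close>)
  have T_sub: "T \<subseteq> carrier H" using lW by (auto simp: T_def \<phi>_def H_carrier)
  have gen: "generate H T = carrier H"
  proof
    show "generate H T \<subseteq> carrier H" using H.generate_in_carrier[OF T_sub] by blast
    have "rep w \<in> generate H T" if "w \<in> ?W" for w
      using that
    proof (induction w)
      case Nil
      then show ?case using generate.one[of H T] H_one by simp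
    next
      case (Cons p w)
      obtain s b where p: "p = (s, b)" by (cases p)
      have s: "s \<in> A" and w: "w \<in> ?W" using Cons.prems p by (auto simp: signed_words_def)
      have "rep [(s, b)] \<in> generate H T"
        unfolding letter[OF s, symmetric] using s by (auto simp: T_def intro: generate.incl generate.inv)
      then have "rep [(s, b)] \<otimes>\<^bsub>H\<^esub> rep w \<in> generate H T" using Cons.IH[OF w] by (rule generate.eng)
      then show ?case using H_mult[OF lW[OF s] w] p by simp
    qed
    then show "carrier H \<subseteq> generate H T" unfolding H_carrier by auto
  qed
  have "presented_by H T (coxeter_relators T m)"
    unfolding presented_by_def
  proof (intro conjI ballI grp T_sub gen)
    fix u v assume uv: "u \<in> signed_words T" "v \<in> signed_words T"
    let ?u = "map (apfst \<psi>) u" and ?v = "map (apfst \<psi>) v"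
    have "word_eval H u = word_eval H v \<longleftrightarrow> rep ?u = rep ?v"
      using pull[OF uv(1)] pull[OF uv(2)] eval[of ?u] eval[of ?v] by simp
    also have "\<dots> \<longleftrightarrow> pres_equiv A ?R ?u ?v" using rep_eq[of ?u ?v] pull[OF uv(1)] pull[OF uv(2)] by (simp add: eqv_def)
    also have "\<dots> \<longleftrightarrow> pres_equiv T (coxeter_relators T m) u v"
    proof
      assume "pres_equiv A ?R ?u ?v"
      from pres_equiv_transport[of A \<phi> T m \<kappa>, OF _ m this]
      show "pres_equiv T (coxeter_relators T m) u v" using pull[OF uv(1)] pull[OF uv(2)] by (simp only: T_def imageI)
    next
      assume "pres_equiv T (coxeter_relators T m) u v"
      from pres_equiv_transport[of T \<psi> A \<kappa> m, OF psiT(1) _ this]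
      show "pres_equiv A ?R ?u ?v" by (simp add: m_def)
    qed
    finally show "word_eval H u = word_eval H v \<longleftrightarrow> pres_equiv T (coxeter_relators T m) u v" .
  qed
  moreover have "coxeter_matrix T m"
    using M inj unfolding coxeter_matrix_def T_def by (auto simp: m inj_on_eq_iff)
  ultimately have "coxeter_system H T m" using fin by (simp add: coxeter_system_def T_def)
  moreover have "bij_betw \<phi> A T" using inj by (simp add: bij_betw_def T_def)
  ultimately show ?thesis using m by blast
qed

section \<open>Cycles as nerves, and the theorem\<close>

definition cyclic_next :: "nat \<Rightarrow> nat \<Rightarrow> nat" where
  "cyclic_next N i = (if Suc i = N then 0 else Suc i)"

definition cycle_matrix :: "nat \<Rightarrow> (nat \<Rightarrow> nat) \<Rightarrow> nat \<Rightarrow> nat \<Rightarrow> enat" where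
  "cycle_matrix N l i j = (if i = j then 1 else if j = cyclic_next N i then enat (l i)
     else if i = cyclic_next N j then enat (l j) else \<infinity>)"

lemma cyclic_next_lt: "i < N \<Longrightarrow> cyclic_next N i < N"
  by (auto simp: cyclic_next_def)

text \<open>
  If \<open>x < y < z\<close> are pairwise adjacent, then \<open>y\<close> and \<open>z\<close> are the successors of \<open>x\<close> and \<open>y\<close>, so \<open>x\<close> and \<open>z\<close> can only be
  adjacent as the first and the last vertex.
\<close>
lemma cyclic_triangle:
  assumes lt: "a < N" "b < N" "c < N" and ne: "a \<noteq> b" "a \<noteq> c" "b \<noteq> c"
    and adj: "a = cyclic_next N b \<or> b = cyclic_next N a" "a = cyclic_next N c \<or> c = cyclic_next N a"
      "b = cyclic_next N c \<or> c = cyclic_next N b"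
  shows "N = 3"
proof -
  have less: "j = Suc i \<or> (i = 0 \<and> Suc j = N)"
    if "i < j" "j < N" "i = cyclic_next N j \<or> j = cyclic_next N i" for i j
    using that unfolding cyclic_next_def by (auto split: if_splits)
  have sorted: "N = 3" if o: "x < y" "y < z" "z < N"
    and a: "x = cyclic_next N y \<or> y = cyclic_next N x" "x = cyclic_next N z \<or> z = cyclic_next N x"
      "y = cyclic_next N z \<or> z = cyclic_next N y" for x y z
  proof -
    have "y = Suc x \<or> (x = 0 \<and> Suc y = N)" using less[OF o(1) _ a(1)] o by linarith
    moreover have "z = Suc x \<or> (x = 0 \<and> Suc z = N)" using less[OF _ o(3) a(2)] o by linarith
    moreover have "z = Suc y \<or> (y = 0 \<and> Suc z = N)" by (rule less[OF o(2,3) a(3)])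
    ultimately show ?thesis using o by linarith
  qed
  consider "a < b" "b < c" | "a < c" "c < b" | "b < a" "a < c" | "b < c" "c < a" | "c < a" "a < b" | "c < b" "b < a"
    using ne by linarith
  then show ?thesis
  proof cases
    case 1 then show ?thesis using sorted[of a b c] lt adj by blast
  next
    case 2 then show ?thesis using sorted[of a c b] lt adj by blast
  next
    case 3 then show ?thesis using sorted[of b a c] lt adj by blast
  next
    case 4 then show ?thesis using sorted[of b c a] lt adj by blast
  next
    case 5 then show ?thesis using sorted[of c a b] lt adj by blast
  next
    case 6 then show ?thesis using sorted[of c b a] lt adj by blast
  qed
qed

lemma coxeter_cycle_matrix:
  assumes "3 \<le> N" "\<And>i. i < N \<Longrightarrow> 2 \<le> l i"
  shows "coxeter_matrix {..<N} (cycle_matrix N l)"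
  using assms by (auto simp: coxeter_matrix_def cycle_matrix_def cyclic_next_def numeral_eq_enat)

text \<open>
  The nerve is the cycle: three generators of a finite subgroup would be pairwise adjacent, which is only
  possible for \<open>N = 3\<close>, and then \<open>finite_rank_3\<close> contradicts the bound on \<open>\<Sum> 1 / l\<close>.
\<close>
theorem cycle_system:
  assumes N: "3 \<le> N" and l: "\<And>i. i < N \<Longrightarrow> 2 \<le> l i"
    and neg: "(\<Sum>i<N. 1 / real (l i)) < real N - 2"
    and R: "0 < R" "R < 1" "charfun N {..<N} l R = (0::real)"
  shows "\<exists>(H :: nat monoid) T m. coxeter_system H T m \<and> euler_characteristic (nerve H T) = 0 \<and>
    growth_rate H T = 1 / R"
proof -
  let ?A = "{..<N}" and ?\<kappa> = "cycle_matrix N l" and ?s = "cyclic_next N"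
  have "coxeter_matrix ?A ?\<kappa>" by (rule coxeter_cycle_matrix[OF N]) (rule l)
  from coxeter_system_exists[OF finite_lessThan this]
  obtain H :: "nat monoid" and T m \<phi> where
    cox: "coxeter_system H T m" and bij: "bij_betw \<phi> ?A T"
    and m': "\<forall>a\<in>?A. \<forall>b\<in>?A. m (\<phi> a) (\<phi> b) = ?\<kappa> a b"
    by blast
  have m: "m (\<phi> a) (\<phi> b) = ?\<kappa> a b" if "a < N" "b < N" for a b using m' that by simp
  interpret H: coxeter H T m using cox by unfold_locales
  have T: "T = \<phi> ` ?A" and inj: "inj_on \<phi> ?A" using bij by (auto simp: bij_betw_def)
  have phi_eq: "\<phi> a = \<phi> b \<longleftrightarrow> a = b" if "a < N" "b < N" for a b using inj that by (auto simp: inj_on_eq_iff)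
  have cardT: "card T = N" using bij_betw_same_card[OF bij] by simp
  define edge where "edge i = {\<phi> i, \<phi> (?s i)}" for i
  have next_neq: "?s i \<noteq> i" if "i < N" for i using N that by (auto simp: cyclic_next_def)
  have edges: "H.edges = edge ` ?A"
  proof (intro equalityI subsetI)
    fix e assume "e \<in> H.edges"
    then obtain x y where xy: "x \<in> T" "y \<in> T" "x \<noteq> y" "e = {x, y}" "m x y \<noteq> \<infinity>" by (auto simp: H.edges_def)
    then obtain a b where ab: "a < N" "b < N" "x = \<phi> a" "y = \<phi> b" using T by auto
    then have "a \<noteq> b" "?\<kappa> a b \<noteq> \<infinity>" using xy m by auto
    then have "b = ?s a \<or> a = ?s b" by (auto simp: cycle_matrix_def split: if_splits)
    then have "e = edge a \<or> e = edge b" using ab xy by (auto simp: edge_def)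
    then show "e \<in> edge ` ?A" using ab by auto
  next
    fix e assume "e \<in> edge ` ?A"
    then obtain i where i: "i < N" "e = edge i" by auto
    have "m (\<phi> i) (\<phi> (?s i)) \<noteq> \<infinity>"
      using i next_neq[OF i(1)] by (simp add: m cyclic_next_lt cycle_matrix_def)
    moreover have "\<phi> i \<in> T" "\<phi> (?s i) \<in> T" "\<phi> i \<noteq> \<phi> (?s i)"
      using i cyclic_next_lt[OF i(1)] next_neq[OF i(1)] phi_eq[of i "?s i"] T by auto
    ultimately show "e \<in> H.edges" unfolding H.edges_def i(2) edge_def by blast
  qed
  have lab: "H.label (edge i) = l i" if i: "i < N" for i
    unfolding edge_def
  proof (rule H.label_eq)
    show "m (\<phi> i) (\<phi> (?s i)) = enat (l i)"
      using i next_neq[OF i] by (simp add: m cyclic_next_lt cycle_matrix_def)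
  qed (use i cyclic_next_lt[OF i] next_neq[OF i] phi_eq[of i "?s i"] T in auto)
  have inj_edge: "inj_on edge ?A"
  proof (rule inj_onI)
    fix i j assume ij: "i \<in> ?A" "j \<in> ?A" "edge i = edge j"
    then have "(i = j \<and> ?s i = ?s j) \<or> (i = ?s j \<and> ?s i = j)"
      using cyclic_next_lt[of i N] cyclic_next_lt[of j N] phi_eq by (simp add: edge_def doubleton_eq_iff)
    then show "i = j" using N ij by (auto simp: cyclic_next_def split: if_splits)
  qed
  have card_edges: "card H.edges = N" unfolding edges using inj_edge by (simp add: card_image)
  have sum_edges: "(\<Sum>e\<in>H.edges. f (H.label e)) = (\<Sum>i<N. f (l i))" for f :: "nat \<Rightarrow> 'x::comm_monoid_add"
    unfolding edges sum.reindex[OF inj_edge] comp_def using lab by (intro sum.cong) auto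
  have adj: "a = ?s b \<or> b = ?s a" if "a < N" "b < N" "a \<noteq> b" "P \<subseteq> T" "finite (generate H P)" "\<phi> a \<in> P" "\<phi> b \<in> P" for a b P
  proof -
    have "generate H {\<phi> a, \<phi> b} \<subseteq> generate H P" using that by (intro H.mono_generate) auto
    then have "finite (generate H {\<phi> a, \<phi> b})" using that by (rule_tac finite_subset)
    then have "?\<kappa> a b \<noteq> \<infinity>" using H.finite_generate_pair_iff[of "\<phi> a" "\<phi> b"] that phi_eq m by auto
    then show ?thesis using that(3) by (auto simp: cycle_matrix_def split: if_splits)
  qed
  have dim: "coxeter_dim H T \<le> 2"
    unfolding H.dim_le_iff
  proof (intro ballI, rule ccontr)
    fix P assume P: "P \<in> nerve H T" "\<not> card P \<le> 2"
    then have PT: "P \<subseteq> T" and fin: "finite (generate H P)" unfolding nerve_def by blast+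
    have "3 \<le> card P" using P(2) by simp
    then obtain Q where Q: "Q \<subseteq> P" "card Q = 3"
      by (rule obtain_subset_with_card_n) (rule that)
    from Q(2) obtain x y z where xyz: "Q = {x, y, z}" "x \<noteq> y" "x \<noteq> z" "y \<noteq> z"
      unfolding card_3_iff by blast
    have inP: "x \<in> P" "y \<in> P" "z \<in> P" using Q(1) xyz(1) by simp_all
    then have "x \<in> T" "y \<in> T" "z \<in> T" using PT by blast+
    then obtain a b c where abc: "a < N" "b < N" "c < N" "x = \<phi> a" "y = \<phi> b" "z = \<phi> c"
      unfolding T by blast
    have ne: "a \<noteq> b" "a \<noteq> c" "b \<noteq> c" using abc(4-6) xyz(2-4) by blast+
    have "a = ?s b \<or> b = ?s a"
      using adj[OF abc(1,2) ne(1) PT fin] inP(1,2) abc(4,5) by simp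
    moreover have "a = ?s c \<or> c = ?s a"
      using adj[OF abc(1,3) ne(2) PT fin] inP(1,3) abc(4,6) by simp
    moreover have "b = ?s c \<or> c = ?s b"
      using adj[OF abc(2,3) ne(3) PT fin] inP(2,3) abc(5,6) by simp
    ultimately have N3: "N = 3" by (rule cyclic_triangle[OF abc(1-3) ne])
    have "Q = T"
      by (rule card_subset_eq[OF H.finite_S]) (use Q PT cardT N3 in auto)
    then have "P = T" using Q(1) PT by (intro subset_antisym) simp_all
    then have "1 < (\<Sum>e\<in>H.edges. 1 / real (H.label e))"
      using P(1) cardT N3 by (intro H.finite_carrier_rank_3) simp_all
    also have "\<dots> = (\<Sum>i<N. 1 / real (l i))" by (rule sum_edges)
    finally show False using neg N3 by simp
  qed
  have "euler_characteristic (nerve H T) = 0"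
    using H.euler_dim_2[OF dim] card_edges cardT by simp
  moreover have "growth_rate H T = 1 / R"
  proof (rule H.growth_rate_eq[OF dim _ R(1,2)])
    have "charfun (card T) H.edges H.label (complex_of_real R) = charfun N {..<N} l (complex_of_real R)"
      unfolding charfun_def cardT
      by (simp add: sum_edges[of "\<lambda>n. complex_of_real R ^ n / qsum n (complex_of_real R)"])
    then show "charfun (card T) H.edges H.label (complex_of_real R) = 0"
      using R(3) by (simp add: charfun_of_real)
  qed (simp add: card_edges cardT)
  ultimately show ?thesis using cox by blast
qed

theorem theorem2:
  fixes G :: "('a, 'b) monoid_scheme" and S :: "'a set" and k :: "'a \<Rightarrow> 'a \<Rightarrow> enat"
  assumes "coxeter_system G S k"
    and "\<not> coxeter_spherical S k"
    and "\<not> coxeter_affine S k"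
    and "coxeter_dim G S \<le> 2"
    and "euler_characteristic (nerve G S) \<ge> 1"
  shows "pisot_number (growth_rate G S) \<and>
    (\<exists>(H :: nat \<Rightarrow> nat monoid) (T :: nat \<Rightarrow> nat set) (m :: nat \<Rightarrow> nat \<Rightarrow> nat \<Rightarrow> enat).
       (\<forall>n. coxeter_system (H n) (T n) (m n) \<and>
            euler_characteristic (nerve (H n) (T n)) = 0 \<and>
            growth_rate (H n) (T n) \<le> growth_rate G S) \<and>
       (\<lambda>n. growth_rate (H n) (T n)) \<longlonglongrightarrow> growth_rate G S)"
proof -
  interpret coxeter G S k using assms(1) by unfold_locales
  let ?N = "card S" and ?E = "card edges"
  have EN: "?E < ?N" using euler_dim_2[OF assms(4)] assms(5) by simp
  have neg: "(\<Sum>e\<in>edges. 1 / real (label e)) < real ?N - 2" by (rule not_affine_imp[OF assms(3) EN])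
  obtain R where R: "0 < R" "R < 1" "charfun ?N edges label R = (0::real)"
    using charfun_root[OF finite_edges label_ge2 neg, of 0] charfun_0[of edges label ?N, OF label_ge2] by auto
  have cR: "charfun ?N edges label (complex_of_real R) = 0" using R(3) by (simp add: charfun_of_real)
  have gr: "growth_rate G S = 1 / R" using growth_rate_eq[OF assms(4) _ R(1,2) cR] EN by simp
  have pisot: "pisot_number (growth_rate G S)"
    unfolding gr by (rule pisot_charfun[OF finite_edges label_ge2 EN R(1,2) cR])
  obtain h where h: "bij_betw h {..<?E} edges"
    using ex_bij_betw_nat_finite[OF finite_edges] by (auto simp: lessThan_atLeast0)
  define L where "L i = label (h i)" for i
  have sum_h: "(\<Sum>i<?E. f (L i)) = (\<Sum>e\<in>edges. f (label e))" for f :: "nat \<Rightarrow> real"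
    unfolding L_def by (rule sum.reindex_bij_betw[OF h])
  have L2: "2 \<le> L i" if "i < ?E" for i unfolding L_def using h that by (intro label_ge2) (auto simp: bij_betw_def)
  have RL: "charfun ?N {..<?E} L R = 0" using R(3) sum_h[of "\<lambda>n. R ^ n / qsum n R"] by (simp add: charfun_def)
  obtain m r where mr: "\<And>n. 2 \<le> m n" "\<And>n. (\<Sum>j<?N. 1 / real (filled ?E L (m n) j)) < real ?N - 2"
    "\<And>n. R \<le> r n" "\<And>n. 0 < r n" "\<And>n. r n < 1" "\<And>n. charfun ?N {..<?N} (filled ?E L (m n)) (r n) = 0"
    "r \<longlonglongrightarrow> R"
    using filled_roots[OF L2 EN _ R(1,2) RL] neg sum_h[of "\<lambda>n. 1 / real n"] by auto
  have N3: "3 \<le> ?N"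
  proof -
    have "0 \<le> (\<Sum>e\<in>edges. 1 / real (label e))" by (intro sum_nonneg) auto
    then show ?thesis using neg by simp
  qed
  have "\<exists>(H :: nat monoid) T k. coxeter_system H T k \<and> euler_characteristic (nerve H T) = 0 \<and> growth_rate H T = 1 / r n" for n
    by (rule cycle_system[OF N3 _ mr(2)[of n] mr(4)[of n] mr(5)[of n] mr(6)[of n]])
      (use mr(1)[of n] L2 in \<open>auto simp: filled_def\<close>)
  then obtain H :: "nat \<Rightarrow> nat monoid" and T :: "nat \<Rightarrow> nat set" and k' :: "nat \<Rightarrow> nat \<Rightarrow> nat \<Rightarrow> enat" where
    H: "\<And>n. coxeter_system (H n) (T n) (k' n)" "\<And>n. euler_characteristic (nerve (H n) (T n)) = 0"
    "\<And>n. growth_rate (H n) (T n) = 1 / r n" by metis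
  have "(\<lambda>n. 1 / r n) \<longlonglongrightarrow> 1 / R" using mr(7) R(1) by (intro tendsto_intros) auto
  then have "(\<lambda>n. growth_rate (H n) (T n)) \<longlonglongrightarrow> growth_rate G S" by (simp add: H gr)
  moreover have "growth_rate (H n) (T n) \<le> growth_rate G S" for n
    unfolding H gr using mr(3)[of n] R(1) by (intro divide_left_mono) (auto intro: mult_pos_pos mr)
  ultimately show ?thesis using pisot H by blast
qed

end
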